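(* Let $d\ge2$, $\alpha\in(0,1)$, and let $\mu$ be an $\alpha$-stable distribution on $\mathbb{R}^d$ with no shift, characteristic exponent $|z|^\alpha V(u_z)$, and spectral spherical measure $\lambda=P\omega$ where $0\ne P\in\mathcal{P}_{q,d}$ for some $q\in\mathbb{Z}_+$. Then the Fourier transform $\hat\mu$ is integrable and the density of $\mu$ is $$g(x)=\sum_{k=1}^\infty\frac{(-2^\alpha)^k\pi^{-d/2}}{k!\,|x|^{k\alpha+d}}\sum_{j=0}^{kq}\frac{\Gamma((j+k\alpha+d)/2)}{\Gamma((j-k\alpha)/2)}S_{j,k}(u_x),\qquad x\ne0.$$ The series converges absolutely and uniformly on $\{x:|x|\ge r\}$ for every $r>0$.
   Context: Let $d\ge 2$, $\mathbb{S}^{d-1}$ the unit sphere, $\omega$ its surface measure, $u_x=x/|x|$ for $x\ne0$. $\mathcal{P}_{q,d}$ is the set of restrictions to $\mathbb{S}^{d-1}$ of polynomials of degree at most $q$; $\pi_j$ is the orthogonal projection of $L^2(\mathbb{S}^{d-1},\omega)$ onto the space of spherical harmonics of degree $j$ (restrictions of homogeneous harmonic polynomials of degree $j$). An $\alpha$-stable distribution $\mu$ ($\alpha\ne1$) with no shift has $\hat\mu(z)=\int e^{i\langle x,z\rangle}\mu(dx)=\exp\{-|z|^\alpha V(u_z)\}$, $V(u)=\int_{\mathbb{S}^{d-1}}|\langle u,v\rangle|^\alpha[1-i\tan(\pi\alpha/2)\,\mathrm{sgn}\langle u,v\rangle]\lambda(dv)$, with $\lambda$ the spectral spherical measure. For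 integer $k\ge0$, $S_{j,k}=(-i)^j\pi_j(V^k)$. $1/\Gamma$ is the entire function vanishing at nonpositive integers. The density is $g(x)=(2\pi)^{-d}\int e^{-i\langle x,z\rangle}\hat\mu(z)dz$. *)

theory Defs
  imports "HOL-Probability.Probability"
begin

definition multi_indices :: "nat \<Rightarrow> ('a::euclidean_space \<Rightarrow> nat) set" where
  "multi_indices n = {m. (\<forall>b. b \<notin> Basis \<longrightarrow> m b = 0) \<and> sum m Basis \<le> n}"

definition homog_indices :: "nat \<Rightarrow> ('a::euclidean_space \<Rightarrow> nat) set" where
  "homog_indices n = {m. (\<forall>b. b \<notin> Basis \<longrightarrow> m b = 0) \<and> sum m Basis = n}"

definition poly_fun :: "('a::euclidean_space \<Rightarrow> nat) set \<Rightarrow> (('a \<Rightarrow> nat) \<Rightarrow> real) \<Rightarrow> 'a \<Rightarrow> real" where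
  "poly_fun M c x = (\<Sum>m\<in>M. c m * (\<Prod>b\<in>Basis. (x \<bullet> b) ^ m b))"

definition sphere_poly :: "nat \<Rightarrow> ('a::euclidean_space \<Rightarrow> real) \<Rightarrow> bool" where
  "sphere_poly q P \<longleftrightarrow> (\<exists>c. \<forall>u\<in>sphere 0 1. P u = poly_fun (multi_indices q) c u)"

definition laplacian :: "('a::euclidean_space \<Rightarrow> real) \<Rightarrow> 'a \<Rightarrow> real" where
  "laplacian f x = (\<Sum>b\<in>Basis. deriv (deriv (\<lambda>t. f (x + t *\<^sub>R b))) 0)"

definition homog_harmonic :: "nat \<Rightarrow> ('a::euclidean_space \<Rightarrow> real) \<Rightarrow> bool" where
  "homog_harmonic j f \<longleftrightarrow> (\<exists>c. f = poly_fun (homog_indices j) c) \<and> (\<forall>x. laplacian f x = 0)"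

definition spherical_harmonics :: "nat \<Rightarrow> ('a::euclidean_space \<Rightarrow> complex) set" where
  "spherical_harmonics j = {h. \<exists>f1 f2. homog_harmonic j f1 \<and> homog_harmonic j f2 \<and>
      h = (\<lambda>u. if u \<in> sphere 0 1 then complex_of_real (f1 u) + \<i> * complex_of_real (f2 u) else 0)}"

section \<open>Surface measure on the unit sphere (cone measure)\<close>

definition sphere_measure :: "'a::euclidean_space measure" where
  "sphere_measure = density
     (distr (restrict_space lborel (ball 0 1 - {0})) borel (\<lambda>x. x /\<^sub>R norm x))
     (\<lambda>_. ennreal (real DIM('a)))"

definition sph_proj :: "nat \<Rightarrow> ('a::euclidean_space \<Rightarrow> complex) \<Rightarrow> ('a \<Rightarrow> complex)" where
  "sph_proj j F = (THE h. h \<in> spherical_harmonics j \<and>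
      (\<forall>e\<in>spherical_harmonics j. (CLINT u|sphere_measure. (F u - h u) * cnj (e u)) = 0))"

definition stable_V :: "real \<Rightarrow> 'a::euclidean_space measure \<Rightarrow> 'a \<Rightarrow> complex" where
  "stable_V \<alpha> lam u = (CLINT v|lam. complex_of_real (\<bar>u \<bullet> v\<bar> powr \<alpha>) *
      (1 - \<i> * complex_of_real (tan (pi * \<alpha> / 2) * sgn (u \<bullet> v))))"

definition Sjk :: "real \<Rightarrow> 'a::euclidean_space measure \<Rightarrow> nat \<Rightarrow> nat \<Rightarrow> 'a \<Rightarrow> complex" where
  "Sjk \<alpha> lam j k = (\<lambda>u. (- \<i>) ^ j * sph_proj j (\<lambda>v. stable_V \<alpha> lam v ^ k) u)"

definition char_fun :: "'a::euclidean_space measure \<Rightarrow> 'a \<Rightarrow> complex" where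
  "char_fun M z = (CLINT x|M. cis (x \<bullet> z))"

definition inv_fourier_density :: "'a::euclidean_space measure \<Rightarrow> 'a \<Rightarrow> complex" where
  "inv_fourier_density M x = complex_of_real ((2 * pi) powr (- real DIM('a))) *
      (CLINT z|lborel. cis (- (x \<bullet> z)) * char_fun M z)"

definition stable_term :: "real \<Rightarrow> nat \<Rightarrow> 'a::euclidean_space measure \<Rightarrow> nat \<Rightarrow> 'a \<Rightarrow> complex" where
  "stable_term \<alpha> q lam k x =
     complex_of_real ((- (2 powr \<alpha>)) ^ k * pi powr (- real DIM('a) / 2)
        / (fact k * norm x powr (real k * \<alpha> + real DIM('a)))) *
     (\<Sum>j=0..k*q. complex_of_real (Gamma ((real j + real k * \<alpha> + real DIM('a)) / 2)
                    * rGamma ((real j - real k * \<alpha>) / 2))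
                  * Sjk \<alpha> lam j k (x /\<^sub>R norm x))"

end

theory Submission
  imports Defs "HOL-Complex_Analysis.Complex_Analysis"
begin

text \<open>
  By the Funk--Hecke formula \<open>V\<close> is a polynomial of degree \<open>q\<close> on the sphere, so \<open>V\<^sup>k\<close> is a sum of
  spherical harmonics of degree at most \<open>k q\<close>. Multiply the characteristic function by \<open>e\<^bsup>-\<epsilon>|z|\<^esup>\<close>,
  expand \<open>exp (-|z|\<^sup>\<alpha> V)\<close> in powers of \<open>V\<close> and integrate term by term in polar coordinates: a
  spherical harmonic \<open>Y\<close> of degree \<open>j\<close> contributes \<open>Y(x/|x|)\<close> times an explicit constant times
  \<open>\<integral> (\<epsilon>/|x| + i sin t)\<^bsup>-a\<^esup> cos\<^sup>n t dt\<close> over \<open>[-\<pi>/2, \<pi>/2]\<close>, with \<open>a = d + k \<alpha> + j\<close> and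
  \<open>n = 2 j + d - 2\<close>. Pushing the path of integration into the lower half plane, away from the zero of
  the sine, gives a bound uniform in \<open>\<epsilon>\<close> and the limit for \<open>\<epsilon> \<rightarrow> 0\<close>, which a recurrence in \<open>a\<close>
  and the Beta integral evaluate as a quotient of Gamma values. Since \<open>\<alpha> < 1\<close>, the numbers
  \<open>C\<^sup>k \<Gamma>(d + k \<alpha>) / k!\<close> are summable, so Tannery's theorem applies.
\<close>

section \<open>Homogeneous polynomials and the Laplacian\<close>

text \<open>The damping is forced: the radial factors r^(d - 1 + k \<alpha>) of the expanded series
  are not integrable. An exponential damping makes each radial integral an explicit complex power.
  At \<epsilon> = 0 the integral over the real arc diverges absolutely at t = 0, since a > 1, so
  estimates by absolute values on the real segment are useless; only the displaced path makes the
  cancellation visible. The bound has to beat \<Gamma>(d + k \<alpha> + j), which exceeds \<Gamma>(d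
  + k \<alpha>) by about j! times a factor geometric in j and k. The compensating 1 / j! comes from
  the sphere, as the ratio of \<open>sphere_fourier_const d j\<close> to the coefficient
  \<open>funk_hecke_coeff d j j\<close> through which the harmonic components are estimated. As j is
  at most k q, what remains is geometric in k. Surface calculus is avoided: sphere integrals of
  Laplacians are read off Gaussian integrals over the whole space, where integration by parts is
  translation invariance. That \<open>inv_fourier_density\<close> really is a density of \<mu> is a
  separate argument by Gaussian smoothing.\<close>

inductive hpoly :: "nat \<Rightarrow> ('a::euclidean_space \<Rightarrow> real) \<Rightarrow> bool" where
  const: "hpoly 0 (\<lambda>x. c)"
| coord: "b \<in> Basis \<Longrightarrow> hpoly n f \<Longrightarrow> hpoly (Suc n) (\<lambda>x. (x \<bullet> b) * f x)"
| add: "hpoly n f \<Longrightarrow> hpoly n g \<Longrightarrow> hpoly n (\<lambda>x. f x + g x)"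

lemma hpoly_scale: "hpoly n f \<Longrightarrow> hpoly n (\<lambda>x. c * f x)"
proof (induction rule: hpoly.induct)
  case (const a)
  then show ?case by (rule hpoly.const)
next
  case (coord b n f)
  then show ?case using hpoly.coord[OF coord(1), of n "\<lambda>x. c * f x"] by (simp add: mult.left_commute)
next
  case (add n f g)
  then show ?case using hpoly.add[OF add(3,4)] by (simp add: distrib_left)
qed

lemma hpoly_zero: "hpoly n (\<lambda>x::'a::euclidean_space. 0)"
proof (induction n)
  case 0
  then show ?case by (rule hpoly.const)
next
  case (Suc n)
  obtain b :: 'a where "b \<in> Basis" using nonempty_Basis by blast
  from hpoly.coord[OF this Suc] show ?case by simp
qed

lemma hpoly_sum: "finite A \<Longrightarrow> (\<And>i. i \<in> A \<Longrightarrow> hpoly n (f i)) \<Longrightarrow> hpoly n (\<lambda>x. \<Sum>i\<in>A. f i x)"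
  by (induction A rule: finite_induct) (auto intro: hpoly_zero hpoly.add)

lemma hpoly_diff: "hpoly n f \<Longrightarrow> hpoly n g \<Longrightarrow> hpoly n (\<lambda>x. f x - g x)"
  using hpoly.add[of n f "\<lambda>x. -1 * g x"] hpoly_scale[of n g "-1"] by simp

lemma hpoly_mult: "hpoly m f \<Longrightarrow> hpoly n g \<Longrightarrow> hpoly (m + n) (\<lambda>x. f x * g x)"
proof (induction rule: hpoly.induct)
  case (const c)
  then show ?case by (simp add: hpoly_scale)
next
  case (coord b m f)
  then show ?case using hpoly.coord[OF coord(1), of "m+n" "\<lambda>x. f x * g x"] by (simp add: mult.assoc)
next
  case (add m f h)
  then show ?case using hpoly.add[of "m+n" "\<lambda>x. f x * g x" "\<lambda>x. h x * g x"] by (simp add: distrib_right)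
qed

lemma hpoly_inner: "hpoly (Suc 0) (\<lambda>x. v \<bullet> x)"
proof -
  have "hpoly (Suc 0) (\<lambda>x. \<Sum>b\<in>Basis. (v \<bullet> b) * ((x \<bullet> b) * 1))"
    by (intro hpoly_sum finite_Basis hpoly_scale hpoly.coord hpoly.const)
  then show ?thesis by (subst euclidean_inner) simp
qed

lemma hpoly_norm2: "hpoly 2 (\<lambda>x. (norm x)\<^sup>2)"
proof -
  have "hpoly 2 (\<lambda>x. \<Sum>b\<in>Basis. (x \<bullet> b) * ((x \<bullet> b) * 1))"
    unfolding numeral_2_eq_2 by (intro hpoly_sum finite_Basis hpoly.coord hpoly.const)
  then show ?thesis by (subst power2_norm_eq_inner, subst euclidean_inner) simp
qed

lemma hpoly_power: "hpoly m f \<Longrightarrow> hpoly (n * m) (\<lambda>x. f x ^ n)"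
proof (induction n)
  case 0
  show ?case using hpoly.const[of 1] by simp
next
  case (Suc n)
  show ?case using hpoly_mult[OF Suc(2) Suc(1)[OF Suc(2)]] by simp
qed

lemma hpoly_continuous: "hpoly n f \<Longrightarrow> continuous_on A f"
  by (induction rule: hpoly.induct) (auto intro!: continuous_intros)

lemma hpoly_measurable [measurable_dest]: "hpoly n f \<Longrightarrow> f \<in> borel_measurable borel"
  using hpoly_continuous borel_measurable_continuous_onI by blast

lemma hpoly_homogeneous: "hpoly n f \<Longrightarrow> f (t *\<^sub>R x) = t ^ n * f x"
  by (induction rule: hpoly.induct) (auto simp: algebra_simps)

lemma hpoly_0_const: "hpoly n f \<Longrightarrow> n = 0 \<Longrightarrow> \<exists>c. f = (\<lambda>x. c)"
  by (induction rule: hpoly.induct) auto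

lemma hpoly_bound: "hpoly n f \<Longrightarrow> \<exists>B\<ge>0. \<forall>x. \<bar>f x\<bar> \<le> B * norm x ^ n"
proof -
  assume f: "hpoly n f"
  have "compact (f ` sphere 0 1)"
    by (intro compact_continuous_image hpoly_continuous[OF f] compact_sphere)
  then obtain B where B: "\<And>u. norm u = 1 \<Longrightarrow> \<bar>f u\<bar> \<le> B"
    by (metis bounded_iff compact_imp_bounded image_eqI mem_sphere_0 real_norm_def)
  \<comment> \<open>The summand with \<open>f 0\<close> covers the origin for \<open>n = 0\<close>,
    where \<open>0 ^ n = 1\<close>; for positive \<open>n\<close> homogeneity gives
    \<open>f 0 = 0\<close>.\<close>
  have "\<bar>f x\<bar> \<le> max 0 B * norm x ^ n + \<bar>f 0\<bar> * norm x ^ n" for x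
  proof (cases "x = 0")
    case True
    have "f 0 = 0 ^ n * f 0" using hpoly_homogeneous[OF f, of 0 0] by simp
    then show ?thesis using True by (cases n) (auto simp: max_def)
  next
    case False
    have "f x = norm x ^ n * f (x /\<^sub>R norm x)"
      using hpoly_homogeneous[OF f, of "norm x" "x /\<^sub>R norm x"] False by simp
    moreover have "\<bar>f (x /\<^sub>R norm x)\<bar> \<le> max 0 B" using B[of "x /\<^sub>R norm x"] False by simp
    ultimately have "\<bar>f x\<bar> \<le> norm x ^ n * max 0 B"
      by (simp add: abs_mult mult_left_mono)
    then show ?thesis by (simp add: mult.commute add_increasing2)
  qed
  then show ?thesis
    by (intro exI[of _ "max 0 B + \<bar>f 0\<bar>"]) (auto simp: distrib_right)
qed

section \<open>Directional derivatives and the Laplacian of homogeneous polynomials\<close>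

definition dir_deriv :: "'a::euclidean_space \<Rightarrow> ('a \<Rightarrow> real) \<Rightarrow> 'a \<Rightarrow> real" where
  "dir_deriv v f x = deriv (\<lambda>t. f (x + t *\<^sub>R v)) 0"

lemma dir_derivI:
  "((\<lambda>t. f (x + t *\<^sub>R v)) has_real_derivative D) (at 0) \<Longrightarrow> dir_deriv v f x = D"
  unfolding dir_deriv_def by (rule DERIV_imp_deriv)

text \<open>Truncated subtraction makes \<open>n - 1\<close> say only "constant" when
  \<open>n = 0\<close>, so the vanishing of the derivative is carried along as a third conjunct; the
  \<open>coord\<close> case uses it to keep \<open>(x \<bullet> b) * D x\<close> in degree
  \<open>n\<close>.\<close>

lemma hpoly_deriv_exists:
  "hpoly n f \<Longrightarrow> \<exists>D. (\<forall>x. ((\<lambda>t. f (x + t *\<^sub>R v)) has_real_derivative D x) (at 0)) \<and> hpoly (n - 1) D \<and> (n = 0 \<longrightarrow> D = (\<lambda>x. 0))"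
proof (induction rule: hpoly.induct)
  case (const c)
  then show ?case by (intro exI[of _ "\<lambda>x. 0"]) (auto intro: hpoly_zero)
next
  case (coord b n f)
  from coord.IH obtain D where D: "\<And>x. ((\<lambda>t. f (x + t *\<^sub>R v)) has_real_derivative D x) (at 0)"
      "hpoly (n - 1) D" "n = 0 \<longrightarrow> D = (\<lambda>x. 0)"
    by (elim exE conjE) metis
  have lin: "((\<lambda>t. (x + t *\<^sub>R v) \<bullet> b) has_real_derivative v \<bullet> b) (at 0)" for x
    by (auto intro!: derivative_eq_intros simp: inner_add_left)
  have "((\<lambda>t. ((x + t *\<^sub>R v) \<bullet> b) * f (x + t *\<^sub>R v)) has_real_derivative (v \<bullet> b) * f x + (x \<bullet> b) * D x) (at 0)" for x
    using DERIV_mult[OF lin[of x] D(1)[of x]] by (simp add: algebra_simps)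
  moreover have "hpoly n (\<lambda>x. (v \<bullet> b) * f x + (x \<bullet> b) * D x)"
  proof (rule hpoly.add)
    show "hpoly n (\<lambda>x. (v \<bullet> b) * f x)" by (rule hpoly_scale) fact
    show "hpoly n (\<lambda>x. (x \<bullet> b) * D x)"
    proof (cases n)
      case 0 then show ?thesis using D by (simp add: hpoly_zero)
    next
      case (Suc m) then show ?thesis using D hpoly.coord[OF coord(1)] by simp
    qed
  qed
  ultimately show ?case by (intro exI[of _ "\<lambda>x. (v \<bullet> b) * f x + (x \<bullet> b) * D x"]) simp
next
  case (add n f g)
  from add.IH(1) obtain D where
    D: "\<And>x. ((\<lambda>t. f (x + t *\<^sub>R v)) has_real_derivative D x) (at 0)"
      "hpoly (n - 1) D" "n = 0 \<longrightarrow> D = (\<lambda>x. 0)" by (elim exE conjE) metis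
  from add.IH(2) obtain E where
    E: "\<And>x. ((\<lambda>t. g (x + t *\<^sub>R v)) has_real_derivative E x) (at 0)"
      "hpoly (n - 1) E" "n = 0 \<longrightarrow> E = (\<lambda>x. 0)" by (elim exE conjE) metis
  show ?case
  proof (intro exI[of _ "\<lambda>x. D x + E x"] conjI allI impI)
    show "((\<lambda>t. f (x + t *\<^sub>R v) + g (x + t *\<^sub>R v)) has_real_derivative D x + E x) (at 0)" for x
      by (intro DERIV_add D E)
    show "hpoly (n - 1) (\<lambda>x. D x + E x)" by (intro hpoly.add D E)
    show "(\<lambda>x. D x + E x) = (\<lambda>x. 0)" if "n = 0" using D(3) E(3) that by simp
  qed
qed

lemma hpoly_dir_deriv:
  assumes "hpoly n f"
  shows "((\<lambda>t. f (x + t *\<^sub>R v)) has_real_derivative dir_deriv v f x) (at 0)"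
    and "hpoly (n - 1) (dir_deriv v f)" and "n = 0 \<Longrightarrow> dir_deriv v f = (\<lambda>x. 0)"
proof -
  obtain D where D: "\<And>x. ((\<lambda>t. f (x + t *\<^sub>R v)) has_real_derivative D x) (at 0)"
      "hpoly (n - 1) D" "n = 0 \<longrightarrow> D = (\<lambda>x. 0)"
    using hpoly_deriv_exists[OF assms, of v] by (elim exE conjE) metis
  have "dir_deriv v f = D" by (intro ext dir_derivI D(1))
  then show "((\<lambda>t. f (x + t *\<^sub>R v)) has_real_derivative dir_deriv v f x) (at 0)"
    "hpoly (n - 1) (dir_deriv v f)" "n = 0 \<Longrightarrow> dir_deriv v f = (\<lambda>x. 0)" using D by auto
qed

lemma hpoly_dir_deriv_at:
  assumes "hpoly n f"
  shows "((\<lambda>t. f (x + t *\<^sub>R v)) has_real_derivative dir_deriv v f (x + t *\<^sub>R v)) (at t)"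
proof -
  have "((\<lambda>s. f (x + (t + s) *\<^sub>R v)) has_real_derivative dir_deriv v f (x + t *\<^sub>R v)) (at 0)"
    using hpoly_dir_deriv(1)[OF assms, of "x + t *\<^sub>R v" v] by (simp add: scaleR_add_left add.assoc)
  then show ?thesis using DERIV_shift[of "\<lambda>s. f (x + s *\<^sub>R v)" _ 0 t] by (simp add: add.commute)
qed

lemma dir_deriv_add:
  "hpoly m f \<Longrightarrow> hpoly n g \<Longrightarrow> dir_deriv v (\<lambda>x. f x + g x) = (\<lambda>x. dir_deriv v f x + dir_deriv v g x)"
  by (intro ext dir_derivI DERIV_add hpoly_dir_deriv(1))

lemma dir_deriv_scale:
  "hpoly n f \<Longrightarrow> dir_deriv v (\<lambda>x. c * f x) = (\<lambda>x. c * dir_deriv v f x)"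
  by (intro ext dir_derivI DERIV_cmult hpoly_dir_deriv(1))

lemma dir_deriv_mult:
  assumes "hpoly m f" "hpoly n g"
  shows "dir_deriv v (\<lambda>x. f x * g x) = (\<lambda>x. dir_deriv v f x * g x + f x * dir_deriv v g x)"
  using DERIV_mult[OF hpoly_dir_deriv(1)[OF assms(1)] hpoly_dir_deriv(1)[OF assms(2)]]
  by (intro ext dir_derivI) (simp add: algebra_simps)

lemma dir_deriv_sum:
  "finite A \<Longrightarrow> (\<And>i. i \<in> A \<Longrightarrow> hpoly n (f i)) \<Longrightarrow>
    dir_deriv v (\<lambda>x. \<Sum>i\<in>A. f i x) = (\<lambda>x. \<Sum>i\<in>A. dir_deriv v (f i) x)"
  by (intro ext dir_derivI DERIV_sum hpoly_dir_deriv(1)) auto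

lemma dir_deriv_coord: "dir_deriv v (\<lambda>x. x \<bullet> b) = (\<lambda>x. v \<bullet> b)"
  by (intro ext dir_derivI) (auto intro!: derivative_eq_intros simp: inner_add_left)

lemma hpoly_coord: "hpoly (Suc 0) (\<lambda>x. x \<bullet> v)"
  using hpoly_inner[of v] by (simp add: inner_commute)

lemma hpoly_euler:
  assumes "hpoly n f" shows "dir_deriv x f x = real n * f x"
proof (rule dir_derivI)
  have "f (x + t *\<^sub>R x) = (1 + t) ^ n * f x" for t
    using hpoly_homogeneous[OF assms, of "1 + t" x] by (simp add: scaleR_add_left)
  moreover have "((\<lambda>t. (1 + t) ^ n * f x) has_real_derivative real n * f x) (at 0)"
    by (auto intro!: derivative_eq_intros)
  ultimately show "((\<lambda>t. f (x + t *\<^sub>R x)) has_real_derivative real n * f x) (at 0)" by simp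
qed

lemma dir_deriv_basis:
  assumes "hpoly n f" shows "dir_deriv v f x = (\<Sum>b\<in>Basis. (v \<bullet> b) * dir_deriv b f x)"
  using assms
proof (induction rule: hpoly.induct)
  case (const c)
  then show ?case by (simp add: dir_deriv_def)
next
  case (coord b n f)
  have v: "v \<bullet> b = (\<Sum>c\<in>Basis. (v \<bullet> c) * (c \<bullet> b))" for v :: 'a
    by (subst euclidean_inner) (simp add: inner_commute)
  have "dir_deriv v (\<lambda>x. (x \<bullet> b) * f x) x = (v \<bullet> b) * f x + (x \<bullet> b) * dir_deriv v f x" for v
    by (simp add: dir_deriv_mult[OF hpoly_coord coord(2)] dir_deriv_coord)
  then show ?case
    by (simp add: coord(3) v[of v] sum_distrib_left sum_distrib_right sum.distrib distrib_left mult.assoc mult.left_commute)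
next
  case (add n f g)
  then show ?case by (simp add: dir_deriv_add sum.distrib algebra_simps)
qed

lemma hpoly_euler_basis:
  assumes "hpoly n f" shows "(\<Sum>b\<in>Basis. (x \<bullet> b) * dir_deriv b f x) = real n * f x"
  using dir_deriv_basis[OF assms, of x x] hpoly_euler[OF assms] by simp

lemma laplacian_hpoly:
  assumes "hpoly n f" shows "laplacian f x = (\<Sum>b\<in>Basis. dir_deriv b (dir_deriv b f) x)"
proof -
  have "deriv (\<lambda>t. f (x + t *\<^sub>R b)) = (\<lambda>t. dir_deriv b f (x + t *\<^sub>R b))" for b
    by (intro ext DERIV_imp_deriv hpoly_dir_deriv_at[OF assms])
  then show ?thesis unfolding laplacian_def by (simp add: dir_deriv_def)
qed

lemma hpoly_laplacian:
  assumes "hpoly n f" shows "hpoly (n - 2) (laplacian f)"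
proof -
  have "laplacian f = (\<lambda>x. \<Sum>b\<in>Basis. dir_deriv b (dir_deriv b f) x)"
    using laplacian_hpoly[OF assms] by blast
  moreover have "hpoly (n - 2) (dir_deriv b (dir_deriv b f))" for b
    using hpoly_dir_deriv(2)[OF hpoly_dir_deriv(2)[OF assms]] by (simp add: numeral_2_eq_2)
  ultimately show ?thesis by (simp add: hpoly_sum)
qed

lemma laplacian_low:
  assumes "hpoly n f" "n < 2" shows "laplacian f x = 0"
proof -
  have "n - 1 = 0" using assms by simp
  then show ?thesis
    using laplacian_hpoly[OF assms(1)] hpoly_dir_deriv(3)[OF hpoly_dir_deriv(2)[OF assms(1)]] by simp
qed

lemma laplacian_add:
  assumes "hpoly n f" "hpoly n g"
  shows "laplacian (\<lambda>x. f x + g x) x = laplacian f x + laplacian g x"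
  using assms hpoly_dir_deriv(2)[OF assms(1)] hpoly_dir_deriv(2)[OF assms(2)]
  by (simp add: laplacian_hpoly[of n] hpoly.add dir_deriv_add[of n _ n] dir_deriv_add[of "n - Suc 0" _ "n - Suc 0"] sum.distrib)

lemma laplacian_scale:
  assumes "hpoly n f"
  shows "laplacian (\<lambda>x. c * f x) x = c * laplacian f x"
  using assms hpoly_dir_deriv(2)[OF assms(1)] 
  by (simp add: laplacian_hpoly[of n] hpoly_scale dir_deriv_scale dir_deriv_scale[of "n - Suc 0"] sum_distrib_left)

lemma laplacian_diff:
  assumes "hpoly n f" "hpoly n g"
  shows "laplacian (\<lambda>x. f x - g x) x = laplacian f x - laplacian g x"
  using laplacian_add[OF assms(1) hpoly_scale[OF assms(2), of "-1"]] laplacian_scale[OF assms(2), of "-1"]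
  by simp

lemma laplacian_mult:
  assumes f: "hpoly m f" and g: "hpoly n g"
  shows "laplacian (\<lambda>x. f x * g x) x =
    f x * laplacian g x + 2 * (\<Sum>b\<in>Basis. dir_deriv b f x * dir_deriv b g x) + g x * laplacian f x"
proof -
  note d = hpoly_dir_deriv(2)[OF f] hpoly_dir_deriv(2)[OF g]
  have "dir_deriv b (dir_deriv b (\<lambda>x. f x * g x)) x =
     dir_deriv b (dir_deriv b f) x * g x + 2 * (dir_deriv b f x * dir_deriv b g x) + f x * dir_deriv b (dir_deriv b g) x" for b
  proof -
    have "hpoly (m - 1 + n) (\<lambda>x. dir_deriv b f x * g x)" "hpoly (m + (n - 1)) (\<lambda>x. f x * dir_deriv b g x)"
      using hpoly_mult d f g by blast+
    then show ?thesis
      by (simp add: dir_deriv_mult[OF f g] dir_deriv_mult[OF d(1) g] dir_deriv_mult[OF f d(2)] dir_deriv_add)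
  qed
  then show ?thesis
    by (simp add: laplacian_hpoly[OF hpoly_mult[OF f g]] laplacian_hpoly[OF f] laplacian_hpoly[OF g]
        sum.distrib sum_distrib_left algebra_simps)
qed

lemma dir_deriv_norm2: "dir_deriv v (\<lambda>x. (norm x)\<^sup>2) x = 2 * (x \<bullet> v)"
proof -
  have "(\<lambda>t. (norm (x + t *\<^sub>R v))\<^sup>2) = (\<lambda>t. x \<bullet> x + 2 * t * (x \<bullet> v) + t\<^sup>2 * (v \<bullet> v))"
    unfolding power2_norm_eq_inner inner_add_left inner_add_right by (simp add: power2_eq_square fun_eq_iff inner_commute)
  then show ?thesis by (intro dir_derivI) (auto intro!: derivative_eq_intros)
qed

text \<open>In the product rule, \<open>2 * DIM('a)\<close> is the Laplacian of |x|^2, and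
  \<open>4 * n\<close> comes from the cross term, because the gradient of |x|^2 is 2 x and Euler's
  identity evaluates the derivative of \<open>f\<close> along x.\<close>

lemma laplacian_norm2_mult:
  fixes f :: "'a::euclidean_space \<Rightarrow> real"
  assumes f: "hpoly n f"
  shows "laplacian (\<lambda>x. (norm x)\<^sup>2 * f x) x = (norm x)\<^sup>2 * laplacian f x + (4 * real n + 2 * real DIM('a)) * f x"
proof -
  have "laplacian (\<lambda>x::'a. (norm x)\<^sup>2) x = 2 * real DIM('a)"
  proof -
    have "dir_deriv b (\<lambda>x. (norm x)\<^sup>2) = (\<lambda>x. 2 * (x \<bullet> b))" for b :: 'a
      using dir_deriv_norm2 by blast
    then show ?thesis
      by (simp add: laplacian_hpoly[OF hpoly_norm2] dir_deriv_scale[OF hpoly_coord] dir_deriv_coord)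
  qed
  moreover have "(\<Sum>b\<in>Basis. dir_deriv b (\<lambda>x. (norm x)\<^sup>2) x * dir_deriv b f x) = 2 * (real n * f x)"
    by (simp add: dir_deriv_norm2 hpoly_euler_basis[OF f, symmetric] sum_distrib_left mult.assoc)
  ultimately show ?thesis
    unfolding laplacian_mult[OF hpoly_norm2 f] by (simp add: algebra_simps)
qed

text \<open>Substituting \<open>g = (f - |x|\<^sup>2 w) / c\<close> with \<open>w = \<Delta> g\<close> gives the same equation for \<open>w\<close>
  in degree \<open>n - 2\<close> with a larger constant, so the equation is solved by descent.\<close>

lemma laplacian_resolvent:
  fixes f :: "'a::euclidean_space \<Rightarrow> real"
  assumes "hpoly n f" "c > 0"
  shows "\<exists>g. hpoly n g \<and> (\<forall>x. (norm x)\<^sup>2 * laplacian g x + c * g x = f x)"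
  using assms
proof (induction n arbitrary: f c rule: less_induct)
  case (less n)
  show ?case
  proof (cases "n < 2")
    case True
    have "hpoly n (\<lambda>x. (1/c) * f x)" using less by (intro hpoly_scale)
    then show ?thesis using laplacian_low[OF _ True] less(3)
      by (intro exI[of _ "\<lambda>x. (1/c) * f x"]) (auto simp: field_simps)
  next
    case False
    define c' where "c' = c + 4 * real (n - 2) + 2 * real DIM('a)"
    have "n - 2 < n" "c' > 0" using False less(3) by (auto simp: c'_def add_pos_nonneg)
    from less(1)[OF this(1) hpoly_laplacian[OF less(2)] this(2)] obtain w where
      w: "hpoly (n - 2) w" "\<And>x. (norm x)\<^sup>2 * laplacian w x + c' * w x = laplacian f x" by blast
    have nw: "hpoly n (\<lambda>x. (norm x)\<^sup>2 * w x)"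
      using hpoly_mult[OF hpoly_norm2 w(1)] le_add_diff_inverse[of 2 n] False by (simp del: le_add_diff_inverse)
    have d: "hpoly n (\<lambda>x. f x - (norm x)\<^sup>2 * w x)" by (rule hpoly_diff[OF less(2) nw])
    have "laplacian (\<lambda>x. (1/c) * (f x - (norm x)\<^sup>2 * w x)) x = w x" for x
    proof -
      have "laplacian (\<lambda>x. f x - (norm x)\<^sup>2 * w x) x = c * w x"
        using w(2)[of x]
        unfolding laplacian_diff[OF less(2) nw] laplacian_norm2_mult[OF w(1)] by (simp add: c'_def algebra_simps)
      then show ?thesis using less(3) by (simp only: laplacian_scale[OF d]) simp
    qed
    then show ?thesis using hpoly_scale[OF d, of "1/c"] less(3)
      by (intro exI[of _ "\<lambda>x. (1/c) * (f x - (norm x)\<^sup>2 * w x)"]) (auto simp: field_simps)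
  qed
qed

text \<open>By \<open>laplacian_norm2_mult\<close>, f - |x|^2 s is harmonic exactly when
  \<open>s\<close> solves the resolvent equation for the Laplacian of \<open>f\<close> with constant
  4 n + 2 d.\<close>

lemma harmonic_split:
  fixes f :: "'a::euclidean_space \<Rightarrow> real"
  assumes "hpoly (n + 2) f"
  shows "\<exists>s. hpoly n s \<and> hpoly (n + 2) (\<lambda>x. f x - (norm x)\<^sup>2 * s x) \<and>
    (\<forall>x. laplacian (\<lambda>x. f x - (norm x)\<^sup>2 * s x) x = 0)"
proof -
  have "4 * real n + 2 * real DIM('a) > 0" by (simp add: add_nonneg_pos)
  from laplacian_resolvent[OF hpoly_laplacian[OF assms] this] obtain s where
    s: "hpoly n s" "\<And>x. (norm x)\<^sup>2 * laplacian s x + (4 * real n + 2 * real DIM('a)) * s x = laplacian f x"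
    by auto
  have ns: "hpoly (n + 2) (\<lambda>x. (norm x)\<^sup>2 * s x)"
    using hpoly_mult[OF hpoly_norm2 s(1)] by (simp add: add.commute)
  show ?thesis
    using s hpoly_diff[OF assms ns]
    by (intro exI[of _ s]) (simp add: laplacian_diff[OF assms ns] laplacian_norm2_mult[OF s(1)])
qed

section \<open>Comparison with polynomials given by coefficients\<close>

lemma finite_homog_indices: "finite (homog_indices n :: ('a::euclidean_space \<Rightarrow> nat) set)"
proof -
  have "homog_indices n \<subseteq> PiE_dflt Basis 0 (\<lambda>b::'a. {..n})"
  proof
    fix m :: "'a \<Rightarrow> nat" assume m: "m \<in> homog_indices n"
    have "m b \<le> n" if "b \<in> Basis" for b
    proof -
      have "m b \<le> sum m Basis" using that by (intro member_le_sum) auto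
      then show ?thesis using m by (simp add: homog_indices_def)
    qed
    then show "m \<in> PiE_dflt Basis 0 (\<lambda>b::'a. {..n})" using m
      by (auto simp: PiE_dflt_def homog_indices_def)
  qed
  moreover have "finite (PiE_dflt Basis 0 (\<lambda>b::'a. {..n}))" by (intro finite_PiE_dflt) auto
  ultimately show ?thesis by (rule finite_subset)
qed

lemma hpoly_monomial: "hpoly (sum m A) (\<lambda>x. \<Prod>b\<in>A. (x \<bullet> b) ^ m b)" if "finite A"
  using that
proof (induction A rule: finite_induct)
  case empty
  then show ?case by (simp add: hpoly.const)
next
  case (insert b A)
  then show ?case using hpoly_mult[OF hpoly_power[OF hpoly_coord[of b], of "m b"] insert(3)] by simp
qed

lemma hpoly_poly_fun: "hpoly n (poly_fun (homog_indices n) c)"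
proof -
  have "hpoly n (\<lambda>x. c m * (\<Prod>b\<in>Basis. (x \<bullet> b) ^ m b))" if "m \<in> homog_indices n" for m
    using hpoly_scale[OF hpoly_monomial[OF finite_Basis, of m]] that by (simp add: homog_indices_def)
  then show ?thesis unfolding poly_fun_def[abs_def] by (intro hpoly_sum finite_homog_indices)
qed

lemma hpoly_imp_poly_fun:
  assumes "hpoly n f" shows "\<exists>c. f = poly_fun (homog_indices n) c"
  using assms
proof (induction rule: hpoly.induct)
  case (const c)
  have "homog_indices 0 = {\<lambda>b::'a. 0}" by (auto simp: homog_indices_def)
  then show ?case by (intro exI[of _ "\<lambda>_. c"]) (simp add: poly_fun_def fun_eq_iff)
next
  case (coord b n f)
  then obtain c where c: "f = poly_fun (homog_indices n) c" by blast
  let ?u = "\<lambda>m::'a\<Rightarrow>nat. m(b := Suc (m b))"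
  let ?d = "\<lambda>m::'a\<Rightarrow>nat. m(b := m b - 1)"
  have inj: "inj_on ?u (homog_indices n)"
    by (rule inj_on_inverseI[of _ ?d]) auto
  have sub: "?u ` homog_indices n \<subseteq> homog_indices (Suc n)"
  proof safe
    fix m :: "'a \<Rightarrow> nat" assume m: "m \<in> homog_indices n"
    have "sum (?u m) Basis = Suc (sum m Basis)"
      using coord(1) by (simp add: sum.remove[OF finite_Basis coord(1)])
    then show "?u m \<in> homog_indices (Suc n)" using m coord(1) by (auto simp: homog_indices_def)
  qed
  \<comment> \<open>The coefficients are transported along the exponent shift \<open>?u\<close>;
    multi-indices outside its range are those in which \<open>b\<close> does not occur.\<close>
  define e where "e m = (if m \<in> ?u ` homog_indices n then c (?d m) else 0)" for m
  have mono: "(\<Prod>a\<in>Basis. (x \<bullet> a) ^ (?u m) a) = (x \<bullet> b) * (\<Prod>a\<in>Basis. (x \<bullet> a) ^ m a)" for x m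
    using coord(1) by (simp add: prod.remove[OF finite_Basis coord(1)])
  have "poly_fun (homog_indices (Suc n)) e x = (x \<bullet> b) * f x" for x
  proof -
    have "poly_fun (homog_indices (Suc n)) e x = poly_fun (?u ` homog_indices n) e x"
      unfolding poly_fun_def using sub
      by (intro sum.mono_neutral_right finite_homog_indices) (auto simp: e_def)
    also have "\<dots> = (\<Sum>m\<in>homog_indices n. e (?u m) * (\<Prod>a\<in>Basis. (x \<bullet> a) ^ (?u m) a))"
      unfolding poly_fun_def by (rule sum.reindex[OF inj, unfolded o_def])
    also have "\<dots> = (\<Sum>m\<in>homog_indices n. (x \<bullet> b) * (c m * (\<Prod>a\<in>Basis. (x \<bullet> a) ^ m a)))"
      by (intro sum.cong refl) (simp only: mono, simp add: e_def)
    finally show ?thesis by (simp add: c poly_fun_def sum_distrib_left)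
  qed
  then show ?case by (intro exI[of _ e]) auto
next
  case (add n f g)
  then obtain c d where "f = poly_fun (homog_indices n) c" "g = poly_fun (homog_indices n) d" by blast
  then show ?case
    by (intro exI[of _ "\<lambda>m. c m + d m"]) (simp add: poly_fun_def fun_eq_iff sum.distrib distrib_right)
qed

text \<open>From here on, induction on \<open>hpoly\<close> replaces sums over multi-indices: the
  coefficient form is awkward under products and derivatives, while each rule of
  \<open>hpoly\<close> is a one-line computation.\<close>

lemma homog_harmonic_iff: "homog_harmonic n f \<longleftrightarrow> hpoly n f \<and> (\<forall>x. laplacian f x = 0)"
  unfolding homog_harmonic_def using hpoly_imp_poly_fun hpoly_poly_fun by blast


section \<open>Polar coordinates\<close>

definition radial_measure :: "nat \<Rightarrow> real measure" where
  "radial_measure d = density lborel (\<lambda>r. indicator {0<..} r * ennreal (r ^ (d - 1)))"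

lemma sets_sphere_measure [simp, measurable_cong]: "sets sphere_measure = sets borel"
  and space_sphere_measure [simp]: "space sphere_measure = UNIV"
  by (simp_all add: sphere_measure_def)

lemma sets_radial_measure [simp, measurable_cong]: "sets (radial_measure d) = sets borel"
  and space_radial_measure [simp]: "space (radial_measure d) = UNIV"
  by (simp_all add: radial_measure_def)

lemma measurable_unit_direction:
  "(\<lambda>x::'a::euclidean_space. x /\<^sub>R norm x) \<in> measurable (restrict_space lborel (ball 0 1 - {0})) borel"
  by (intro measurable_restrict_space1) measurable

text \<open>The cone description of surface measure: the factor d undoes the 1 / d that the radial
  integral of r^(d - 1) over the unit interval contributes.\<close>

lemma nn_integral_sphere_measure:
  fixes f :: "'a::euclidean_space \<Rightarrow> ennreal"
  assumes [measurable]: "f \<in> borel_measurable borel"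
  shows "(\<integral>\<^sup>+u. f u \<partial>sphere_measure) =
    ennreal (real DIM('a)) * (\<integral>\<^sup>+y. f (y /\<^sub>R norm y) * indicator (ball 0 1 - {0}) y \<partial>lborel)"
proof -
  let ?D = "distr (restrict_space lborel (ball 0 1 - {0})) borel (\<lambda>x::'a. x /\<^sub>R norm x)"
  have "(\<integral>\<^sup>+u. f u \<partial>sphere_measure) = (\<integral>\<^sup>+u. ennreal (real DIM('a)) * f u \<partial>?D)"
    unfolding sphere_measure_def by (subst nn_integral_density) auto
  also have "\<dots> = ennreal (real DIM('a)) * (\<integral>\<^sup>+u. f u \<partial>?D)"
    by (subst nn_integral_cmult) auto
  also have "(\<integral>\<^sup>+u. f u \<partial>?D) = (\<integral>\<^sup>+y. f (y /\<^sub>R norm y) \<partial>restrict_space lborel (ball 0 1 - {0}))"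
    by (subst nn_integral_distr) (auto intro: measurable_unit_direction)
  also have "\<dots> = (\<integral>\<^sup>+y. f (y /\<^sub>R norm y) * indicator (ball 0 1 - {0}) y \<partial>lborel)"
    by (subst nn_integral_restrict_space) auto
  finally show ?thesis .
qed

lemma nn_integral_lborel_scaleR:
  fixes f :: "'a::euclidean_space \<Rightarrow> ennreal"
  assumes [measurable]: "f \<in> borel_measurable borel" and "c > 0"
  shows "(\<integral>\<^sup>+x. f x \<partial>lborel) = ennreal (c ^ DIM('a)) * (\<integral>\<^sup>+x. f (c *\<^sub>R x) \<partial>lborel)"
proof -
  have "c \<noteq> 0" using assms by simp
  show ?thesis
    by (subst lborel_affine[OF \<open>c \<noteq> 0\<close>, of 0])
       (use assms in \<open>simp add: nn_integral_density nn_integral_distr nn_integral_cmult\<close>)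
qed

lemma emeasure_sphere_measure_UNIV:
  "emeasure (sphere_measure :: 'a::euclidean_space measure) UNIV = ennreal (2 * pi powr (real DIM('a) / 2) / Gamma (real DIM('a) / 2))"
proof -
  let ?d = "real DIM('a)"
  have d: "?d > 0" by simp
  have "emeasure (sphere_measure :: 'a measure) UNIV = (\<integral>\<^sup>+u. 1 \<partial>(sphere_measure :: 'a measure))"
    by simp
  also have "\<dots> = ennreal ?d * (\<integral>\<^sup>+y. 1 * indicator (ball 0 1 - {0::'a}) y \<partial>lborel)"
    by (rule nn_integral_sphere_measure) simp
  also have "(\<integral>\<^sup>+y. 1 * indicator (ball 0 1 - {0::'a}) y \<partial>lborel) = emeasure lborel (ball 0 1 - {0::'a})"
    by simp
  also have "\<dots> = emeasure lborel (ball 0 1 :: 'a set)"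
    by (rule emeasure_Diff_null_set) auto
  also have "\<dots> = ennreal (unit_ball_vol ?d)"
    by (subst emeasure_ball) auto
  also have "ennreal ?d * \<dots> = ennreal (?d * unit_ball_vol ?d)"
    by (rule ennreal_mult'[symmetric]) simp
  also have "?d * unit_ball_vol ?d = 2 * pi powr (?d / 2) / Gamma (?d / 2)"
  proof -
    have "Gamma (?d / 2 + 1) = ?d / 2 * Gamma (?d / 2)" using d using nonpos_Ints_nonpos[of "?d / 2"] d by (intro Gamma_plus1) force
    then show ?thesis unfolding unit_ball_vol_def using d by (simp only:) simp
  qed
  finally show ?thesis .
qed

global_interpretation sphere_measure: finite_measure "sphere_measure :: 'a::euclidean_space measure"
  by (rule finite_measureI) (simp add: emeasure_sphere_measure_UNIV)

text \<open>The primitive for the integral over the dilation factor that remains in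
  \<open>nn_integral_polar\<close>.\<close>

lemma has_real_derivative_inverse_power:
  fixes s :: real assumes "s > 0"
  shows "((\<lambda>s. - (R / s ^ n)) has_real_derivative R * real n / s ^ (n + 1)) (at s)"
proof (cases n)
  case (Suc m)
  have "s ^ n \<noteq> 0" using assms by simp
  then have "((\<lambda>s. - R * inverse (s ^ n)) has_real_derivative - R * - (inverse (s ^ n) * (real n * s ^ (n - 1)) * inverse (s ^ n))) (at s)"
    by (intro DERIV_cmult DERIV_inverse' DERIV_pow[THEN DERIV_subset]) auto
  moreover have "- R * - (inverse (s ^ n) * (real n * s ^ (n - 1)) * inverse (s ^ n)) = R * real n / s ^ (n + 1)"
    using assms Suc by (simp add: field_simps)
  moreover have "(\<lambda>s. - R * inverse (s ^ n)) = (\<lambda>s. - (R / s ^ n))" by (simp add: fun_eq_iff divide_inverse)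
  ultimately show ?thesis by (simp only:)
qed simp

text \<open>Write the sphere integral as an integral over the punctured unit ball and substitute
  \<open>r = s |y|\<close>, then \<open>x = s y\<close>; the remaining inner integral over \<open>s > |x|\<close> equals \<open>1\<close>.\<close>

lemma nn_integral_polar:
  fixes f :: "'a::euclidean_space \<Rightarrow> ennreal"
  assumes [measurable]: "f \<in> borel_measurable borel"
  shows "(\<integral>\<^sup>+x. f x \<partial>lborel) =
    (\<integral>\<^sup>+r. (\<integral>\<^sup>+u. f (r *\<^sub>R u) \<partial>sphere_measure) \<partial>radial_measure DIM('a))"
proof -
  let ?d = "DIM('a)"
  let ?B = "ball 0 1 - {0::'a}"
  let ?D = "ennreal (real ?d)"
  let ?P = "indicator {0<..} :: real \<Rightarrow> ennreal"
  have d: "?d > 0" by simp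
  have [measurable]: "?B \<in> sets borel" by (intro sets.Diff) auto
  have dS: "\<And>x::real. x ^ ?d = x * x ^ (?d - 1)" using d by (metis Suc_pred' power_Suc)
  have meas1: "(\<lambda>r. \<integral>\<^sup>+u. f (r *\<^sub>R u) \<partial>sphere_measure) \<in> borel_measurable borel"
    by measurable
  have inner: "(\<integral>\<^sup>+r. ?P r * ennreal (r ^ (?d - 1)) * f (r *\<^sub>R (y /\<^sub>R norm y)) \<partial>lborel) * indicator ?B y =
      (\<integral>\<^sup>+s. ?P s * ennreal (s ^ (?d - 1)) * ennreal (norm y ^ ?d) * f (s *\<^sub>R y) * indicator ?B y \<partial>lborel)" for y
  proof (cases "y \<in> ?B")
    case True
    then have ny: "norm y > 0" by simp
    have "(\<integral>\<^sup>+r. ?P r * ennreal (r ^ (?d - 1)) * f (r *\<^sub>R (y /\<^sub>R norm y)) \<partial>lborel) =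
      ennreal \<bar>norm y\<bar> * (\<integral>\<^sup>+s. ?P (0 + norm y * s) * ennreal ((0 + norm y * s) ^ (?d - 1)) * f ((0 + norm y * s) *\<^sub>R (y /\<^sub>R norm y)) \<partial>lborel)"
      using ny by (intro nn_integral_real_affine) auto
    also have "\<dots> = (\<integral>\<^sup>+s. ennreal (norm y) * (?P (norm y * s) * ennreal ((norm y * s) ^ (?d - 1)) * f (s *\<^sub>R y)) \<partial>lborel)"
    proof -
      have "(norm y * s) *\<^sub>R (y /\<^sub>R norm y) = s *\<^sub>R y" for s using ny by simp
      then show ?thesis by (subst nn_integral_cmult) (simp_all only: abs_norm_cancel add_0_left, measurable)
    qed
    also have "\<dots> = (\<integral>\<^sup>+s. ?P s * ennreal (s ^ (?d - 1)) * ennreal (norm y ^ ?d) * f (s *\<^sub>R y) \<partial>lborel)"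
    proof (intro nn_integral_cong)
      fix s :: real
      show "ennreal (norm y) * (?P (norm y * s) * ennreal ((norm y * s) ^ (?d - 1)) * f (s *\<^sub>R y)) =
        ?P s * ennreal (s ^ (?d - 1)) * ennreal (norm y ^ ?d) * f (s *\<^sub>R y)"
      proof (cases "s > 0")
        case True
        then have "ennreal (norm y) * ennreal ((norm y * s) ^ (?d - 1)) = ennreal (s ^ (?d - 1)) * ennreal (norm y ^ ?d)"
          using ny by (simp add: ennreal_mult'[symmetric] dS power_mult_distrib mult_ac)
        then show ?thesis using True ny by (simp add: mult.assoc[symmetric])
      next
        case False
        then show ?thesis using ny by (simp add: zero_less_mult_iff)
      qed
    qed
    finally show ?thesis using True by simp
  qed simp
  have outer: "(\<integral>\<^sup>+y. ?P s * ennreal (s ^ (?d - 1)) * ennreal (norm y ^ ?d) * f (s *\<^sub>R y) * indicator ?B y \<partial>lborel) =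
      (\<integral>\<^sup>+x. ?P s * ennreal (norm x ^ ?d / s ^ (?d + 1)) * f x * indicator {x. 0 < norm x \<and> norm x < s} x \<partial>lborel)" for s :: real
  proof (cases "s > 0")
    case True
    let ?h = "\<lambda>x::'a. ?P s * ennreal (norm x ^ ?d / s ^ (?d + 1)) * f x * indicator {x. 0 < norm x \<and> norm x < s} x"
    have "(\<integral>\<^sup>+x. ?h x \<partial>lborel) = ennreal (s ^ ?d) * (\<integral>\<^sup>+x. ?h (s *\<^sub>R x) \<partial>lborel)"
      using True by (intro nn_integral_lborel_scaleR) auto
    also have "\<dots> = (\<integral>\<^sup>+x. ennreal (s ^ ?d) * ?h (s *\<^sub>R x) \<partial>lborel)"
      by (subst nn_integral_cmult) auto
    also have "\<dots> = (\<integral>\<^sup>+y. ?P s * ennreal (s ^ (?d - 1)) * ennreal (norm y ^ ?d) * f (s *\<^sub>R y) * indicator ?B y \<partial>lborel)"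
    proof (intro nn_integral_cong)
      fix y :: 'a
      have "indicator {x. 0 < norm x \<and> norm x < s} (s *\<^sub>R y) = (indicator ?B y :: ennreal)"
        using True by (auto simp: indicator_def)
      moreover have "ennreal (s ^ ?d) * ennreal (norm (s *\<^sub>R y) ^ ?d / s ^ (?d + 1)) = ennreal (s ^ (?d - 1)) * ennreal (norm y ^ ?d)"
        using True by (simp add: ennreal_mult'[symmetric] dS power_mult_distrib field_simps)
      ultimately show "ennreal (s ^ ?d) * ?h (s *\<^sub>R y) = ?P s * ennreal (s ^ (?d - 1)) * ennreal (norm y ^ ?d) * f (s *\<^sub>R y) * indicator ?B y"
        using True by (simp add: mult.assoc[symmetric])
    qed
    finally show ?thesis by simp
  qed simp
  have last: "(\<integral>\<^sup>+s. ?P s * ennreal (norm x ^ ?d / s ^ (?d + 1)) * f x * indicator {x. 0 < norm x \<and> norm x < s} x \<partial>lborel) * ?D = f x"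
    if "x \<noteq> 0" for x :: 'a
  proof -
    let ?r = "norm x"
    have r: "?r > 0" using that by simp
    have "((\<lambda>s::real. - (1 / s ^ ?d)) \<longlongrightarrow> - 0) at_top"
      using d by (intro tendsto_intros tendsto_divide_0[OF tendsto_const] filterlim_at_top_imp_at_infinity filterlim_pow_at_top filterlim_ident) auto
    then have "((\<lambda>s::real. - (?r ^ ?d / s ^ ?d)) \<longlongrightarrow> 0) at_top"
      using tendsto_mult_right_zero[of "\<lambda>s::real. - (1 / s ^ ?d)" at_top "?r ^ ?d"] by simp
    then have "(\<integral>\<^sup>+s. ennreal (?r ^ ?d * real ?d / s ^ (?d + 1)) * indicator {?r..} s \<partial>lborel) = ennreal (0 - (- (?r ^ ?d / ?r ^ ?d)))"
    proof (rule nn_integral_FTC_atLeast[rotated 3])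
      fix s assume "?r \<le> s"
      then have "s > 0" using r by linarith
      then show "((\<lambda>s. - (?r ^ ?d / s ^ ?d)) has_real_derivative ?r ^ ?d * real ?d / s ^ (?d + 1)) (at s)"
        by (rule has_real_derivative_inverse_power)
      show "0 \<le> ?r ^ ?d * real ?d / s ^ (?d + 1)" using \<open>s > 0\<close> by simp
    qed simp
    then have one: "(\<integral>\<^sup>+s. ennreal (?r ^ ?d * real ?d / s ^ (?d + 1)) * indicator {?r..} s \<partial>lborel) = 1" using r by simp
    have "(\<integral>\<^sup>+s. ?P s * ennreal (?r ^ ?d / s ^ (?d + 1)) * f x * indicator {x. 0 < norm x \<and> norm x < s} x \<partial>lborel) * ?D =
       (\<integral>\<^sup>+s. f x * (ennreal (?r ^ ?d * real ?d / s ^ (?d + 1)) * indicator {?r..} s) \<partial>lborel)"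
    proof (subst nn_integral_multc[symmetric], goal_cases)
      case 2
      \<comment> \<open>The condition \<open>norm x < s\<close> is strict, whereas the half-line in
        the fundamental theorem is closed; the two differ in one null point.\<close>
      have "AE s in lborel. s \<noteq> ?r" by (rule AE_lborel_singleton)
      then show ?case
      proof (intro nn_integral_cong_AE, eventually_elim)
        case (elim s)
        show ?case
        proof (cases "?r < s")
          case True
          then have s: "s > 0" using r by linarith
          have "ennreal (?r ^ ?d * real ?d / s ^ (?d + 1)) = ennreal (?r ^ ?d / s ^ (?d + 1)) * ?D"
            using s by (subst ennreal_mult'[symmetric]) auto
          moreover have "?P s = 1" using s by simp
          moreover have "indicator {x. 0 < norm x \<and> norm x < s} x = (1::ennreal)" "indicator {?r..} s = (1::ennreal)" using True r by auto
          ultimately show ?thesis by (simp only: mult_1_left mult_1_right) (simp only: mult_ac)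
        next
          case False
          then show ?thesis using elim by simp
        qed
      qed
    qed measurable
    also have "\<dots> = f x" by (subst nn_integral_cmult, measurable) (simp only: one mult_1_right)
    finally show ?thesis .
  qed
  have "(\<integral>\<^sup>+r. (\<integral>\<^sup>+u. f (r *\<^sub>R u) \<partial>sphere_measure) \<partial>radial_measure DIM('a)) =
     (\<integral>\<^sup>+r. ?P r * ennreal (r ^ (?d - 1)) * (\<integral>\<^sup>+u. f (r *\<^sub>R u) \<partial>sphere_measure) \<partial>lborel)"
    unfolding radial_measure_def by (subst nn_integral_density) (use meas1 in auto)
  also have "\<dots> = (\<integral>\<^sup>+r. (\<integral>\<^sup>+y. ?P r * ennreal (r ^ (?d - 1)) * f (r *\<^sub>R (y /\<^sub>R norm y)) * indicator ?B y * ?D \<partial>lborel) \<partial>lborel)"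
  proof (intro nn_integral_cong)
    fix r :: real
    have "(\<integral>\<^sup>+y. ?P r * ennreal (r ^ (?d - 1)) * f (r *\<^sub>R (y /\<^sub>R norm y)) * indicator ?B y * ?D \<partial>lborel) =
      (\<integral>\<^sup>+y. (?P r * ennreal (r ^ (?d - 1)) * ?D) * (f (r *\<^sub>R (y /\<^sub>R norm y)) * indicator ?B y) \<partial>lborel)"
      by (simp only: mult_ac)
    also have "\<dots> = (?P r * ennreal (r ^ (?d - 1)) * ?D) * (\<integral>\<^sup>+y. f (r *\<^sub>R (y /\<^sub>R norm y)) * indicator ?B y \<partial>lborel)"
      by (rule nn_integral_cmult) measurable
    finally show "?P r * ennreal (r ^ (?d - 1)) * (\<integral>\<^sup>+u. f (r *\<^sub>R u) \<partial>sphere_measure) =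
      (\<integral>\<^sup>+y. ?P r * ennreal (r ^ (?d - 1)) * f (r *\<^sub>R (y /\<^sub>R norm y)) * indicator ?B y * ?D \<partial>lborel)"
      by (subst nn_integral_sphere_measure, measurable) (simp only: mult_ac)
  qed
  also have "\<dots> = (\<integral>\<^sup>+y. (\<integral>\<^sup>+r. ?P r * ennreal (r ^ (?d - 1)) * f (r *\<^sub>R (y /\<^sub>R norm y)) * indicator ?B y * ?D \<partial>lborel) \<partial>lborel)"
    by (rule lborel_pair.Fubini') measurable
  also have "\<dots> = (\<integral>\<^sup>+y. (\<integral>\<^sup>+s. ?P s * ennreal (s ^ (?d - 1)) * ennreal (norm y ^ ?d) * f (s *\<^sub>R y) * indicator ?B y \<partial>lborel) * ?D \<partial>lborel)"
    by (intro nn_integral_cong, subst inner[symmetric]) (simp add: nn_integral_multc)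
  also have "\<dots> = (\<integral>\<^sup>+y. (\<integral>\<^sup>+s. ?P s * ennreal (s ^ (?d - 1)) * ennreal (norm y ^ ?d) * f (s *\<^sub>R y) * indicator ?B y \<partial>lborel) \<partial>lborel) * ?D"
    by (rule nn_integral_multc) measurable
  also have "(\<integral>\<^sup>+y. (\<integral>\<^sup>+s. ?P s * ennreal (s ^ (?d - 1)) * ennreal (norm y ^ ?d) * f (s *\<^sub>R y) * indicator ?B y \<partial>lborel) \<partial>lborel) =
     (\<integral>\<^sup>+s. (\<integral>\<^sup>+y. ?P s * ennreal (s ^ (?d - 1)) * ennreal (norm y ^ ?d) * f (s *\<^sub>R y) * indicator ?B y \<partial>lborel) \<partial>lborel)"
    by (rule lborel_pair.Fubini') measurable
  also have "\<dots> = (\<integral>\<^sup>+s. (\<integral>\<^sup>+x. ?P s * ennreal (norm x ^ ?d / s ^ (?d + 1)) * f x * indicator {x. 0 < norm x \<and> norm x < s} x \<partial>lborel) \<partial>lborel)"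
    by (simp only: outer)
  also have "\<dots> = (\<integral>\<^sup>+x. (\<integral>\<^sup>+s. ?P s * ennreal (norm x ^ ?d / s ^ (?d + 1)) * f x * indicator {x. 0 < norm x \<and> norm x < s} x \<partial>lborel) \<partial>lborel)"
    by (rule lborel_pair.Fubini') measurable
  also have "\<dots> * ?D = (\<integral>\<^sup>+x. (\<integral>\<^sup>+s. ?P s * ennreal (norm x ^ ?d / s ^ (?d + 1)) * f x * indicator {x. 0 < norm x \<and> norm x < s} x \<partial>lborel) * ?D \<partial>lborel)"
    by (rule nn_integral_multc[symmetric]) measurable
  also have "\<dots> = (\<integral>\<^sup>+x. f x \<partial>lborel)"
    using AE_lborel_singleton[of "0::'a"]
    by (intro nn_integral_cong_AE, eventually_elim) (rule last)
  finally show ?thesis by simp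
qed

lemma sigma_finite_radial_measure: "sigma_finite_measure (radial_measure d)"
proof -
  have "AE x in lborel. indicator {0<..} x * ennreal (x ^ (d - 1)) \<noteq> \<infinity>"
    by (auto simp: indicator_def)
  then show ?thesis unfolding radial_measure_def
    by (subst sigma_finite_measure.sigma_finite_iff_density_finite[OF lborel.sigma_finite_measure_axioms]) auto
qed

global_interpretation radial_measure: sigma_finite_measure "radial_measure d"
  by (rule sigma_finite_radial_measure)

text \<open>Stated as an image measure so that polar coordinates pass from nonnegative integrals to
  Bochner integrals of vector-valued functions.\<close>

lemma lborel_eq_polar:
  "(lborel :: 'a::euclidean_space measure) =
    distr (radial_measure DIM('a) \<Otimes>\<^sub>M sphere_measure) borel (\<lambda>(r, u). r *\<^sub>R u)"
proof (rule measure_eqI)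
  fix A :: "'a set" assume "A \<in> sets lborel"
  then have [measurable]: "A \<in> sets borel" by simp
  have "emeasure lborel A = (\<integral>\<^sup>+x. indicator A x \<partial>lborel)" by simp
  also have "\<dots> = (\<integral>\<^sup>+r. (\<integral>\<^sup>+u. indicator A (r *\<^sub>R u) \<partial>sphere_measure) \<partial>radial_measure DIM('a))"
    by (rule nn_integral_polar) measurable
  also have "\<dots> = (\<integral>\<^sup>+x. indicator A (fst x *\<^sub>R snd x) \<partial>(radial_measure DIM('a) \<Otimes>\<^sub>M sphere_measure))"
    by (subst sphere_measure.nn_integral_fst[symmetric]) auto
  also have "\<dots> = emeasure (distr (radial_measure DIM('a) \<Otimes>\<^sub>M sphere_measure) borel (\<lambda>(r, u). r *\<^sub>R u)) A"
    by (subst nn_integral_indicator[symmetric], simp)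
       (subst nn_integral_distr, auto simp: split_beta')
  finally show "emeasure lborel A = \<dots>" .
qed simp

text \<open>\<open>sphere_measure\<close> is a measure on the whole space; this is the bridge by
  which facts known on the sphere alone enter its integrals.\<close>

lemma AE_sphere_measure: "AE u in sphere_measure. norm (u::'a::euclidean_space) = 1"
proof (rule AE_I')
  have "emeasure sphere_measure {u::'a. norm u \<noteq> 1} = (\<integral>\<^sup>+u. indicator {u. norm u \<noteq> 1} u \<partial>(sphere_measure :: 'a measure))"
    by (subst nn_integral_indicator) auto
  also have "\<dots> = ennreal (real DIM('a)) * (\<integral>\<^sup>+y. indicator {u. norm u \<noteq> 1} (y /\<^sub>R norm y) * indicator (ball 0 1 - {0::'a}) y \<partial>lborel)"
    by (rule nn_integral_sphere_measure) measurable
  also have "(\<integral>\<^sup>+y. indicator {u. norm u \<noteq> 1} (y /\<^sub>R norm y) * indicator (ball 0 1 - {0::'a}) y \<partial>lborel) = (\<integral>\<^sup>+y. 0 \<partial>(lborel :: 'a measure))"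
    by (intro nn_integral_cong) (auto simp: indicator_def)
  finally show "{u::'a. norm u \<noteq> 1} \<in> null_sets sphere_measure" by (auto simp: null_sets_def)
qed auto

lemma AE_radial_measure: "AE r in radial_measure d. r > 0"
  unfolding radial_measure_def by (subst AE_density) (auto simp: indicator_def)

lemma integral_radial_measure:
  fixes f :: "real \<Rightarrow> 'b::{banach, second_countable_topology}"
  assumes [measurable]: "f \<in> borel_measurable borel"
  shows "integrable (radial_measure d) f \<longleftrightarrow> integrable lborel (\<lambda>r. (indicator {0<..} r * r ^ (d - 1)) *\<^sub>R f r)"
    and "(LINT r|radial_measure d. f r) = (LINT r|lborel. (indicator {0<..} r * r ^ (d - 1)) *\<^sub>R f r)"
proof -
  have e: "radial_measure d = density lborel (\<lambda>r. ennreal (indicator {0<..} r * r ^ (d - 1)))"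
    unfolding radial_measure_def by (intro arg_cong2[where f=density] ext refl) (auto simp: indicator_def)
  show "integrable (radial_measure d) f \<longleftrightarrow> integrable lborel (\<lambda>r. (indicator {0<..} r * r ^ (d - 1)) *\<^sub>R f r)"
    unfolding e by (subst integrable_density) (auto simp: indicator_def)
  show "(LINT r|radial_measure d. f r) = (LINT r|lborel. (indicator {0<..} r * r ^ (d - 1)) *\<^sub>R f r)"
    unfolding e by (subst integral_density) (auto simp: indicator_def)
qed

lemma integrable_sphere_bounded:
  fixes f :: "'a::euclidean_space \<Rightarrow> 'b::{banach, second_countable_topology}"
  assumes "f \<in> borel_measurable borel" "\<And>u. norm u = 1 \<Longrightarrow> norm (f u) \<le> B"
  shows "integrable sphere_measure f"
proof (rule sphere_measure.integrable_const_bound[of _ B])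
  show "AE x in sphere_measure. norm (f x) \<le> B"
    using AE_sphere_measure by eventually_elim (rule assms)
qed (use assms in simp)

lemma integrable_sphere_continuous:
  fixes f :: "'a::euclidean_space \<Rightarrow> 'b::{banach, second_countable_topology}"
  assumes "continuous_on UNIV f"
  shows "integrable sphere_measure f"
proof -
  have "compact (f ` sphere 0 1)"
    by (intro compact_continuous_image compact_sphere continuous_on_subset[OF assms]) auto
  then obtain B where "\<And>u. norm u = 1 \<Longrightarrow> norm (f u) \<le> B"
    by (metis bounded_iff compact_imp_bounded image_eqI mem_sphere_0)
  then show ?thesis
    using assms by (intro integrable_sphere_bounded) (auto intro: borel_measurable_continuous_onI)
qed

text \<open>The majorant depends on the radius only: since the sphere has finite measure,
  integrability in d dimensions is thereby reduced to a one-dimensional question.\<close>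

lemma integral_polar:
  fixes F :: "real \<Rightarrow> 'a::euclidean_space \<Rightarrow> 'b::{banach, second_countable_topology}"
  assumes F [measurable]: "case_prod F \<in> borel_measurable (borel \<Otimes>\<^sub>M borel)"
    and int: "integrable (radial_measure DIM('a)) g"
    and bd: "\<And>r u. r > 0 \<Longrightarrow> norm u = 1 \<Longrightarrow> norm (F r u) \<le> g r"
  shows "integrable lborel (\<lambda>z. F (norm z) (z /\<^sub>R norm z))"
    and "(LINT z|lborel. F (norm z) (z /\<^sub>R norm z)) =
      (LINT r|radial_measure DIM('a). LINT u|sphere_measure. F r u)"
    and "integrable (radial_measure DIM('a) \<Otimes>\<^sub>M sphere_measure) (case_prod F)"
proof -
  interpret pair_sigma_finite "radial_measure DIM('a)" "sphere_measure :: 'a measure" ..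
  let ?M = "radial_measure DIM('a) \<Otimes>\<^sub>M (sphere_measure :: 'a measure)"
  have [measurable]: "g \<in> borel_measurable borel" using borel_measurable_integrable[OF int] by simp
  have AE: "AE x in ?M. fst x > 0 \<and> norm (snd x) = 1"
  proof (rule AE_pair_measure)
    show "AE r in radial_measure DIM('a). AE u in sphere_measure. fst (r, u) > 0 \<and> norm (snd (r, u) :: 'a) = 1"
      using AE_radial_measure by eventually_elim (use AE_sphere_measure in auto)
  qed measurable
  have "integrable ?M (\<lambda>x. g (fst x))"
  proof (rule Fubini_integrable)
    show "integrable (radial_measure DIM('a)) (\<lambda>r. LINT u|(sphere_measure :: 'a measure). norm (g (fst (r, u))))"
      using int by simp
  qed auto
  then show int': "integrable ?M (case_prod F)"
  proof (rule Bochner_Integration.integrable_bound)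
    show "AE x in ?M. norm (case_prod F x) \<le> norm (g (fst x))"
      using AE
    proof eventually_elim
      case (elim x)
      then show ?case using bd[of "fst x" "snd x"] by (simp add: split_beta')
    qed
  qed measurable
  have eq: "AE x in ?M. F (norm (fst x *\<^sub>R snd x)) ((fst x *\<^sub>R snd x) /\<^sub>R norm (fst x *\<^sub>R snd x)) = F (fst x) (snd x)"
    using AE by eventually_elim auto
  have int2: "integrable ?M (\<lambda>x. F (norm (fst x *\<^sub>R snd x)) ((fst x *\<^sub>R snd x) /\<^sub>R norm (fst x *\<^sub>R snd x)))"
    using int' by (subst integrable_cong_AE[OF _ _ eq]) (auto simp: split_beta')
  then show "integrable lborel (\<lambda>z. F (norm z) (z /\<^sub>R norm z))"
    by (subst lborel_eq_polar, subst integrable_distr_eq) (auto simp: split_beta')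
  have "(LINT z|lborel. F (norm z) (z /\<^sub>R norm z)) =
     (LINT x|?M. F (norm (fst x *\<^sub>R snd x)) ((fst x *\<^sub>R snd x) /\<^sub>R norm (fst x *\<^sub>R snd x)))"
    by (subst lborel_eq_polar, subst integral_distr) (auto simp: split_beta')
  also have "\<dots> = (LINT x|?M. case_prod F x)"
    using eq by (intro integral_cong_AE) (auto simp: split_beta')
  also have "\<dots> = (LINT r|radial_measure DIM('a). LINT u|sphere_measure. F r u)"
    by (rule integral_fst[OF int', symmetric])
  finally show "(LINT z|lborel. F (norm z) (z /\<^sub>R norm z)) =
      (LINT r|radial_measure DIM('a). LINT u|sphere_measure. F r u)" .
qed

text \<open>A hyperplane through the origin is a cone, so its preimage under projection to the
  sphere lies in the hyperplane itself, a Lebesgue null set. Used for the strict positivity of the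
  real part of \<open>V\<close>.\<close>

lemma AE_sphere_measure_inner:
  assumes "v \<noteq> (0::'a::euclidean_space)"
  shows "AE u in sphere_measure. v \<bullet> u \<noteq> 0"
proof (rule AE_I')
  have null: "{x. v \<bullet> x = 0} \<in> null_sets lborel"
    using negligible_hyperplane[of v 0] assms
    by (auto simp: negligible_iff_null_sets null_sets_completion_iff)
  have "emeasure sphere_measure {u. v \<bullet> u = 0} = (\<integral>\<^sup>+u. indicator {u. v \<bullet> u = 0} u \<partial>(sphere_measure :: 'a measure))"
    by (subst nn_integral_indicator) auto
  also have "\<dots> = ennreal (real DIM('a)) * (\<integral>\<^sup>+y. indicator {u. v \<bullet> u = 0} (y /\<^sub>R norm y) * indicator (ball 0 1 - {0::'a}) y \<partial>lborel)"
    by (rule nn_integral_sphere_measure) measurable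
  also have "(\<integral>\<^sup>+y. indicator {u. v \<bullet> u = 0} (y /\<^sub>R norm y) * indicator (ball 0 1 - {0::'a}) y \<partial>lborel) = (\<integral>\<^sup>+y. 0 \<partial>(lborel :: 'a measure))"
    using AE_not_in[OF null]
    by (intro nn_integral_cong_AE, eventually_elim) (auto simp: indicator_def)
  finally show "{u. v \<bullet> u = 0} \<in> null_sets sphere_measure" by (auto simp: null_sets_def)
qed auto

text \<open>Extend \<open>f\<close> to the punctured ball by constancy along rays. A nonzero value
  at \<open>u\<close> would persist on an open set containing \<open>u / 2\<close>, but the cone
  definition makes that set negligible.\<close>

lemma sphere_measure_continuous_zero:
  fixes f :: "'a::euclidean_space \<Rightarrow> real"
  assumes cont: "continuous_on (sphere 0 1) f"
    and AE: "AE u in sphere_measure. f u = 0" and u: "norm u = 1"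
  shows "f u = 0"
proof (rule ccontr)
  assume nz: "f u \<noteq> 0"
  have "AE y in lborel. y \<in> ball 0 1 - {0} \<longrightarrow> f (y /\<^sub>R norm y) = 0"
  proof -
    have "AE y in distr (restrict_space lborel (ball 0 1 - {0})) borel (\<lambda>x::'a. x /\<^sub>R norm x). f y = 0"
      using AE unfolding sphere_measure_def by (subst (asm) AE_density) auto
    then have "AE y in restrict_space lborel (ball 0 1 - {0::'a}). f (y /\<^sub>R norm y) = 0"
      by (rule AE_distrD[OF measurable_unit_direction])
    then show ?thesis by (subst (asm) AE_restrict_space_iff) auto
  qed
  then obtain N where N: "\<And>y. y \<in> space lborel - N \<Longrightarrow> y \<in> ball 0 1 - {0} \<longrightarrow> f (y /\<^sub>R norm y) = 0" "N \<in> null_sets lborel"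
    by (rule AE_E3) blast
  have neg: "negligible {y \<in> ball 0 1 - {0}. f (y /\<^sub>R norm y) \<noteq> 0}"
  proof (rule negligible_subset)
    show "negligible N" using N(2) by (simp add: negligible_iff_null_sets null_sets_completionI)
    show "{y \<in> ball 0 1 - {0}. f (y /\<^sub>R norm y) \<noteq> 0} \<subseteq> N"
    proof (rule subsetI, rule ccontr)
      fix y assume "y \<in> {y \<in> ball 0 1 - {0}. f (y /\<^sub>R norm y) \<noteq> 0}" "y \<notin> N"
      then show False using N(1)[of y] by simp
    qed
  qed
  have "continuous_on (ball 0 1 - {0}) (\<lambda>y. f (y /\<^sub>R norm y))"
  proof (rule continuous_on_compose2[OF cont])
    show "(\<lambda>y. y /\<^sub>R norm y) ` (ball 0 1 - {0::'a}) \<subseteq> sphere 0 1"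
      by clarsimp (metis left_inverse norm_eq_zero)
  qed (auto intro!: continuous_intros)
  then have "open {y \<in> ball 0 1 - {0}. f (y /\<^sub>R norm y) \<noteq> 0}"
    using continuous_open_preimage[of "ball 0 1 - {0}" "\<lambda>y. f (y /\<^sub>R norm y)" "- {0}"]
    by (simp add: vimage_def Int_def open_Diff open_Compl)
  moreover have "(1/2) *\<^sub>R u \<in> {y \<in> ball 0 1 - {0}. f (y /\<^sub>R norm y) \<noteq> 0}"
    using u nz by auto
  ultimately show False using neg open_not_negligible by blast
qed


section \<open>Gaussian integration by parts and spherical integrals\<close>

lemma integral_lborel_translate:
  fixes f :: "'a::euclidean_space \<Rightarrow> 'b::{banach, second_countable_topology}"
  assumes [measurable]: "f \<in> borel_measurable borel"
  shows "(LINT x|lborel. f (x + c)) = (LINT x|lborel. f x)"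
    and "integrable lborel (\<lambda>x. f (x + c)) \<longleftrightarrow> integrable lborel f"
proof -
  have "(LINT x|lborel. f x) = (LINT x|distr lborel borel ((+) c). f x)"
    by (simp add: lborel_distr_plus)
  also have "\<dots> = (LINT x|lborel. f (x + c))"
    by (subst integral_distr) (auto simp: add.commute)
  finally show "(LINT x|lborel. f (x + c)) = (LINT x|lborel. f x)" by simp
  have "integrable lborel f \<longleftrightarrow> integrable (distr lborel borel ((+) c)) f"
    by (simp add: lborel_distr_plus)
  also have "\<dots> \<longleftrightarrow> integrable lborel (\<lambda>x. f (x + c))"
    by (subst integrable_distr_eq) (auto simp: add.commute)
  finally show "integrable lborel (\<lambda>x. f (x + c)) \<longleftrightarrow> integrable lborel f" by simp
qed

text \<open>Integrate \<open>F (x + v) - F x = \<integral>\<^sub>0\<^sup>1 D (x + t v) dt\<close> over \<open>x\<close> and use translation invariance.\<close>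

lemma integral_directional_derivative_eq_0:
  fixes F D :: "'a::euclidean_space \<Rightarrow> real"
  assumes F: "integrable lborel F" and D: "integrable lborel D"
    and cont: "continuous_on UNIV D"
    and deriv: "\<And>x t. ((\<lambda>t. F (x + t *\<^sub>R v)) has_real_derivative D (x + t *\<^sub>R v)) (at t)"
  shows "(LINT x|lborel. D x) = 0"
proof -
  have [measurable]: "F \<in> borel_measurable borel" "D \<in> borel_measurable borel"
    using borel_measurable_integrable[OF F] borel_measurable_integrable[OF D] by simp_all
  have ftc: "(LINT t|lborel. D (x + t *\<^sub>R v) * indicator {0..1} t) = F (x + v) - F x" for x
  proof -
    have "isCont (\<lambda>t. D (x + t *\<^sub>R v)) t" for t
      using continuous_on_compose2[OF cont, of UNIV "\<lambda>t. x + t *\<^sub>R v"]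
      by (auto intro!: continuous_intros simp: continuous_on_eq_continuous_at)
    then show ?thesis using integral_FTC_Icc_real[of 0 1 "\<lambda>t. F (x + t *\<^sub>R v)" "\<lambda>t. D (x + t *\<^sub>R v)"] deriv by simp
  qed
  have tr: "(LINT x|lborel. norm (D (x + t *\<^sub>R v) * indicator {0..1} t)) = indicator {0..1} t * (LINT x|lborel. \<bar>D x\<bar>)" for t :: real
    using integral_lborel_translate(1)[of "\<lambda>x. \<bar>D x\<bar>" "t *\<^sub>R v"] by (simp add: abs_mult indicator_def)
  have int: "integrable (lborel \<Otimes>\<^sub>M lborel) (\<lambda>(t::real, x). D (x + t *\<^sub>R v) * indicator {0..1} t)"
  proof (rule lborel_pair.Fubini_integrable)
    show "integrable lborel (\<lambda>t::real. LINT x|lborel. norm (case (t, x) of (t, x) \<Rightarrow> D (x + t *\<^sub>R v) * indicator {0..1} t))"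
      unfolding prod.case tr by (intro integrable_mult_left integrable_real_indicator) auto
    show "AE t in lborel. integrable lborel (\<lambda>x. case (t::real, x) of (t, x) \<Rightarrow> D (x + t *\<^sub>R v) * indicator {0..1} t)"
      using integral_lborel_translate(2)[of D] D by simp
  qed measurable
  have "(LINT x|lborel. LINT t|lborel. D (x + t *\<^sub>R v) * indicator {0..1} t) =
        (LINT t|lborel. LINT x|lborel. D (x + t *\<^sub>R v) * indicator {0..1} t)"
    by (rule lborel_pair.Fubini_integral[OF int])
  also have "\<dots> = (LINT t|lborel. indicator {0..1::real} t * (LINT x|lborel. D x))"
    using integral_lborel_translate(1)[of D] by (simp add: mult.commute)
  also have "\<dots> = (LINT x|lborel. D x)" by simp
  finally have "(LINT x|lborel. D x) = (LINT x|lborel. F (x + v) - F x)" by (simp add: ftc)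
  also have "\<dots> = 0"
    using F integral_lborel_translate[of F v] by (simp add: Bochner_Integration.integral_diff)
  finally show ?thesis .
qed

section \<open>Gaussian moments and sphere integrals of Laplacians\<close>

definition gauss_moment :: "nat \<Rightarrow> nat \<Rightarrow> real" where
  "gauss_moment d n = (LINT r|radial_measure d. r ^ n * exp (- r\<^sup>2 / 2))"

lemma integrable_gauss_moment: "integrable (radial_measure d) (\<lambda>r. r ^ n * exp (- r\<^sup>2 / 2))"
proof -
  have "integrable lborel (\<lambda>x. std_normal_density x * x ^ (d - 1 + n))"
    by (rule integrable_std_normal_moment)
  then have "integrable lborel (\<lambda>x. indicator {0<..} x *\<^sub>R (sqrt (2 * pi) * (std_normal_density x * x ^ (d - 1 + n))))"
    by (intro integrable_mult_indicator) auto
  also have "(\<lambda>x. indicator {0<..} x *\<^sub>R (sqrt (2 * pi) * (std_normal_density x * x ^ (d - 1 + n)))) =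
     (\<lambda>r::real. (indicator {0<..} r * r ^ (d - 1)) *\<^sub>R (r ^ n * exp (- r\<^sup>2 / 2)))"
    by (auto simp: fun_eq_iff std_normal_density_def power_add field_simps)
  finally show ?thesis by (subst integral_radial_measure) measurable
qed

text \<open>If the moment were zero, the radial measure would vanish and, by polar coordinates, so
  would Lebesgue measure. Positivity allows the radial factor to be cancelled in
  \<open>hpoly_sphere_laplacian\<close>.\<close>

lemma gauss_moment_pos: "gauss_moment DIM('a::euclidean_space) n > 0"
proof -
  let ?M = "radial_measure DIM('a)"
  have nn: "AE r in ?M. 0 \<le> r ^ n * exp (- r\<^sup>2 / 2)"
    using AE_radial_measure by eventually_elim auto
  have "gauss_moment DIM('a) n \<noteq> 0"
  proof
    assume "gauss_moment DIM('a) n = 0"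
    then have "AE r in ?M. r ^ n * exp (- r\<^sup>2 / 2) = 0"
      using integral_nonneg_eq_0_iff_AE[OF integrable_gauss_moment nn] by (simp add: gauss_moment_def)
    then have "AE r in ?M. False"
      using AE_radial_measure by eventually_elim auto
    then have "emeasure ?M UNIV = 0"
      using ae_filter_eq_bot_iff[of ?M] by (simp add: eventually_False)
    moreover have "emeasure lborel (UNIV :: 'a set) = (\<integral>\<^sup>+r. (\<integral>\<^sup>+u. 1 \<partial>(sphere_measure :: 'a measure)) \<partial>?M)"
      using nn_integral_polar[of "\<lambda>x::'a. 1"] by simp
    ultimately show False by simp
  qed
  moreover have "gauss_moment DIM('a) n \<ge> 0"
    unfolding gauss_moment_def by (rule integral_nonneg_AE[OF nn])
  ultimately show ?thesis by simp
qed

lemma hpoly_gauss_integral: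
  fixes f :: "'a::euclidean_space \<Rightarrow> real"
  assumes f: "hpoly n f"
  shows "integrable lborel (\<lambda>z. f z * exp (- (norm z)\<^sup>2 / 2))"
    and "(LINT z|lborel. f z * exp (- (norm z)\<^sup>2 / 2)) = gauss_moment DIM('a) n * (LINT u|sphere_measure. f u)"
proof -
  have [measurable]: "f \<in> borel_measurable borel" by (rule hpoly_measurable[OF f])
  obtain B where B: "B \<ge> 0" "\<And>x. \<bar>f x\<bar> \<le> B * norm x ^ n" using hpoly_bound[OF f] by blast
  have eq: "f z * exp (- (norm z)\<^sup>2 / 2) = norm z ^ n * exp (- (norm z)\<^sup>2 / 2) * f (z /\<^sub>R norm z)" for z
  proof (cases "z = 0")
    case True
    then show ?thesis using hpoly_homogeneous[OF f, of 0 0] by simp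
  next
    case False
    then show ?thesis using hpoly_homogeneous[OF f, of "norm z" "z /\<^sub>R norm z"] by simp
  qed
  have m: "(\<lambda>(r, u). r ^ n * exp (- r\<^sup>2 / 2) * f u) \<in> borel_measurable (borel \<Otimes>\<^sub>M borel)" by measurable
  have i: "integrable (radial_measure DIM('a)) (\<lambda>r. r ^ n * exp (- r\<^sup>2 / 2) * B)"
    by (intro integrable_mult_left integrable_gauss_moment)
  have b: "norm (r ^ n * exp (- r\<^sup>2 / 2) * f u) \<le> r ^ n * exp (- r\<^sup>2 / 2) * B" if "r > 0" "norm u = 1" for r u
    using that B(2)[of u] by (simp add: abs_mult mult_left_mono)
  note p = integral_polar[OF m i b]
  show "integrable lborel (\<lambda>z. f z * exp (- (norm z)\<^sup>2 / 2))" unfolding eq by (rule p(1))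
  have "(LINT z|lborel. f z * exp (- (norm z)\<^sup>2 / 2)) =
    (LINT r|radial_measure DIM('a). LINT u|sphere_measure. r ^ n * exp (- r\<^sup>2 / 2) * f u)"
    unfolding eq by (rule p(2))
  then show "(LINT z|lborel. f z * exp (- (norm z)\<^sup>2 / 2)) = gauss_moment DIM('a) n * (LINT u|sphere_measure. f u)"
    by (simp add: gauss_moment_def)
qed

text \<open>Stein's identity: the derivative of \<open>f\<close> times the Gaussian integrates to
  zero, and differentiating the Gaussian produces the factor
  \<open>- (z \<bullet> v)\<close>.\<close>

lemma hpoly_stein:
  fixes f :: "'a::euclidean_space \<Rightarrow> real"
  assumes f: "hpoly n f"
  shows "(LINT z|lborel. dir_deriv v f z * exp (- (norm z)\<^sup>2 / 2)) = (LINT z|lborel. (z \<bullet> v) * f z * exp (- (norm z)\<^sup>2 / 2))"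
proof -
  let ?g = "\<lambda>z::'a. exp (- (norm z)\<^sup>2 / 2)"
  have i1: "integrable lborel (\<lambda>z. dir_deriv v f z * ?g z)"
    by (rule hpoly_gauss_integral[OF hpoly_dir_deriv(2)[OF f]])
  have i2: "integrable lborel (\<lambda>z. (z \<bullet> v) * f z * ?g z)"
    by (rule hpoly_gauss_integral[OF hpoly_mult[OF hpoly_coord f]])
  have "(LINT z|lborel. dir_deriv v f z * ?g z - (z \<bullet> v) * f z * ?g z) = 0"
  proof (rule integral_directional_derivative_eq_0[where v=v])
    show "integrable lborel (\<lambda>z. f z * ?g z)" by (rule hpoly_gauss_integral[OF f])
    show "integrable lborel (\<lambda>z. dir_deriv v f z * ?g z - (z \<bullet> v) * f z * ?g z)" using i1 i2 by simp
    show "continuous_on UNIV (\<lambda>z. dir_deriv v f z * ?g z - (z \<bullet> v) * f z * ?g z)"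
      by (intro continuous_intros hpoly_continuous[OF f] hpoly_continuous[OF hpoly_dir_deriv(2)[OF f]]) auto
    fix x t
    have "((\<lambda>t. (norm (x + t *\<^sub>R v))\<^sup>2) has_real_derivative 2 * ((x + t *\<^sub>R v) \<bullet> v)) (at t)"
      using hpoly_dir_deriv_at[OF hpoly_norm2, of x v t] by (simp add: dir_deriv_norm2)
    then have "((\<lambda>t. ?g (x + t *\<^sub>R v)) has_real_derivative - (((x + t *\<^sub>R v) \<bullet> v) * ?g (x + t *\<^sub>R v))) (at t)"
    proof -
      assume h: "((\<lambda>t. (norm (x + t *\<^sub>R v))\<^sup>2) has_real_derivative 2 * ((x + t *\<^sub>R v) \<bullet> v)) (at t)"
      have "((\<lambda>t. exp ((-1/2) * (norm (x + t *\<^sub>R v))\<^sup>2)) has_real_derivative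
         exp ((-1/2) * (norm (x + t *\<^sub>R v))\<^sup>2) * ((-1/2) * (2 * ((x + t *\<^sub>R v) \<bullet> v)))) (at t)"
        by (rule DERIV_fun_exp[OF DERIV_cmult[OF h]])
      then show ?thesis by (simp add: mult.commute)
    qed
    from DERIV_mult[OF hpoly_dir_deriv_at[OF f, of x v t] this]
    show "((\<lambda>t. f (x + t *\<^sub>R v) * ?g (x + t *\<^sub>R v)) has_real_derivative
       dir_deriv v f (x + t *\<^sub>R v) * ?g (x + t *\<^sub>R v) - ((x + t *\<^sub>R v) \<bullet> v) * f (x + t *\<^sub>R v) * ?g (x + t *\<^sub>R v)) (at t)"
      by (simp add: algebra_simps)
  qed
  then show ?thesis using i1 i2 by simp
qed

text \<open>This replaces the divergence theorem on the sphere. Stein's identity for the partial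
  derivatives, together with Euler's identity, gives \<open>lap\<close>; for the functions
  \<open>(z \<bullet> b) * h z\<close> it gives \<open>euler\<close>. Combining them on the
  Laplacian of \<open>f\<close> leaves the same radial moment on both sides, which cancels.\<close>

lemma hpoly_sphere_laplacian:
  fixes f :: "'a::euclidean_space \<Rightarrow> real"
  assumes f: "hpoly n f"
  shows "(LINT u|sphere_measure. laplacian f u) = real n * (real n + real DIM('a) - 2) * (LINT u|sphere_measure. f u)"
proof -
  let ?g = "\<lambda>z::'a. exp (- (norm z)\<^sup>2 / 2)"
  let ?G = "\<lambda>f. (LINT z|lborel. f z * ?g z)"
  have lap: "?G (laplacian h) = real k * ?G h" if h: "hpoly k h" for h :: "'a \<Rightarrow> real" and k
  proof -
    note d = hpoly_dir_deriv(2)[OF h]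
    have "?G (laplacian h) = (LINT z|lborel. (\<Sum>b\<in>Basis. dir_deriv b (dir_deriv b h) z * ?g z))"
      by (simp add: laplacian_hpoly[OF h] sum_distrib_right)
    also have "\<dots> = (\<Sum>b\<in>Basis. ?G (dir_deriv b (dir_deriv b h)))"
      by (intro Bochner_Integration.integral_sum hpoly_gauss_integral(1)[OF hpoly_dir_deriv(2)[OF d]])
    also have "\<dots> = (\<Sum>b\<in>Basis. (LINT z|lborel. (z \<bullet> b) * dir_deriv b h z * ?g z))"
      by (simp only: hpoly_stein[OF d])
    also have "\<dots> = (LINT z|lborel. (\<Sum>b\<in>Basis. (z \<bullet> b) * dir_deriv b h z * ?g z))"
      by (intro Bochner_Integration.integral_sum[symmetric] hpoly_gauss_integral(1)[OF hpoly_mult[OF hpoly_coord d]])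
    also have "\<dots> = (LINT z|lborel. real k * (h z * ?g z))"
      by (simp only: hpoly_euler_basis[OF h] sum_distrib_right[symmetric] mult.assoc[symmetric])
    finally show ?thesis by (simp only: integral_mult_right_zero)
  qed
  have euler: "(real k + real DIM('a)) * ?G h = ?G (\<lambda>z. (norm z)\<^sup>2 * h z)" if h: "hpoly k h" for h :: "'a \<Rightarrow> real" and k
  proof -
    note d = hpoly_dir_deriv(2)[OF h]
    have c: "hpoly (Suc k) (\<lambda>z. (z \<bullet> b) * h z)" for b
      using hpoly_mult[OF hpoly_coord h] by simp
    have e: "dir_deriv b (\<lambda>z. (z \<bullet> b) * h z) z = h z + (z \<bullet> b) * dir_deriv b h z" if "b \<in> Basis" for b z
      using that by (simp add: dir_deriv_mult[OF hpoly_coord h] dir_deriv_coord)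
    have "(real k + real DIM('a)) * ?G h = (LINT z|lborel. (real k + real DIM('a)) * (h z * ?g z))" by simp
    also have "\<dots> = (LINT z|lborel. (\<Sum>b\<in>Basis. dir_deriv b (\<lambda>z. (z \<bullet> b) * h z) z * ?g z))"
    proof -
      have "(\<Sum>b\<in>Basis. dir_deriv b (\<lambda>z. (z \<bullet> b) * h z) z) = (real k + real DIM('a)) * h z" for z
        using hpoly_euler_basis[OF h, of z] by (simp add: e sum.distrib distrib_right)
      then show ?thesis by (simp only: sum_distrib_right[symmetric] mult.assoc)
    qed
    also have "\<dots> = (\<Sum>b\<in>Basis. ?G (dir_deriv b (\<lambda>z. (z \<bullet> b) * h z)))"
      by (intro Bochner_Integration.integral_sum hpoly_gauss_integral(1)[OF hpoly_dir_deriv(2)[OF c]])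
    also have "\<dots> = (\<Sum>b\<in>Basis. (LINT z|lborel. (z \<bullet> b) * ((z \<bullet> b) * h z) * ?g z))"
      by (simp only: hpoly_stein[OF c])
    also have "\<dots> = (LINT z|lborel. (\<Sum>b\<in>Basis. (z \<bullet> b) * ((z \<bullet> b) * h z) * ?g z))"
      by (intro Bochner_Integration.integral_sum[symmetric] hpoly_gauss_integral(1)[OF hpoly_mult[OF hpoly_coord c]])
    also have "\<dots> = ?G (\<lambda>z. (norm z)\<^sup>2 * h z)"
    proof -
      have "(\<Sum>b\<in>Basis. (z \<bullet> b) * ((z \<bullet> b) * h z) * ?g z) = (norm z)\<^sup>2 * h z * ?g z" for z
      proof -
        have "(norm z)\<^sup>2 = (\<Sum>b\<in>Basis. (z \<bullet> b) * (z \<bullet> b))"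
          by (subst power2_norm_eq_inner, rule euclidean_inner)
        then show ?thesis by (simp add: sum_distrib_right mult.assoc)
      qed
      then show ?thesis by simp
    qed
    finally show ?thesis .
  qed
  let ?S = "\<lambda>f::'a\<Rightarrow>real. (LINT u|sphere_measure. f u)"
  let ?R = "gauss_moment DIM('a)"
  show ?thesis
  proof (cases "n < 2")
    case True
    then have "real n * ?G f = 0" using lap[OF f] laplacian_low[OF f] by simp
    then have "real n * ?S f = 0"
      using hpoly_gauss_integral(2)[OF f] gauss_moment_pos[where 'a='a, of n] by auto
    then show ?thesis using laplacian_low[OF f True] by auto
  next
    case False
    define m where "m = n - 2"
    have n: "n = m + 2" using False by (simp add: m_def)
  note l = hpoly_laplacian[OF f]
  have l': "hpoly m (laplacian f)" using l n by simp
  \<comment> \<open>On the sphere the factor |u|^2 is invisible, but it lifts the Laplacian from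
    degree \<open>m\<close> to degree \<open>n\<close>, so that its Gaussian integral carries the
    moment \<open>?R n\<close> of \<open>f\<close>.\<close>
  have "?S (\<lambda>u. (norm u)\<^sup>2 * laplacian f u) = ?S (laplacian f)"
  proof (rule integral_cong_AE)
    show "AE u in sphere_measure. (norm u)\<^sup>2 * laplacian f u = laplacian f u"
      using AE_sphere_measure by eventually_elim simp
  qed (use hpoly_measurable[OF l'] in measurable)
  then have "?R n * ?S (laplacian f) = ?G (\<lambda>z. (norm z)\<^sup>2 * laplacian f z)"
    using hpoly_gauss_integral(2)[OF hpoly_mult[OF hpoly_norm2 l']] n by (simp add: add.commute)
  also have "\<dots> = (real m + real DIM('a)) * ?G (laplacian f)" using euler[OF l'] by simp
  also have "\<dots> = (real m + real DIM('a)) * (real n * (?R n * ?S f))"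
    using lap[OF f] hpoly_gauss_integral(2)[OF f] by simp
  finally have "?R n * ?S (laplacian f) = ?R n * (real n * (real n + real DIM('a) - 2) * ?S f)"
    using n by (simp add: mult_ac)
  then show ?thesis using gauss_moment_pos[where 'a='a, of n] by simp
  qed
qed


lemma dir_deriv_commute:
  assumes "hpoly n f" shows "dir_deriv v (dir_deriv w f) = dir_deriv w (dir_deriv v f)"
  using assms
proof (induction rule: hpoly.induct)
  case (const c)
  then show ?case by (simp add: dir_deriv_def)
next
  case (coord b n f)
  note d = hpoly_dir_deriv(2)[OF coord(2)]
  have D: "dir_deriv v (dir_deriv w (\<lambda>x. (x \<bullet> b) * f x)) x =
    (w \<bullet> b) * dir_deriv v f x + ((v \<bullet> b) * dir_deriv w f x + (x \<bullet> b) * dir_deriv v (dir_deriv w f) x)" for v w x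
  proof -
    have "dir_deriv w (\<lambda>x. (x \<bullet> b) * f x) = (\<lambda>x. (w \<bullet> b) * f x + (x \<bullet> b) * dir_deriv w f x)"
      by (simp add: dir_deriv_mult[OF hpoly_coord coord(2)] dir_deriv_coord)
    then show ?thesis
      by (simp add: dir_deriv_add[OF hpoly_scale[OF coord(2)] hpoly_mult[OF hpoly_coord d]]
          dir_deriv_scale[OF coord(2)] dir_deriv_mult[OF hpoly_coord d] dir_deriv_coord)
  qed
  show ?case by (rule ext) (simp add: D coord(3))
next
  case (add n f g)
  note d = hpoly_dir_deriv(2)[OF add(1)] hpoly_dir_deriv(2)[OF add(2)]
  show ?case
    by (simp add: dir_deriv_add[OF add(1,2)] dir_deriv_add[OF d] add(3,4))
qed

lemma homog_harmonic_dir_deriv: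
  assumes "homog_harmonic n f" shows "homog_harmonic (n - 1) (dir_deriv v f)"
proof -
  have f: "hpoly n f" "\<And>x. laplacian f x = 0" using assms by (auto simp: homog_harmonic_iff)
  note d = hpoly_dir_deriv(2)[OF f(1)]
  note dd = hpoly_dir_deriv(2)[OF d]
  have "laplacian f = (\<lambda>x. \<Sum>b\<in>Basis. dir_deriv b (dir_deriv b f) x)"
    using laplacian_hpoly[OF f(1)] by blast
  then have "dir_deriv v (\<lambda>x. \<Sum>b\<in>Basis. dir_deriv b (dir_deriv b f) x) = dir_deriv v (\<lambda>x. 0)"
    using f(2) by (metis (no_types, lifting))
  then have "(\<Sum>b\<in>Basis. dir_deriv v (dir_deriv b (dir_deriv b f)) x) = 0" for x
    by (simp add: dir_deriv_sum[OF finite_Basis dd] fun_eq_iff) (simp add: dir_deriv_def)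
  then have "laplacian (dir_deriv v f) x = 0" for x
    by (simp add: laplacian_hpoly[OF d] dir_deriv_commute[OF f(1), of _ v] dir_deriv_commute[OF d, of _ v])
  then show ?thesis using d by (simp add: homog_harmonic_iff)
qed

lemma integrable_sphere_hpoly: "hpoly n f \<Longrightarrow> integrable sphere_measure f"
  by (intro integrable_sphere_continuous hpoly_continuous)

text \<open>For harmonic \<open>f\<close> and \<open>g\<close>, \<open>\<Delta>(f g) = 2 \<nabla>f \<cdot> \<nabla>g\<close>, which reduces the degrees by one.\<close>

lemma homog_harmonic_orthogonal:
  fixes f g :: "'a::euclidean_space \<Rightarrow> real"
  assumes "DIM('a) \<ge> 2" "homog_harmonic i f" "homog_harmonic j g" "i \<noteq> j"
  shows "(LINT u|sphere_measure. f u * g u) = 0"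
  using assms(2-4)
proof (induction i arbitrary: j f g)
  case (Suc i)
  have f: "hpoly (Suc i) f" "\<And>x. laplacian f x = 0" and g: "hpoly j g" "\<And>x. laplacian g x = 0"
    using Suc by (auto simp: homog_harmonic_iff)
  note df = hpoly_dir_deriv(2)[OF f(1)] and dg = hpoly_dir_deriv(2)[OF g(1)]
  have z: "(LINT u|sphere_measure. dir_deriv b f u * dir_deriv b g u) = 0" for b
  proof (cases j)
    case 0
    then show ?thesis using hpoly_dir_deriv(3)[OF g(1)] by simp
  next
    case (Suc k)
    then show ?thesis
      using Suc.IH[OF _ homog_harmonic_dir_deriv[OF Suc.prems(2)]] homog_harmonic_dir_deriv[OF Suc.prems(1)] Suc.prems(3)
      by simp
  qed
  have "(real (Suc i + j)) * (real (Suc i + j) + real DIM('a) - 2) * (LINT u|sphere_measure. f u * g u) =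
     (LINT u|sphere_measure. laplacian (\<lambda>u. f u * g u) u)"
    by (rule hpoly_sphere_laplacian[OF hpoly_mult[OF f(1) g(1)], symmetric])
  also have "\<dots> = (LINT u|sphere_measure. (\<Sum>b\<in>Basis. 2 * (dir_deriv b f u * dir_deriv b g u)))"
    by (simp add: laplacian_mult[OF f(1) g(1)] f(2) g(2) sum_distrib_left)
  also have "\<dots> = (\<Sum>b\<in>Basis. (LINT u|sphere_measure. 2 * (dir_deriv b f u * dir_deriv b g u)))"
    by (intro Bochner_Integration.integral_sum integrable_mult_right integrable_sphere_hpoly[OF hpoly_mult[OF df dg]])
  also have "\<dots> = 0" by (simp add: z)
  finally show ?case using assms(1) by auto
next
  case 0
  then show ?case
  proof -
    have f: "hpoly 0 f" and g: "hpoly j g" "\<And>x. laplacian g x = 0"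
      using 0 by (auto simp: homog_harmonic_iff)
    obtain c where c: "f = (\<lambda>x. c)" using hpoly_0_const[OF f] by blast
    have "real j * (real j + real DIM('a) - 2) * (LINT u|sphere_measure. g u) = 0"
      using hpoly_sphere_laplacian[OF g(1)] g(2) by simp
    then have "(LINT u|sphere_measure. g u) = 0" using 0 assms(1) by auto
    then show ?thesis by (simp add: c)
  qed
qed

section \<open>Sphere integrals of harmonics against powers of a linear form\<close>

text \<open>The Funk--Hecke eigenvalue of the zonal kernel t^n on harmonics of degree j in dimension
  d. The number \<open>(n - j) div 2\<close> is the power of |u|^2 by which degree n exceeds degree
  j.\<close>

definition funk_hecke_coeff :: "nat \<Rightarrow> nat \<Rightarrow> nat \<Rightarrow> real" where
  "funk_hecke_coeff d n j = (if j \<le> n \<and> even (n - j)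
     then 2 * pi powr (real d / 2) * fact n / (2 ^ n * fact ((n - j) div 2) * Gamma (real ((n - j) div 2) + real j + real d / 2))
     else 0)"

lemma funk_hecke_coeff_eq:
  "funk_hecke_coeff d (j + 2 * m) j = 2 * pi powr (real d / 2) * fact (j + 2 * m) / (2 ^ (j + 2 * m) * fact m * Gamma (real m + real j + real d / 2))"
  by (simp add: funk_hecke_coeff_def)

text \<open>The relation that \<open>hpoly_sphere_laplacian\<close> imposes on the integrals of a
  harmonic times the n-th power of a linear form. The factors \<open>real j\<close> and
  \<open>real (n - 1)\<close> annihilate the terms whose index would be falsified by truncated
  subtraction.\<close>

lemma funk_hecke_coeff_rec:
  assumes "d \<ge> 2" "n > 0"
  shows "real (j + n) * (real (j + n) + real d - 2) * funk_hecke_coeff d n j =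
    2 * real n * (real j * funk_hecke_coeff d (n - 1) (j - 1)) + real n * real (n - 1) * funk_hecke_coeff d (n - 2) j"
proof (cases "j \<le> n \<and> even (n - j)")
  case False
  have "real j * funk_hecke_coeff d (n - 1) (j - 1) = 0"
    using False assms by (cases j; cases n) (auto simp: funk_hecke_coeff_def)
  moreover have "real (n - 1) * funk_hecke_coeff d (n - 2) j = 0"
  proof (cases "n < 2")
    case False
    then obtain k where "n = Suc (Suc k)" by (metis Suc_1 add_2_eq_Suc le_add_diff_inverse not_less)
    then show ?thesis using \<open>\<not> (j \<le> n \<and> even (n - j))\<close> by (auto simp: funk_hecke_coeff_def Suc_diff_le)
  qed (use assms in auto)
  moreover have "funk_hecke_coeff d n j = 0" using False unfolding funk_hecke_coeff_def by presburger
  ultimately show ?thesis by auto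
next
  case True
  then obtain m where n: "n = j + 2 * m" by (metis dvdE le_add_diff_inverse)
  let ?x = "real m + real j + real d / 2"
  \<comment> \<open>All three coefficients become multiples of this number once Gamma is shifted to
    \<open>?x - 1\<close>; the recurrence then reads 4 (j + m) K = 4 j K + 4 m K.\<close>
  define K where "K = 2 * pi powr (real d / 2) * fact n / (2 ^ n * fact m * Gamma (?x - 1))"
  have x: "?x - 1 > 0" using assms n by (cases m; cases j) auto
  then have "Gamma ?x = (?x - 1) * Gamma (?x - 1)"
    using Gamma_plus1[of "?x - 1"] nonpos_Ints_nonpos[of "?x - 1"] by fastforce
  then have c1: "funk_hecke_coeff d n j * (?x - 1) = K"
    unfolding n funk_hecke_coeff_eq K_def using x by simp
  have c2: "real n * (real j * funk_hecke_coeff d (n - 1) (j - 1)) = 2 * real j * K"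
  proof (cases j)
    case (Suc i)
    have e: "real m + real i + real d / 2 = ?x - 1" by (simp add: Suc)
    have "n - 1 = i + 2 * m" by (simp add: n Suc)
    then have "funk_hecke_coeff d (n - 1) (j - 1) = 2 * pi powr (real d / 2) * fact (n - 1) / (2 ^ (n - 1) * fact m * Gamma (?x - 1))"
      using funk_hecke_coeff_eq[of d i m] e Suc by simp
    moreover have "fact n = real n * fact (n - 1)" "(2::real) ^ n = 2 * 2 ^ (n - 1)"
      using assms by (simp_all add: fact_reduce power_eq_if)
    ultimately show ?thesis by (simp add: K_def mult_ac)
  qed simp
  have c3: "real n * real (n - 1) * funk_hecke_coeff d (n - 2) j = 4 * real m * K"
  proof (cases m)
    case 0
    then show ?thesis using n assms by (auto simp: funk_hecke_coeff_def)
  next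
    case (Suc i)
    have e: "real i + real j + real d / 2 = ?x - 1" by (simp add: Suc)
    have "n - 2 = j + 2 * i" by (simp add: n Suc)
    then have "funk_hecke_coeff d (n - 2) j = 2 * pi powr (real d / 2) * fact (n - 2) / (2 ^ (n - 2) * fact i * Gamma (?x - 1))"
      using funk_hecke_coeff_eq[of d j i] e Suc by simp
    moreover have "fact n = real n * real (n - 1) * fact (n - 2)" "(2::real) ^ n = 4 * 2 ^ (n - 2)"
      using n Suc by (simp_all add: fact_reduce power_eq_if numeral_2_eq_2)
    moreover have "fact m = real m * fact i" by (simp add: Suc)
    moreover have "real m \<noteq> 0" by (simp add: Suc)
    moreover have "Gamma (?x - 1) \<noteq> 0" using Gamma_real_pos[OF x] by linarith
    ultimately show ?thesis unfolding K_def by (simp add: field_simps)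
  qed
  have "real (j + n) * (real (j + n) + real d - 2) * funk_hecke_coeff d n j = 4 * (real j + real m) * (funk_hecke_coeff d n j * (?x - 1))"
    by (simp add: n algebra_simps)
  also have "\<dots> = 2 * (real n * (real j * funk_hecke_coeff d (n - 1) (j - 1))) + real n * real (n - 1) * funk_hecke_coeff d (n - 2) j"
    unfolding c1 c2 c3 by (simp add: algebra_simps)
  finally show ?thesis by simp
qed

text \<open>Apply \<open>hpoly_sphere_laplacian\<close> to \<open>f\<close> times the n-th power of
  the form. Since \<open>f\<close> is harmonic, only two terms survive: the derivative of
  \<open>f\<close> along \<theta>, harmonic of degree j - 1, with power n - 1, and \<open>f\<close>
  with power n - 2. At \<theta> Euler's identity turns that derivative into j f(\<theta>), so both
  are multiples of \<open>f \<theta>\<close> by induction.\<close>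

lemma homog_harmonic_inner_power:
  fixes f :: "'a::euclidean_space \<Rightarrow> real"
  assumes d: "DIM('a) \<ge> 2" and \<theta>: "norm \<theta> = 1" and "homog_harmonic j f"
  shows "(LINT u|sphere_measure. f u * (\<theta> \<bullet> u) ^ n) = funk_hecke_coeff DIM('a) n j * f \<theta>"
  using assms(3)
proof (induction n arbitrary: j f rule: less_induct)
  case (less n)
  have f: "hpoly j f" "\<And>x. laplacian f x = 0" using less.prems by (auto simp: homog_harmonic_iff)
  show ?case
  proof (cases "n = 0")
    case True
    show ?thesis
    proof (cases "j = 0")
      case True
      then obtain c where c: "f = (\<lambda>x. c)" using hpoly_0_const[OF f(1)] by blast
      have "measure sphere_measure (UNIV :: 'a set) = 2 * pi powr (real DIM('a) / 2) / Gamma (real DIM('a) / 2)"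
        by (simp add: measure_def emeasure_sphere_measure_UNIV)
      then show ?thesis using \<open>n = 0\<close> True by (simp add: c funk_hecke_coeff_def)
    next
      case False
      have "real j * (real j + real DIM('a) - 2) * (LINT u|sphere_measure. f u) = 0"
        using hpoly_sphere_laplacian[OF f(1)] f(2) by simp
      then show ?thesis using False d \<open>n = 0\<close> by (auto simp: funk_hecke_coeff_def)
    qed
  next
    case False
    let ?L = "\<lambda>u::'a. \<theta> \<bullet> u"
    have hp: "hpoly k (\<lambda>u. ?L u ^ k)" for k using hpoly_power[OF hpoly_inner, of k \<theta>] by simp
    have dL: "dir_deriv v (\<lambda>u. ?L u ^ k) = (\<lambda>u. real k * (\<theta> \<bullet> v) * ?L u ^ (k - 1))" for v k
      by (intro ext dir_derivI) (auto intro!: derivative_eq_intros simp: inner_add_right)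
    have th: "(\<Sum>b\<in>Basis. (\<theta> \<bullet> b) * (\<theta> \<bullet> b)) = 1"
      using \<theta> euclidean_inner[of \<theta> \<theta>] by (simp add: norm_eq_sqrt_inner)
    have lapL: "laplacian (\<lambda>u. ?L u ^ n) x = real n * real (n - 1) * ?L x ^ (n - 2)" for x
    proof -
      have "dir_deriv b (dir_deriv b (\<lambda>u. ?L u ^ n)) x = (\<theta> \<bullet> b) * (\<theta> \<bullet> b) * (real n * real (n - 1) * ?L x ^ (n - 2))" for b
        unfolding dL dir_deriv_scale[OF hp] by (simp add: numeral_2_eq_2)
      then show ?thesis by (simp add: laplacian_hpoly[OF hp] sum_distrib_right[symmetric] th)
    qed
    have lap: "laplacian (\<lambda>u. f u * ?L u ^ n) x = 2 * real n * (dir_deriv \<theta> f x * ?L x ^ (n - 1)) + real n * real (n - 1) * (f x * ?L x ^ (n - 2))" for x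
    proof -
      have "(\<Sum>b\<in>Basis. dir_deriv b f x * dir_deriv b (\<lambda>u. ?L u ^ n) x) = real n * (dir_deriv \<theta> f x * ?L x ^ (n - 1))"
        by (simp add: dL dir_deriv_basis[OF f(1), of \<theta>] sum_distrib_left sum_distrib_right mult_ac)
      then show ?thesis by (simp add: laplacian_mult[OF f(1) hp] f(2) lapL)
    qed
    note df = hpoly_dir_deriv(2)[OF f(1)]
    have ih1: "(LINT u|sphere_measure. dir_deriv \<theta> f u * ?L u ^ (n - 1)) = funk_hecke_coeff DIM('a) (n - 1) (j - 1) * (real j * f \<theta>)"
      using less.IH[OF _ homog_harmonic_dir_deriv[OF less.prems]] False hpoly_euler[OF f(1)] by simp
    have ih2: "real (n - 1) * (LINT u|sphere_measure. f u * ?L u ^ (n - 2)) = real (n - 1) * (funk_hecke_coeff DIM('a) (n - 2) j * f \<theta>)"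
      using less.IH[OF _ less.prems, of "n - 2"] False by simp
    have "real (j + n) * (real (j + n) + real DIM('a) - 2) * (LINT u|sphere_measure. f u * ?L u ^ n) =
      (LINT u|sphere_measure. laplacian (\<lambda>u. f u * ?L u ^ n) u)"
      by (rule hpoly_sphere_laplacian[OF hpoly_mult[OF f(1) hp], symmetric])
    also have "\<dots> = 2 * real n * (LINT u|sphere_measure. dir_deriv \<theta> f u * ?L u ^ (n - 1)) + real n * (real (n - 1) * (LINT u|sphere_measure. f u * ?L u ^ (n - 2)))"
      unfolding lap
      by (subst Bochner_Integration.integral_add)
         (simp_all add: integrable_sphere_hpoly[OF hpoly_mult[OF df hp]] integrable_sphere_hpoly[OF hpoly_mult[OF f(1) hp]])
    also have "\<dots> = real (j + n) * (real (j + n) + real DIM('a) - 2) * (funk_hecke_coeff DIM('a) n j * f \<theta>)"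
    proof -
      have "2 * real n * (funk_hecke_coeff DIM('a) (n - 1) (j - 1) * (real j * f \<theta>)) + real n * (real (n - 1) * (funk_hecke_coeff DIM('a) (n - 2) j * f \<theta>)) =
        (2 * real n * (real j * funk_hecke_coeff DIM('a) (n - 1) (j - 1)) + real n * real (n - 1) * funk_hecke_coeff DIM('a) (n - 2) j) * f \<theta>"
        by (simp only: distrib_right distrib_left mult_ac)
      also have "\<dots> = real (j + n) * (real (j + n) + real DIM('a) - 2) * funk_hecke_coeff DIM('a) n j * f \<theta>"
        using funk_hecke_coeff_rec[OF d, of n j] False by (simp only:)
      finally show ?thesis unfolding ih1 ih2 by (simp only: mult.assoc)
    qed
    finally show ?thesis using d False by auto
  qed
qed


section \<open>Harmonic decomposition on the sphere\<close>

lemma homog_harmonic_zero: "homog_harmonic n (\<lambda>x. 0)"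
  by (simp add: homog_harmonic_iff hpoly_zero laplacian_def)

lemma homog_harmonic_add: "homog_harmonic n f \<Longrightarrow> homog_harmonic n g \<Longrightarrow> homog_harmonic n (\<lambda>x. f x + g x)"
  unfolding homog_harmonic_iff by (auto intro: hpoly.add simp: laplacian_add)

lemma homog_harmonic_scale: "homog_harmonic n f \<Longrightarrow> homog_harmonic n (\<lambda>x. c * f x)"
  unfolding homog_harmonic_iff by (auto intro: hpoly_scale simp: laplacian_scale)

lemma homog_harmonic_diff: "homog_harmonic n f \<Longrightarrow> homog_harmonic n g \<Longrightarrow> homog_harmonic n (\<lambda>x. f x - g x)"
  using homog_harmonic_add[of n f "\<lambda>x. -1 * g x"] homog_harmonic_scale[of n g "-1"] by simp

text \<open>Equality is asked on the sphere only, where |u|^2 = 1; this is what lets components of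
  different degree add up to a homogeneous polynomial.\<close>

definition harm_sum :: "nat \<Rightarrow> ('a::euclidean_space \<Rightarrow> real) \<Rightarrow> bool" where
  "harm_sum n f \<longleftrightarrow> (\<exists>Y. (\<forall>j\<le>n. homog_harmonic j (Y j)) \<and> (\<forall>u\<in>sphere 0 1. f u = (\<Sum>j\<le>n. Y j u)))"

lemma harm_sum_harmonic:
  assumes "homog_harmonic k f" "k \<le> n" shows "harm_sum n f"
  unfolding harm_sum_def
proof (intro exI conjI ballI allI impI)
  show "homog_harmonic j (if j = k then f else (\<lambda>x. 0))" for j
    using assms by (simp add: homog_harmonic_zero)
  show "f u = (\<Sum>j\<le>n. (if j = k then f else (\<lambda>x. 0)) u)" for u
    using assms(2) by (simp add: if_distribR sum.delta)
qed

lemma harm_sum_add: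
  assumes "harm_sum n f" "harm_sum n g" shows "harm_sum n (\<lambda>x. f x + g x)"
proof -
  obtain Y Z where "\<forall>j\<le>n. homog_harmonic j (Y j)" "\<forall>u\<in>sphere 0 1. f u = (\<Sum>j\<le>n. Y j u)"
    "\<forall>j\<le>n. homog_harmonic j (Z j)" "\<forall>u\<in>sphere 0 1. g u = (\<Sum>j\<le>n. Z j u)"
    using assms unfolding harm_sum_def by blast
  then show ?thesis unfolding harm_sum_def
    by (intro exI[of _ "\<lambda>j x. Y j x + Z j x"]) (auto intro: homog_harmonic_add simp: sum.distrib)
qed

lemma harm_sum_scale:
  assumes "harm_sum n f" shows "harm_sum n (\<lambda>x. c * f x)"
proof -
  obtain Y where "\<forall>j\<le>n. homog_harmonic j (Y j)" "\<forall>u\<in>sphere 0 1. f u = (\<Sum>j\<le>n. Y j u)"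
    using assms unfolding harm_sum_def by blast
  then show ?thesis unfolding harm_sum_def
    by (intro exI[of _ "\<lambda>j x. c * Y j x"]) (auto intro: homog_harmonic_scale simp: sum_distrib_left)
qed

lemma harm_sum_diff: "harm_sum n f \<Longrightarrow> harm_sum n g \<Longrightarrow> harm_sum n (\<lambda>x. f x - g x)"
  using harm_sum_add[of n f "\<lambda>x. -1 * g x"] harm_sum_scale[of n g "-1"] by simp

lemma harm_sum_sum:
  "finite A \<Longrightarrow> (\<And>i. i \<in> A \<Longrightarrow> harm_sum n (f i)) \<Longrightarrow> harm_sum n (\<lambda>x. \<Sum>i\<in>A. f i x)"
  by (induction A rule: finite_induct) (auto intro: harm_sum_add harm_sum_harmonic[OF homog_harmonic_zero])

lemma harm_sum_cong: "harm_sum n f \<Longrightarrow> (\<And>u. u \<in> sphere 0 1 \<Longrightarrow> f u = g u) \<Longrightarrow> harm_sum n g"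
  unfolding harm_sum_def by auto

lemma harm_sum_mono:
  assumes "harm_sum n f" "n \<le> m" shows "harm_sum m f"
proof -
  obtain Y where Y: "\<forall>j\<le>n. homog_harmonic j (Y j)" "\<forall>u\<in>sphere 0 1. f u = (\<Sum>j\<le>n. Y j u)"
    using assms unfolding harm_sum_def by blast
  have "harm_sum m (\<lambda>u. \<Sum>j\<le>n. Y j u)"
  proof (rule harm_sum_sum)
    fix j assume "j \<in> {..n}"
    then show "harm_sum m (Y j)" using Y(1) assms(2) by (intro harm_sum_harmonic[of j]) auto
  qed simp
  then show ?thesis by (rule harm_sum_cong) (use Y in auto)
qed

text \<open>Restricted to the sphere, the splitting f = (f - |x|^2 s) + |x|^2 s is a harmonic of
  degree n plus the polynomial \<open>s\<close> of degree n - 2, and the descent continues with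
  \<open>s\<close>.\<close>

lemma harm_sum_hpoly: "hpoly n f \<Longrightarrow> harm_sum n f"
proof (induction n arbitrary: f rule: less_induct)
  case (less n)
  show ?case
  proof (cases "n < 2")
    case True
    then have "homog_harmonic n f" using less laplacian_low by (auto simp: homog_harmonic_iff)
    then show ?thesis by (rule harm_sum_harmonic) simp
  next
    case False
    define m where "m = n - 2"
    have n: "n = m + 2" using False by (simp add: m_def)
    from harmonic_split[OF less.prems[unfolded n]] obtain s where
      s: "hpoly m s" "hpoly n (\<lambda>x. f x - (norm x)\<^sup>2 * s x)"
         "\<forall>x. laplacian (\<lambda>x. f x - (norm x)\<^sup>2 * s x) x = 0" unfolding n by blast
    have "harm_sum n (\<lambda>x. f x - (norm x)\<^sup>2 * s x)"
      using s by (intro harm_sum_harmonic[of n]) (auto simp: homog_harmonic_iff)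
    moreover have "harm_sum n s"
      by (rule harm_sum_mono[OF less.IH[OF _ s(1)]]) (auto simp: n)
    ultimately have "harm_sum n (\<lambda>x. (f x - (norm x)\<^sup>2 * s x) + s x)" by (rule harm_sum_add)
    then show ?thesis by (rule harm_sum_cong) auto
  qed
qed

text \<open>A product of harmonics is in general not harmonic, but it is a homogeneous polynomial of
  the summed degree and can be decomposed again.\<close>

lemma harm_sum_mult:
  assumes "harm_sum n f" "harm_sum m g" shows "harm_sum (n + m) (\<lambda>x. f x * g x)"
proof -
  obtain Y where Y: "\<forall>j\<le>n. homog_harmonic j (Y j)" "\<forall>u\<in>sphere 0 1. f u = (\<Sum>j\<le>n. Y j u)"
    using assms(1) unfolding harm_sum_def by blast
  obtain Z where Z: "\<forall>j\<le>m. homog_harmonic j (Z j)" "\<forall>u\<in>sphere 0 1. g u = (\<Sum>j\<le>m. Z j u)"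
    using assms(2) unfolding harm_sum_def by blast
  have "harm_sum (n + m) (\<lambda>u. Y i u * Z j u)" if "i \<le> n" "j \<le> m" for i j
  proof (rule harm_sum_mono)
    show "harm_sum (i + j) (\<lambda>u. Y i u * Z j u)"
      using Y Z that by (intro harm_sum_hpoly hpoly_mult) (auto simp: homog_harmonic_iff)
  qed (use that in simp)
  then have "harm_sum (n + m) (\<lambda>u. \<Sum>i\<le>n. \<Sum>j\<le>m. Y i u * Z j u)"
    by (intro harm_sum_sum) auto
  then show ?thesis by (rule harm_sum_cong) (use Y Z in \<open>simp add: sum_product\<close>)
qed

text \<open>\<open>sphere_poly\<close> leaves \<open>P\<close> arbitrary off the sphere. The
  polynomial \<open>p\<close> is a continuous substitute on the whole space, and all analysis is
  done with it.\<close>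

lemma sphere_poly_decompose:
  assumes "sphere_poly q P"
  obtains p where "continuous_on UNIV p" "harm_sum q p" "\<And>u. norm u = 1 \<Longrightarrow> P u = p u"
proof -
  obtain c where c: "\<And>u. norm u = 1 \<Longrightarrow> P u = poly_fun (multi_indices q) c u"
    using assms unfolding sphere_poly_def by auto
  have un: "multi_indices q = (\<Union>i\<le>q. homog_indices i :: ('a \<Rightarrow> nat) set)"
    by (auto simp: multi_indices_def homog_indices_def)
  have "poly_fun (multi_indices q) c = (\<lambda>u. \<Sum>i\<le>q. poly_fun (homog_indices i) c u)"
    unfolding poly_fun_def un
    by (intro ext sum.UNION_disjoint) (auto simp: finite_homog_indices, auto simp: homog_indices_def)
  moreover have "harm_sum q (\<lambda>u. \<Sum>i\<le>q. poly_fun (homog_indices i) c u)"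
    by (intro harm_sum_sum harm_sum_mono[OF harm_sum_hpoly[OF hpoly_poly_fun]]) auto
  moreover have "continuous_on UNIV (\<lambda>u. \<Sum>i\<le>q. poly_fun (homog_indices i) c u)"
    by (intro continuous_intros hpoly_continuous[OF hpoly_poly_fun])
  ultimately show ?thesis using c that[of "poly_fun (multi_indices q) c"] by simp
qed

lemma homog_harmonic_continuous: "homog_harmonic j f \<Longrightarrow> continuous_on A f"
  using hpoly_continuous by (auto simp: homog_harmonic_iff)

lemma homog_harmonic_measurable [measurable_dest]: "homog_harmonic j f \<Longrightarrow> f \<in> borel_measurable borel"
  using hpoly_measurable by (auto simp: homog_harmonic_iff)

lemma sphere_inner_le_1: "norm \<theta> = 1 \<Longrightarrow> norm u = 1 \<Longrightarrow> \<bar>\<theta> \<bullet> u\<bar> \<le> 1"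
  using Cauchy_Schwarz_ineq2[of \<theta> u] by simp

text \<open>Powers are covered by the previous formula; by Weierstrass approximation the relation
  \<open>I(\<theta>) f(\<theta>0) = I(\<theta>0) f(\<theta>)\<close> extends to continuous kernels.\<close>

lemma funk_hecke_continuous:
  fixes f :: "'a::euclidean_space \<Rightarrow> real" and h :: "real \<Rightarrow> real"
  assumes d: "DIM('a) \<ge> 2" and f: "homog_harmonic j f" and h: "continuous_on UNIV h"
  obtains c where "\<And>\<theta>. norm \<theta> = 1 \<Longrightarrow> (LINT u|sphere_measure. f u * h (\<theta> \<bullet> u)) = c * f \<theta>"
proof (cases "\<exists>\<theta>0. norm \<theta>0 = 1 \<and> f \<theta>0 \<noteq> 0")
  case False
  have "(LINT u|sphere_measure. f u * h (\<theta> \<bullet> u)) = 0" for \<theta>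
  proof (rule integral_eq_zero_AE)
    show "AE u in sphere_measure. f u * h (\<theta> \<bullet> u) = 0"
      using AE_sphere_measure by eventually_elim (use False in auto)
  qed
  then show ?thesis using False by (intro that[of 0]) simp
next
  case True
  then obtain \<theta>0 where \<theta>0: "norm \<theta>0 = 1" "f \<theta>0 \<noteq> 0" by blast
  have cf: "continuous_on UNIV f" by (rule homog_harmonic_continuous[OF f])
  have [measurable]: "f \<in> borel_measurable borel" by (rule homog_harmonic_measurable[OF f])
  let ?I = "\<lambda>h \<theta>. (LINT u|sphere_measure. f u * h (\<theta> \<bullet> u))"
  let ?w = "measure sphere_measure (UNIV :: 'a set)"
  obtain B where B: "B \<ge> 0" "\<And>u. norm u = 1 \<Longrightarrow> \<bar>f u\<bar> \<le> B"
    using hpoly_bound[of j f] f by (auto simp: homog_harmonic_iff) (metis mult.right_neutral power_one)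
  have int: "integrable sphere_measure (\<lambda>u. f u * g (\<theta> \<bullet> u))" if "continuous_on UNIV g" for g :: "real \<Rightarrow> real" and \<theta>
    by (intro integrable_sphere_continuous continuous_intros cf continuous_on_compose2[OF that]) auto
  have key: "?I h \<theta> * f \<theta>0 = ?I h \<theta>0 * f \<theta>" if \<theta>: "norm \<theta> = 1" for \<theta>
  proof (rule ccontr)
    assume ne: "?I h \<theta> * f \<theta>0 \<noteq> ?I h \<theta>0 * f \<theta>"
    define X where "X = \<bar>?I h \<theta> * f \<theta>0 - ?I h \<theta>0 * f \<theta>\<bar>"
    have X: "X > 0" using ne by (simp add: X_def)
    \<comment> \<open>Each of the two approximation errors contributes at most
      \<open>B * e * ?w * B\<close>, together \<open>e * K\<close>; the choice of \<open>e\<close>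
      below keeps this at most \<open>X / 2\<close>, with \<open>K + 1\<close> guarding against
      \<open>K = 0\<close>.\<close>
    define K where "K = 2 * (B * ?w * B)"
    have K: "K \<ge> 0" using B by (simp add: K_def)
    define e where "e = X / (2 * (K + 1))"
    have e: "e > 0" using X K by (simp add: e_def)
    obtain g where g: "real_polynomial_function g" "\<And>x. x \<in> {-1..1} \<Longrightarrow> \<bar>h x - g x\<bar> < e"
      using Stone_Weierstrass_real_polynomial_function[of "{-1..1}" h e] e continuous_on_subset[OF h] by auto
    obtain a N where gN: "g = (\<lambda>x. \<Sum>i\<le>N. a i * x ^ i)"
      using g(1) unfolding real_polynomial_function_iff_sum by blast
    have cg: "continuous_on UNIV g" unfolding gN by (intro continuous_intros)
    have Ig: "?I g \<theta> = (\<Sum>i\<le>N. a i * funk_hecke_coeff DIM('a) i j) * f \<theta>" if "norm \<theta> = 1" for \<theta>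
    proof -
      have "?I g \<theta> = (LINT u|sphere_measure. (\<Sum>i\<le>N. a i * (f u * (\<theta> \<bullet> u) ^ i)))"
        by (simp add: gN sum_distrib_left mult_ac)
      also have "\<dots> = (\<Sum>i\<le>N. (LINT u|sphere_measure. a i * (f u * (\<theta> \<bullet> u) ^ i)))"
        by (intro Bochner_Integration.integral_sum integrable_mult_right int continuous_intros)
      also have "\<dots> = (\<Sum>i\<le>N. a i * (funk_hecke_coeff DIM('a) i j * f \<theta>))"
        by (simp add: homog_harmonic_inner_power[OF d that f])
      finally show ?thesis by (simp add: sum_distrib_right mult.assoc)
    qed
    have near: "\<bar>?I h \<theta> - ?I g \<theta>\<bar> \<le> B * e * ?w" if "norm \<theta> = 1" for \<theta>
    proof -
      have "?I h \<theta> - ?I g \<theta> = (LINT u|sphere_measure. f u * (h (\<theta> \<bullet> u) - g (\<theta> \<bullet> u)))"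
        using int[OF h] int[OF cg] by (simp add: right_diff_distrib)
      also have "\<bar>\<dots>\<bar> \<le> (LINT u|sphere_measure. \<bar>f u * (h (\<theta> \<bullet> u) - g (\<theta> \<bullet> u))\<bar>)"
        by (rule integral_abs_bound)
      also have "\<dots> \<le> (LINT u|(sphere_measure :: 'a measure). B * e)"
      proof (rule integral_mono_AE)
        show "integrable sphere_measure (\<lambda>u. \<bar>f u * (h (\<theta> \<bullet> u) - g (\<theta> \<bullet> u))\<bar>)"
          using int[of "\<lambda>x. h x - g x"] h cg by (intro integrable_abs) (auto intro!: continuous_intros)
        show "AE u in sphere_measure. \<bar>f u * (h (\<theta> \<bullet> u) - g (\<theta> \<bullet> u))\<bar> \<le> B * e"
          using AE_sphere_measure
        proof eventually_elim
          case (elim u)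
          have "\<bar>h (\<theta> \<bullet> u) - g (\<theta> \<bullet> u)\<bar> \<le> e"
            using g(2)[of "\<theta> \<bullet> u"] sphere_inner_le_1[OF that elim] by (auto simp: abs_le_iff)
          then show ?case using B(2)[OF elim] B(1) by (simp add: abs_mult mult_mono)
        qed
      qed auto
      finally show ?thesis by (simp add: mult_ac)
    qed
    have sym: "?I g \<theta> * f \<theta>0 = ?I g \<theta>0 * f \<theta>" by (simp add: Ig[OF \<theta>] Ig[OF \<theta>0(1)])
    have "?I h \<theta> * f \<theta>0 - ?I h \<theta>0 * f \<theta> = (?I h \<theta> - ?I g \<theta>) * f \<theta>0 - (?I h \<theta>0 - ?I g \<theta>0) * f \<theta>"
      using sym by (simp add: algebra_simps)
    then have "X \<le> \<bar>(?I h \<theta> - ?I g \<theta>) * f \<theta>0\<bar> + \<bar>(?I h \<theta>0 - ?I g \<theta>0) * f \<theta>\<bar>"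
      unfolding X_def by (simp only: abs_triangle_ineq4)
    then have "X \<le> \<bar>?I h \<theta> - ?I g \<theta>\<bar> * \<bar>f \<theta>0\<bar> + \<bar>?I h \<theta>0 - ?I g \<theta>0\<bar> * \<bar>f \<theta>\<bar>"
      by (simp only: abs_mult)
    also have "\<dots> \<le> B * e * ?w * B + B * e * ?w * B"
      using near[OF \<theta>] near[OF \<theta>0(1)] B(1) B(2)[OF \<theta>] B(2)[OF \<theta>0(1)] e
      by (intro add_mono mult_mono) (auto intro!: mult_nonneg_nonneg)
    also have "\<dots> = e * K" by (simp add: K_def)
    also have "\<dots> \<le> X / 2" using K X unfolding e_def by (simp add: field_simps)
    finally show False using X by simp
  qed
  show ?thesis
    by (rule that[of "?I h \<theta>0 / f \<theta>0"]) (use key \<theta>0 in \<open>simp add: field_simps\<close>)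
qed

text \<open>A zonal kernel multiplies every harmonic component by a constant, whatever the kernel.
  Hence the degree bound survives convolution with the kernels of \<open>V\<close>, although these
  are not polynomials.\<close>

lemma harm_sum_convolution:
  fixes f :: "'a::euclidean_space \<Rightarrow> real" and h :: "real \<Rightarrow> real"
  assumes d: "DIM('a) \<ge> 2" and f: "harm_sum n f" "f \<in> borel_measurable borel" and h: "continuous_on UNIV h"
  shows "harm_sum n (\<lambda>\<theta>. LINT u|sphere_measure. f u * h (\<theta> \<bullet> u))"
proof -
  obtain Y where Y: "\<And>j. j \<le> n \<Longrightarrow> homog_harmonic j (Y j)" "\<And>u. u \<in> sphere 0 1 \<Longrightarrow> f u = (\<Sum>j\<le>n. Y j u)"
    using f(1) unfolding harm_sum_def by blast
  have "\<exists>c. \<forall>\<theta>. norm \<theta> = 1 \<longrightarrow> (LINT u|sphere_measure. Y j u * h (\<theta> \<bullet> u)) = c * Y j \<theta>" if "j \<le> n" for j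
    using funk_hecke_continuous[OF d Y(1)[OF that] h] by metis
  then obtain c where c: "\<And>j \<theta>. j \<le> n \<Longrightarrow> norm \<theta> = 1 \<Longrightarrow> (LINT u|sphere_measure. Y j u * h (\<theta> \<bullet> u)) = c j * Y j \<theta>"
    by metis
  have [measurable]: "h \<in> borel_measurable borel" by (rule borel_measurable_continuous_onI[OF h])
  note [measurable] = f(2)
  have eq: "(LINT u|sphere_measure. f u * h (\<theta> \<bullet> u)) = (\<Sum>j\<le>n. c j * Y j \<theta>)" if "norm \<theta> = 1" for \<theta>
  proof -
    have [measurable]: "(\<lambda>u. \<Sum>j\<le>n. Y j u * h (\<theta> \<bullet> u)) \<in> borel_measurable borel"
      by (intro borel_measurable_sum borel_measurable_times homog_harmonic_measurable[OF Y(1)]) auto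
    have "(LINT u|sphere_measure. f u * h (\<theta> \<bullet> u)) = (LINT u|sphere_measure. (\<Sum>j\<le>n. Y j u * h (\<theta> \<bullet> u)))"
    proof (rule integral_cong_AE)
      show "AE u in sphere_measure. f u * h (\<theta> \<bullet> u) = (\<Sum>j\<le>n. Y j u * h (\<theta> \<bullet> u))"
        using AE_sphere_measure by eventually_elim (simp add: Y(2) sum_distrib_right)
    qed measurable
    also have "\<dots> = (\<Sum>j\<le>n. (LINT u|sphere_measure. Y j u * h (\<theta> \<bullet> u)))"
      using Y(1) by (intro Bochner_Integration.integral_sum integrable_sphere_continuous continuous_intros
          homog_harmonic_continuous continuous_on_compose2[OF h]) auto
    finally show ?thesis using that by (simp add: c)
  qed
  have "harm_sum n (\<lambda>\<theta>. \<Sum>j\<le>n. c j * Y j \<theta>)"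
    using Y(1) by (intro harm_sum_sum harm_sum_scale harm_sum_harmonic[of _ "Y _"]) auto
  then show ?thesis by (rule harm_sum_cong) (simp add: eq)
qed


section \<open>Spherical harmonics and their projections\<close>

lemma borel_measurable_cnj [measurable]: "cnj \<in> borel_measurable borel"
  by (intro borel_measurable_continuous_onI continuous_intros)

lemma integral_Re_Im_split:
  fixes a b :: "'a \<Rightarrow> real"
  assumes "integrable M a" "integrable M b"
  shows "(CLINT x|M. complex_of_real (a x) + \<i> * complex_of_real (b x)) =
    complex_of_real (LINT x|M. a x) + \<i> * complex_of_real (LINT x|M. b x)"
  using assms by (subst Bochner_Integration.integral_add) (simp_all add: integral_complex_of_real)

text \<open>The value 0 off the sphere agrees with \<open>spherical_harmonics\<close> and makes
  functions equal as soon as they agree on the sphere, as the uniqueness behind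
  \<open>sph_proj\<close> demands.\<close>

definition sph_complex :: "('a::euclidean_space \<Rightarrow> real) \<Rightarrow> ('a \<Rightarrow> real) \<Rightarrow> 'a \<Rightarrow> complex" where
  "sph_complex f g u = (if u \<in> sphere 0 1 then Complex (f u) (g u) else 0)"

lemma spherical_harmonics_iff:
  "h \<in> spherical_harmonics j \<longleftrightarrow> (\<exists>f g. homog_harmonic j f \<and> homog_harmonic j g \<and> h = sph_complex f g)"
  by (simp add: spherical_harmonics_def sph_complex_def[abs_def] Complex_eq cong: if_cong)

lemma sph_complex_measurable:
  assumes "homog_harmonic j f" "homog_harmonic k g"
  shows "sph_complex f g \<in> borel_measurable borel"
proof -
  have [measurable]: "f \<in> borel_measurable borel" "g \<in> borel_measurable borel"
    using assms by (auto intro: homog_harmonic_measurable)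
  have [measurable]: "sphere (0::'a) 1 \<in> sets borel" by auto
  show ?thesis unfolding sph_complex_def[abs_def] Complex_eq by measurable
qed

lemma spherical_harmonics_measurable: "h \<in> spherical_harmonics j \<Longrightarrow> h \<in> borel_measurable borel"
  unfolding spherical_harmonics_iff using sph_complex_measurable by blast

lemma spherical_harmonics_bounded:
  assumes "h \<in> spherical_harmonics j" obtains B where "B \<ge> 0" "\<And>u. norm (h u) \<le> B"
proof -
  obtain f g where h: "homog_harmonic j f" "homog_harmonic j g" "h = sph_complex f g"
    using assms unfolding spherical_harmonics_iff by blast
  obtain B where B: "B \<ge> 0" "\<forall>x. \<bar>f x\<bar> \<le> B * norm x ^ j" using hpoly_bound[of j f] h by (auto simp: homog_harmonic_iff)
  obtain C where C: "C \<ge> 0" "\<forall>x. \<bar>g x\<bar> \<le> C * norm x ^ j" using hpoly_bound[of j g] h by (auto simp: homog_harmonic_iff)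
  have "norm (h u) \<le> B + C" for u
  proof (cases "norm u = 1")
    case True
    have "norm (h u) \<le> \<bar>Re (h u)\<bar> + \<bar>Im (h u)\<bar>" by (rule cmod_le)
    also have "\<dots> \<le> B + C" using True B(2)[rule_format, of u] C(2)[rule_format, of u] by (simp add: h sph_complex_def)
    finally show ?thesis .
  qed (use B C in \<open>simp add: h sph_complex_def\<close>)
  then show ?thesis using that[of "B + C"] B C by simp
qed

lemma integrable_spherical_harmonics_mult:
  fixes F :: "'a::euclidean_space \<Rightarrow> complex"
  assumes h: "h \<in> spherical_harmonics j" and [measurable]: "F \<in> borel_measurable borel"
    and "\<And>u. norm u = 1 \<Longrightarrow> norm (F u) \<le> M"
  shows "integrable sphere_measure (\<lambda>u. F u * h u)" "integrable sphere_measure (\<lambda>u. F u * cnj (h u))"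
proof -
  obtain B where B: "B \<ge> 0" "\<And>u. norm (h u) \<le> B" using spherical_harmonics_bounded[OF h] by blast
  have [measurable]: "h \<in> borel_measurable borel" by (rule spherical_harmonics_measurable[OF h])
  have b: "norm (F u) * norm (h u) \<le> M * B" if "norm u = 1" for u
    using B assms(3)[OF that] by (intro mult_mono) (auto intro: order_trans[OF norm_ge_zero])
  show "integrable sphere_measure (\<lambda>u. F u * h u)" "integrable sphere_measure (\<lambda>u. F u * cnj (h u))"
    using b by (auto intro!: integrable_sphere_bounded[of _ "M * B"] simp: norm_mult)
qed

lemma spherical_harmonics_orthogonal:
  fixes h e :: "'a::euclidean_space \<Rightarrow> complex"
  assumes d: "DIM('a) \<ge> 2" and "h \<in> spherical_harmonics i" "e \<in> spherical_harmonics j" "i \<noteq> j"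
  shows "(CLINT u|sphere_measure. h u * cnj (e u)) = 0"
proof -
  obtain f g where h: "homog_harmonic i f" "homog_harmonic i g" "h = sph_complex f g"
    using assms unfolding spherical_harmonics_iff by blast
  obtain p q where e: "homog_harmonic j p" "homog_harmonic j q" "e = sph_complex p q"
    using assms unfolding spherical_harmonics_iff by blast
  have int: "integrable sphere_measure (\<lambda>u. a u * b u)" if "homog_harmonic i a" "homog_harmonic j b" for a b :: "'a \<Rightarrow> real"
    using that by (intro integrable_sphere_continuous continuous_intros homog_harmonic_continuous)
  have [measurable]: "f \<in> borel_measurable borel" "g \<in> borel_measurable borel" "p \<in> borel_measurable borel" "q \<in> borel_measurable borel"
    using h e by (auto intro: homog_harmonic_measurable)
  note [measurable] = spherical_harmonics_measurable[OF assms(2)] spherical_harmonics_measurable[OF assms(3)]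
  have "(CLINT u|sphere_measure. h u * cnj (e u)) =
     (CLINT u|sphere_measure. complex_of_real (f u * p u + g u * q u) + \<i> * complex_of_real (g u * p u - f u * q u))"
  proof (rule integral_cong_AE)
    show "AE u in sphere_measure. h u * cnj (e u) = complex_of_real (f u * p u + g u * q u) + \<i> * complex_of_real (g u * p u - f u * q u)"
      using AE_sphere_measure by eventually_elim (simp add: h(3) e(3) sph_complex_def complex_eq_iff)
  qed measurable
  also have "\<dots> = complex_of_real (LINT u|sphere_measure. f u * p u + g u * q u) + \<i> * complex_of_real (LINT u|sphere_measure. g u * p u - f u * q u)"
    by (intro integral_Re_Im_split Bochner_Integration.integrable_add Bochner_Integration.integrable_diff int h e)
  also have "\<dots> = 0"
    using int h(1,2) e(1,2) homog_harmonic_orthogonal[OF d _ _ assms(4)] by simp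
  finally show ?thesis .
qed

lemma spherical_harmonics_diff:
  "h \<in> spherical_harmonics j \<Longrightarrow> h' \<in> spherical_harmonics j \<Longrightarrow> (\<lambda>u. h u - h' u) \<in> spherical_harmonics j"
  unfolding spherical_harmonics_iff
proof (elim exE conjE)
  fix f g f' g' :: "'a \<Rightarrow> real"
  assume "homog_harmonic j f" "homog_harmonic j g" "h = sph_complex f g"
    "homog_harmonic j f'" "homog_harmonic j g'" "h' = sph_complex f' g'"
  then show "\<exists>f g. homog_harmonic j f \<and> homog_harmonic j g \<and> (\<lambda>u. h u - h' u) = sph_complex f g"
    by (intro exI[of _ "\<lambda>u. f u - f' u"] exI[of _ "\<lambda>u. g u - g' u"])
       (auto intro: homog_harmonic_diff simp: sph_complex_def fun_eq_iff complex_eq_iff)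
qed

text \<open>A vanishing L^2 norm gives zero almost everywhere, continuity gives zero on the whole
  sphere, and off the sphere the value is zero by construction.\<close>

lemma spherical_harmonics_eq_0:
  assumes h: "h \<in> spherical_harmonics j" and z: "(CLINT u|sphere_measure. h u * cnj (h u)) = 0"
  shows "h = (\<lambda>u. 0)"
proof -
  obtain f g where fg: "homog_harmonic j f" "homog_harmonic j g" "h = sph_complex f g"
    using h unfolding spherical_harmonics_iff by blast
  have [measurable]: "h \<in> borel_measurable borel" "f \<in> borel_measurable borel" "g \<in> borel_measurable borel"
    using spherical_harmonics_measurable[OF h] fg by (auto intro: homog_harmonic_measurable)
  have c: "continuous_on A (\<lambda>u. (f u)\<^sup>2 + (g u)\<^sup>2)" for A
    by (intro continuous_intros homog_harmonic_continuous[OF fg(1)] homog_harmonic_continuous[OF fg(2)])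
  have "(CLINT u|sphere_measure. h u * cnj (h u)) = (CLINT u|sphere_measure. complex_of_real ((f u)\<^sup>2 + (g u)\<^sup>2))"
  proof (rule integral_cong_AE)
    show "AE u in sphere_measure. h u * cnj (h u) = complex_of_real ((f u)\<^sup>2 + (g u)\<^sup>2)"
      using AE_sphere_measure by eventually_elim (simp add: fg(3) sph_complex_def complex_eq_iff power2_eq_square)
  qed measurable
  then have "(LINT u|sphere_measure. (f u)\<^sup>2 + (g u)\<^sup>2) = 0" using z by (metis integral_complex_of_real of_real_eq_0_iff)
  then have "AE u in sphere_measure. (f u)\<^sup>2 + (g u)\<^sup>2 = 0"
    using integral_nonneg_eq_0_iff_AE[OF integrable_sphere_continuous[OF c]] by simp
  from sphere_measure_continuous_zero[OF c this] have "(f u)\<^sup>2 + (g u)\<^sup>2 = 0" if "norm u = 1" for u using that by blast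
  then show ?thesis by (auto simp: fg(3) sph_complex_def fun_eq_iff complex_eq_iff)
qed

text \<open>Packages a function known to be a finite sum of harmonics. Orthogonality then identifies
  the definite description \<open>sph_proj\<close> with the given summands, and the summands can be
  estimated from \<open>F\<close>.\<close>

locale harmonic_expansion =
  fixes F :: "'a::euclidean_space \<Rightarrow> complex" and n :: nat and H :: "nat \<Rightarrow> 'a \<Rightarrow> complex"
  assumes dim: "DIM('a) \<ge> 2" and F_measurable [measurable]: "F \<in> borel_measurable borel"
    and H: "\<And>j. j \<le> n \<Longrightarrow> H j \<in> spherical_harmonics j"
    and F_eq: "\<And>u. norm u = 1 \<Longrightarrow> F u = (\<Sum>j\<le>n. H j u)"
begin

lemma F_bounded: obtains M where "\<And>u. norm u = 1 \<Longrightarrow> norm (F u) \<le> M"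
proof -
  have "\<exists>B. \<forall>u. norm (H j u) \<le> B" if "j \<le> n" for j
    using spherical_harmonics_bounded[OF H[OF that]] by metis
  then obtain B where B: "\<And>j u. j \<le> n \<Longrightarrow> norm (H j u) \<le> B j" by metis
  have "norm (F u) \<le> (\<Sum>j\<le>n. B j)" if "norm u = 1" for u
    unfolding F_eq[OF that] by (rule sum_norm_le) (use B in auto)
  then show ?thesis using that by blast
qed

lemma inner_eq:
  assumes j: "j \<le> n" and e: "e \<in> spherical_harmonics j"
  shows "(CLINT u|sphere_measure. F u * cnj (e u)) = (CLINT u|sphere_measure. H j u * cnj (e u))"
proof -
  have [measurable]: "e \<in> borel_measurable borel" by (rule spherical_harmonics_measurable[OF e])
  have [measurable]: "i \<le> n \<Longrightarrow> H i \<in> borel_measurable borel" for i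
    using spherical_harmonics_measurable[OF H] by blast
  have int: "integrable sphere_measure (\<lambda>u. H i u * cnj (e u))" if "i \<le> n" for i
    using spherical_harmonics_bounded[OF H[OF that]] that
    by (metis (mono_tags) integrable_spherical_harmonics_mult(2)[OF e] spherical_harmonics_measurable[OF H])
  have "(CLINT u|sphere_measure. F u * cnj (e u)) = (CLINT u|sphere_measure. (\<Sum>i\<le>n. H i u * cnj (e u)))"
  proof (rule integral_cong_AE)
    show "AE u in sphere_measure. F u * cnj (e u) = (\<Sum>i\<le>n. H i u * cnj (e u))"
      using AE_sphere_measure by eventually_elim (simp add: F_eq sum_distrib_right)
  qed (use int in \<open>auto intro!: borel_measurable_sum\<close>)
  also have "\<dots> = (\<Sum>i\<le>n. (CLINT u|sphere_measure. H i u * cnj (e u)))"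
    by (intro Bochner_Integration.integral_sum int) auto
  also have "\<dots> = (\<Sum>i\<le>n. if i = j then (CLINT u|sphere_measure. H j u * cnj (e u)) else 0)"
    by (intro sum.cong refl) (auto intro: spherical_harmonics_orthogonal[OF dim H e])
  finally show ?thesis using j by simp
qed

text \<open>For uniqueness, the difference \<open>D\<close> of two candidates is itself a harmonic
  of degree \<open>j\<close>; tested against itself it has zero L^2 norm.\<close>

lemma sph_proj_eq:
  assumes j: "j \<le> n" shows "sph_proj j F = H j"
proof -
  obtain M where M: "\<And>u. norm u = 1 \<Longrightarrow> norm (F u) \<le> M" using F_bounded by blast
  have iF: "integrable sphere_measure (\<lambda>u. F u * cnj (e u))" if "e \<in> spherical_harmonics j" for e
    by (rule integrable_spherical_harmonics_mult(2)[OF that F_measurable M])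
  have ih: "integrable sphere_measure (\<lambda>u. h u * cnj (e u))" if "h \<in> spherical_harmonics j" "e \<in> spherical_harmonics j" for h e
    using spherical_harmonics_bounded[OF that(1)]
    by (metis (mono_tags) integrable_spherical_harmonics_mult(2)[OF that(2)] spherical_harmonics_measurable[OF that(1)])
  show ?thesis unfolding sph_proj_def
  proof (rule the_equality)
    show "H j \<in> spherical_harmonics j \<and> (\<forall>e\<in>spherical_harmonics j. (CLINT u|sphere_measure. (F u - H j u) * cnj (e u)) = 0)"
      using H[OF j] inner_eq[OF j] Bochner_Integration.integral_diff[OF iF ih[OF H[OF j]]] by (auto simp: left_diff_distrib)
    fix h assume h: "h \<in> spherical_harmonics j \<and> (\<forall>e\<in>spherical_harmonics j. (CLINT u|sphere_measure. (F u - h u) * cnj (e u)) = 0)"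
    define D where "D = (\<lambda>u. H j u - h u)"
    have D: "D \<in> spherical_harmonics j" unfolding D_def using h H[OF j] by (intro spherical_harmonics_diff) auto
    have "(CLINT u|sphere_measure. F u * cnj (D u)) = (CLINT u|sphere_measure. h u * cnj (D u))"
    proof -
      have "(CLINT u|sphere_measure. (F u - h u) * cnj (D u)) = (CLINT u|sphere_measure. F u * cnj (D u)) - (CLINT u|sphere_measure. h u * cnj (D u))"
        unfolding left_diff_distrib using h D by (intro Bochner_Integration.integral_diff iF ih) auto
      then show ?thesis using h D by simp
    qed
    then have "(CLINT u|sphere_measure. H j u * cnj (D u)) = (CLINT u|sphere_measure. h u * cnj (D u))"
      using inner_eq[OF j D] by simp
    then have "(CLINT u|sphere_measure. D u * cnj (D u)) = 0"
      using ih[OF H[OF j] D] ih[of h D] h D unfolding D_def by (simp add: left_diff_distrib)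
    then have "D = (\<lambda>u. 0)" by (rule spherical_harmonics_eq_0[OF D])
    then show "h = H j" by (simp add: D_def fun_eq_iff)
  qed
qed

end

lemma spherical_harmonics_inner_power:
  fixes h :: "'a::euclidean_space \<Rightarrow> complex"
  assumes d: "DIM('a) \<ge> 2" and \<theta>: "norm \<theta> = 1" and h: "h \<in> spherical_harmonics j"
  shows "(CLINT u|sphere_measure. h u * complex_of_real ((\<theta> \<bullet> u) ^ n)) = complex_of_real (funk_hecke_coeff DIM('a) n j) * h \<theta>"
proof -
  obtain f g where fg: "homog_harmonic j f" "homog_harmonic j g" "h = sph_complex f g"
    using h unfolding spherical_harmonics_iff by blast
  have [measurable]: "h \<in> borel_measurable borel" "f \<in> borel_measurable borel" "g \<in> borel_measurable borel"
    using spherical_harmonics_measurable[OF h] fg by (auto intro: homog_harmonic_measurable)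
  have int: "integrable sphere_measure (\<lambda>u. f u * (\<theta> \<bullet> u) ^ n)" if "homog_harmonic j f" for f :: "'a \<Rightarrow> real"
    using that by (intro integrable_sphere_continuous continuous_intros homog_harmonic_continuous)
  have "(CLINT u|sphere_measure. h u * complex_of_real ((\<theta> \<bullet> u) ^ n)) =
    (CLINT u|sphere_measure. complex_of_real (f u * (\<theta> \<bullet> u) ^ n) + \<i> * complex_of_real (g u * (\<theta> \<bullet> u) ^ n))"
  proof (rule integral_cong_AE)
    show "AE u in sphere_measure. h u * complex_of_real ((\<theta> \<bullet> u) ^ n) = complex_of_real (f u * (\<theta> \<bullet> u) ^ n) + \<i> * complex_of_real (g u * (\<theta> \<bullet> u) ^ n)"
      using AE_sphere_measure by eventually_elim (simp add: fg(3) sph_complex_def Complex_eq distrib_right)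
  qed measurable
  also have "\<dots> = complex_of_real (LINT u|sphere_measure. f u * (\<theta> \<bullet> u) ^ n) + \<i> * complex_of_real (LINT u|sphere_measure. g u * (\<theta> \<bullet> u) ^ n)"
    by (intro integral_Re_Im_split int fg)
  also have "\<dots> = complex_of_real (funk_hecke_coeff DIM('a) n j) * h \<theta>"
    using \<theta> by (simp add: homog_harmonic_inner_power[OF d \<theta> fg(1)] homog_harmonic_inner_power[OF d \<theta> fg(2)] fg(3) sph_complex_def Complex_eq algebra_simps)
  finally show ?thesis .
qed

lemma funk_hecke_coeff_pos: "d > 0 \<Longrightarrow> funk_hecke_coeff d j j > 0"
  using Gamma_real_pos[of "real j + real d / 2"] by (simp add: funk_hecke_coeff_def)

text \<open>The projection is bounded in \<open>L\<^sup>1\<close> by orthogonality and AM-GM, and the values of a harmonic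
  \<open>h\<close> are recovered from its integrals against \<open>\<langle>\<theta>, u\<rangle>\<^sup>j\<close>.\<close>

lemma (in harmonic_expansion) H_bound:
  assumes j: "j \<le> n" and M: "\<And>u. norm u = 1 \<Longrightarrow> norm (F u) \<le> M" "M > 0" and \<theta>: "norm \<theta> = 1"
  shows "funk_hecke_coeff DIM('a) j j * norm (H j \<theta>) \<le> M * measure sphere_measure (UNIV :: 'a set)"
proof -
  let ?w = "measure sphere_measure (UNIV :: 'a set)"
  note h = H[OF j]
  obtain B where B: "B \<ge> 0" "\<And>u. norm (H j u) \<le> B" using spherical_harmonics_bounded[OF h] by blast
  have [measurable]: "H j \<in> borel_measurable borel" by (rule spherical_harmonics_measurable[OF h])
  have i1: "integrable sphere_measure (\<lambda>u. norm (H j u))"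
    by (rule integrable_sphere_bounded[of _ B]) (use B in auto)
  have i2: "integrable sphere_measure (\<lambda>u. (norm (H j u))\<^sup>2)"
    by (rule integrable_sphere_bounded[of _ "B\<^sup>2"]) (use B in \<open>auto intro: power_mono\<close>)
  have iF: "integrable sphere_measure (\<lambda>u. F u * cnj (H j u))"
    by (rule integrable_spherical_harmonics_mult(2)[OF h F_measurable M(1)])
  define a where "a = (LINT u|sphere_measure. norm (H j u))"
  define b where "b = (LINT u|sphere_measure. (norm (H j u))\<^sup>2)"
  have "complex_of_real b = (CLINT u|sphere_measure. H j u * cnj (H j u))"
    unfolding b_def by (subst integral_complex_of_real[symmetric]) (simp only: complex_norm_square)
  also have "\<dots> = (CLINT u|sphere_measure. F u * cnj (H j u))" using inner_eq[OF j h] by simp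
  finally have "\<bar>b\<bar> = norm (CLINT u|sphere_measure. F u * cnj (H j u))" by (metis norm_of_real)
  also have "\<dots> \<le> (LINT u|sphere_measure. norm (F u * cnj (H j u)))" by (rule integral_norm_bound)
  also have "\<dots> \<le> (LINT u|sphere_measure. M * norm (H j u))"
  proof (rule integral_mono_AE)
    show "AE u in sphere_measure. norm (F u * cnj (H j u)) \<le> M * norm (H j u)"
      using AE_sphere_measure by eventually_elim (simp add: norm_mult M mult_right_mono)
  qed (use iF i1 in auto)
  finally have b: "b \<le> M * a" by (simp add: a_def)
  \<comment> \<open>Here 2 M a is at most b + M^2 w pointwise under the integral, and the bound on
    \<open>b\<close> by \<open>M * a\<close> absorbs one of the two copies of
    \<open>M * a\<close>.\<close>
  have "2 * M * a = (LINT u|sphere_measure. 2 * M * norm (H j u))" by (simp add: a_def)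
  also have "\<dots> \<le> (LINT u|sphere_measure. (norm (H j u))\<^sup>2 + M\<^sup>2)"
  proof (rule integral_mono)
    show "2 * M * norm (H j u) \<le> (norm (H j u))\<^sup>2 + M\<^sup>2" for u
      using sum_squares_bound[of M "norm (H j u)"] by (simp add: add.commute)
  qed (use i1 i2 in auto)
  also have "\<dots> = b + M\<^sup>2 * ?w" using i2 by (simp add: b_def)
  finally have "M * a \<le> M * (M * ?w)" using b by (simp add: power2_eq_square algebra_simps)
  then have a: "a \<le> M * ?w" using M(2) by simp
  have "funk_hecke_coeff DIM('a) j j \<ge> 0" using funk_hecke_coeff_pos[of "DIM('a)" j] by simp
  then have "funk_hecke_coeff DIM('a) j j * norm (H j \<theta>) = norm (CLINT u|sphere_measure. H j u * complex_of_real ((\<theta> \<bullet> u) ^ j))"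
    by (simp add: spherical_harmonics_inner_power[OF dim \<theta> h] norm_mult del: of_real_power)
  also have "\<dots> \<le> (LINT u|sphere_measure. norm (H j u * complex_of_real ((\<theta> \<bullet> u) ^ j)))" by (rule integral_norm_bound)
  also have "\<dots> \<le> a" unfolding a_def
  proof (rule integral_mono_AE)
    have le: "norm (H j u * complex_of_real ((\<theta> \<bullet> u) ^ j)) \<le> norm (H j u)" if "norm u = 1" for u
    proof -
      have "\<bar>\<theta> \<bullet> u\<bar> ^ j \<le> 1" using sphere_inner_le_1[OF \<theta> that] by (intro power_le_one) auto
      then show ?thesis by (simp add: norm_mult norm_power mult_left_le)
    qed
    then show "AE u in sphere_measure. norm (H j u * complex_of_real ((\<theta> \<bullet> u) ^ j)) \<le> norm (H j u)"
      using AE_sphere_measure by auto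
    show "integrable sphere_measure (\<lambda>u. norm (H j u * complex_of_real ((\<theta> \<bullet> u) ^ j)))"
      using le B by (intro integrable_sphere_bounded[of _ B]) (auto intro: order_trans)
  qed (rule i1)
  finally show ?thesis using a by simp
qed


section \<open>Polynomial spectral measures\<close>

definition charm_sum :: "nat \<Rightarrow> ('a::euclidean_space \<Rightarrow> complex) \<Rightarrow> bool" where
  "charm_sum n F \<longleftrightarrow> harm_sum n (\<lambda>u. Re (F u)) \<and> harm_sum n (\<lambda>u. Im (F u))"

lemma charm_sum_power: "charm_sum n F \<Longrightarrow> charm_sum (k * n) (\<lambda>u. F u ^ k)"
proof (induction k)
  case 0
  have "homog_harmonic 0 (\<lambda>x::'a. 1)" by (simp add: homog_harmonic_iff hpoly.const laplacian_def)
  then show ?case using homog_harmonic_zero[of 0]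
    by (auto simp: charm_sum_def intro: harm_sum_harmonic)
next
  case (Suc k)
  then have F: "harm_sum n (\<lambda>u. Re (F u))" "harm_sum n (\<lambda>u. Im (F u))"
    and K: "harm_sum (k * n) (\<lambda>u. Re (F u ^ k))" "harm_sum (k * n) (\<lambda>u. Im (F u ^ k))"
    by (auto simp: charm_sum_def)
  show ?case unfolding charm_sum_def
    by (auto intro!: harm_sum_diff harm_sum_add harm_sum_mult F K)
qed

lemma charm_sum_expansion:
  fixes F :: "'a::euclidean_space \<Rightarrow> complex"
  assumes "DIM('a) \<ge> 2" "F \<in> borel_measurable borel" "charm_sum n F"
  shows "\<exists>H. harmonic_expansion F n H"
proof -
  obtain Y where Y: "\<forall>j\<le>n. homog_harmonic j (Y j)" "\<forall>u\<in>sphere 0 1. Re (F u) = (\<Sum>j\<le>n. Y j u)"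
    using assms(3) unfolding charm_sum_def harm_sum_def by blast
  obtain Z where Z: "\<forall>j\<le>n. homog_harmonic j (Z j)" "\<forall>u\<in>sphere 0 1. Im (F u) = (\<Sum>j\<le>n. Z j u)"
    using assms(3) unfolding charm_sum_def harm_sum_def by blast
  have "harmonic_expansion F n (\<lambda>j. sph_complex (Y j) (Z j))"
  proof
    show "sph_complex (Y j) (Z j) \<in> spherical_harmonics j" if "j \<le> n" for j
      using Y(1) Z(1) that unfolding spherical_harmonics_iff by blast
    show "F u = (\<Sum>j\<le>n. sph_complex (Y j) (Z j) u)" if "norm u = 1" for u
      using Y(2) Z(2) that by (simp add: complex_eq_iff sph_complex_def)
  qed (use assms in auto)
  then show ?thesis by blast
qed

text \<open>No measurability is assumed: the spectral density is arbitrary off the sphere.\<close>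

lemma density_sphere_measure_cong:
  assumes "\<And>u. norm u = 1 \<Longrightarrow> f u = g u"
  shows "density sphere_measure f = density sphere_measure g"
proof -
  have "(\<integral>\<^sup>+u. f u * indicator A u \<partial>sphere_measure) = (\<integral>\<^sup>+u. g u * indicator A u \<partial>sphere_measure)" for A
    using AE_sphere_measure by (intro nn_integral_cong_AE) (auto simp: assms)
  then show ?thesis unfolding density_def by simp
qed

lemma continuous_on_abs_powr:
  assumes "\<alpha> > 0" shows "continuous_on A (\<lambda>t::real. \<bar>t\<bar> powr \<alpha>)"
  using assms by (intro continuous_on_powr' continuous_intros) auto

text \<open>The jump of the sign is killed by the power, which vanishes at 0. Writing the function
  as a difference of powers of the positive and negative parts removes the sign altogether.\<close>

lemma continuous_on_abs_powr_sgn: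
  assumes "\<alpha> > 0" shows "continuous_on A (\<lambda>t::real. \<bar>t\<bar> powr \<alpha> * sgn t)"
proof -
  have "(\<lambda>t::real. \<bar>t\<bar> powr \<alpha> * sgn t) = (\<lambda>t. max t 0 powr \<alpha> - max (-t) 0 powr \<alpha>)"
    by (auto simp: fun_eq_iff sgn_if max_def)
  then show ?thesis using assms by (simp only:) (intro continuous_on_powr' continuous_intros; auto)
qed

locale polynomial_spectral =
  fixes \<alpha> :: real and q :: nat and P :: "'a::euclidean_space \<Rightarrow> real"
  assumes dim: "DIM('a) \<ge> 2" and alpha: "0 < \<alpha>" "\<alpha> < 1"
    and Ppoly: "sphere_poly q P" and Pnz: "\<exists>u\<in>sphere 0 1. P u \<noteq> 0"
    and Pnonneg: "\<forall>u\<in>sphere 0 1. 0 \<le> P u"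
begin

definition lam :: "'a measure" where "lam = density sphere_measure (\<lambda>v. ennreal (P v))"

definition V :: "'a \<Rightarrow> complex" where "V = stable_V \<alpha> lam"

lemma continuous_kernel:
  "continuous_on UNIV (\<lambda>v. \<bar>u \<bullet> v\<bar> powr \<alpha>)" "continuous_on UNIV (\<lambda>v. \<bar>u \<bullet> v\<bar> powr \<alpha> * sgn (u \<bullet> v))" for u :: 'a
  by (rule continuous_on_compose2[OF continuous_on_abs_powr[OF alpha(1), of UNIV], of UNIV "\<lambda>v. u \<bullet> v"]
           continuous_on_compose2[OF continuous_on_abs_powr_sgn[OF alpha(1), of UNIV], of UNIV "\<lambda>v. u \<bullet> v"];
      auto intro!: continuous_intros)+

text \<open>Brings the real and imaginary parts of \<open>V\<close> into the form of
  \<open>harm_sum_convolution\<close>: a polynomial integrated against a continuous function of the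
  inner product.\<close>

lemma V_parts:
  obtains p where "continuous_on UNIV p" "harm_sum q p" "\<And>u. norm u = 1 \<Longrightarrow> P u = p u"
    "\<And>u. V u = complex_of_real (LINT v|sphere_measure. p v * \<bar>u \<bullet> v\<bar> powr \<alpha>) +
      \<i> * complex_of_real (LINT v|sphere_measure. p v * (- tan (pi * \<alpha> / 2) * (\<bar>u \<bullet> v\<bar> powr \<alpha> * sgn (u \<bullet> v))))"
proof -
  obtain p where p: "continuous_on UNIV p" "harm_sum q p" "\<And>u. norm u = 1 \<Longrightarrow> P u = p u"
    using sphere_poly_decompose[OF Ppoly] by blast
  have [measurable]: "p \<in> borel_measurable borel" by (rule borel_measurable_continuous_onI[OF p(1)])
  have lam: "lam = density sphere_measure (\<lambda>v. ennreal (p v))"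
    unfolding lam_def by (rule density_sphere_measure_cong) (simp add: p(3))
  have nn: "AE v in sphere_measure. 0 \<le> p v"
    using AE_sphere_measure by eventually_elim (use p(3) Pnonneg in auto)
  have "V u = complex_of_real (LINT v|sphere_measure. p v * \<bar>u \<bullet> v\<bar> powr \<alpha>) +
      \<i> * complex_of_real (LINT v|sphere_measure. p v * (- tan (pi * \<alpha> / 2) * (\<bar>u \<bullet> v\<bar> powr \<alpha> * sgn (u \<bullet> v))))" for u
  proof -
    have "V u = (CLINT v|sphere_measure. p v *\<^sub>R (complex_of_real (\<bar>u \<bullet> v\<bar> powr \<alpha>) *
      (1 - \<i> * complex_of_real (tan (pi * \<alpha> / 2) * sgn (u \<bullet> v)))))"
      unfolding V_def stable_V_def lam by (rule integral_density) (use nn in auto)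
    also have "\<dots> = (CLINT v|sphere_measure. complex_of_real (p v * \<bar>u \<bullet> v\<bar> powr \<alpha>) +
      \<i> * complex_of_real (p v * (- tan (pi * \<alpha> / 2) * (\<bar>u \<bullet> v\<bar> powr \<alpha> * sgn (u \<bullet> v)))))"
      by (intro Bochner_Integration.integral_cong refl) (simp add: scaleR_conv_of_real algebra_simps)
    also have "\<dots> = complex_of_real (LINT v|sphere_measure. p v * \<bar>u \<bullet> v\<bar> powr \<alpha>) +
      \<i> * complex_of_real (LINT v|sphere_measure. p v * (- tan (pi * \<alpha> / 2) * (\<bar>u \<bullet> v\<bar> powr \<alpha> * sgn (u \<bullet> v))))"
      by (intro integral_Re_Im_split integrable_sphere_continuous continuous_on_mult continuous_on_const p(1) continuous_kernel)
    finally show ?thesis .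
  qed
  then show ?thesis using that[OF p] by blast
qed

lemma V_measurable [measurable]: "V \<in> borel_measurable borel"
proof -
  obtain p where p: "continuous_on UNIV p" "harm_sum q p" "\<And>u. norm u = 1 \<Longrightarrow> P u = p u"
    "\<And>u. V u = complex_of_real (LINT v|sphere_measure. p v * \<bar>u \<bullet> v\<bar> powr \<alpha>) +
      \<i> * complex_of_real (LINT v|sphere_measure. p v * (- tan (pi * \<alpha> / 2) * (\<bar>u \<bullet> v\<bar> powr \<alpha> * sgn (u \<bullet> v))))"
    using V_parts by blast
  have [measurable]: "p \<in> borel_measurable borel" by (rule borel_measurable_continuous_onI[OF p(1)])
  show ?thesis unfolding p(4)[abs_def] by measurable
qed

lemma V_charm: "charm_sum q V"
proof -
  obtain p where p: "continuous_on UNIV p" "harm_sum q p" "\<And>u. norm u = 1 \<Longrightarrow> P u = p u"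
    "\<And>u. V u = complex_of_real (LINT v|sphere_measure. p v * \<bar>u \<bullet> v\<bar> powr \<alpha>) +
      \<i> * complex_of_real (LINT v|sphere_measure. p v * (- tan (pi * \<alpha> / 2) * (\<bar>u \<bullet> v\<bar> powr \<alpha> * sgn (u \<bullet> v))))"
    using V_parts by blast
  have m: "p \<in> borel_measurable borel" by (rule borel_measurable_continuous_onI[OF p(1)])
  have c: "continuous_on UNIV (\<lambda>t. - tan (pi * \<alpha> / 2) * (\<bar>t\<bar> powr \<alpha> * sgn t))"
    by (intro continuous_on_mult_left continuous_on_abs_powr_sgn alpha)
  show ?thesis
    using harm_sum_convolution[OF dim p(2) m continuous_on_abs_powr[OF alpha(1)]] harm_sum_convolution[OF dim p(2) m c]
    by (simp add: charm_sum_def p(4))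
qed

lemma V_power_expansion: "\<exists>H. harmonic_expansion (\<lambda>u. V u ^ k) (k * q) H"
  by (intro charm_sum_expansion dim charm_sum_power V_charm) measurable

lemma V_bound: obtains M where "M > 0" "\<And>u. norm u = 1 \<Longrightarrow> norm (V u) \<le> M"
proof -
  obtain H where "harmonic_expansion V q H" using V_power_expansion[of 1] by auto
  then obtain M where M: "\<And>u. norm u = 1 \<Longrightarrow> norm (V u) \<le> M"
    using harmonic_expansion.F_bounded[of V q H] by metis
  show ?thesis
    by (rule that[of "max 1 M"]) (use M in \<open>auto simp: le_max_iff_disj\<close>)
qed

text \<open>If the real part of \<open>V\<close> vanished at some \<open>u\<close>, the integrand
  would vanish almost everywhere; as \<open>u \<bullet> v\<close> is almost never zero,
  \<open>p\<close> and hence \<open>P\<close> would vanish on the sphere. Compactness makes the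
  positivity uniform, which yields the decay of the characteristic function.\<close>

lemma V_lower: obtains c where "c > 0" "\<And>u. norm u = 1 \<Longrightarrow> c \<le> Re (V u)"
proof -
  obtain p where p: "continuous_on UNIV p" "harm_sum q p" "\<And>u. norm u = 1 \<Longrightarrow> P u = p u"
    "\<And>u. V u = complex_of_real (LINT v|sphere_measure. p v * \<bar>u \<bullet> v\<bar> powr \<alpha>) +
      \<i> * complex_of_real (LINT v|sphere_measure. p v * (- tan (pi * \<alpha> / 2) * (\<bar>u \<bullet> v\<bar> powr \<alpha> * sgn (u \<bullet> v))))"
    using V_parts by blast
  have int: "integrable sphere_measure (\<lambda>v. p v * \<bar>u \<bullet> v\<bar> powr \<alpha>)" for u
    by (intro integrable_sphere_continuous continuous_on_mult p(1) continuous_kernel)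
  have nn: "AE v in sphere_measure. 0 \<le> p v * \<bar>u \<bullet> v\<bar> powr \<alpha>" for u
    using AE_sphere_measure by eventually_elim (use p(3) Pnonneg in auto)
  have pos: "Re (V u) > 0" if u: "norm u = 1" for u
  proof (rule ccontr)
    assume "\<not> Re (V u) > 0"
    moreover have "(LINT v|sphere_measure. p v * \<bar>u \<bullet> v\<bar> powr \<alpha>) \<ge> 0" by (rule integral_nonneg_AE[OF nn])
    ultimately have "(LINT v|sphere_measure. p v * \<bar>u \<bullet> v\<bar> powr \<alpha>) = 0" by (simp add: p(4))
    then have "AE v in sphere_measure. p v * \<bar>u \<bullet> v\<bar> powr \<alpha> = 0"
      using integral_nonneg_eq_0_iff_AE[OF int nn] by simp
    moreover have "AE v in sphere_measure. u \<bullet> v \<noteq> 0" using u by (intro AE_sphere_measure_inner) auto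
    ultimately have "AE v in sphere_measure. p v = 0" by eventually_elim auto
    then have "p v = 0" if "norm v = 1" for v
      using sphere_measure_continuous_zero[OF continuous_on_subset[OF p(1)]] that by blast
    then show False using Pnz p(3) by auto
  qed
  \<comment> \<open>Continuity of the real part of \<open>V\<close> on the sphere is read off its
    expansion into harmonics, each of which is a polynomial.\<close>
  obtain Y where Y: "\<forall>j\<le>q. homog_harmonic j (Y j)" "\<forall>u\<in>sphere 0 1. Re (V u) = (\<Sum>j\<le>q. Y j u)"
    using V_charm unfolding charm_sum_def harm_sum_def by blast
  have "continuous_on (sphere 0 1) (\<lambda>u. \<Sum>j\<le>q. Y j u)"
    using Y(1) by (intro continuous_on_sum homog_harmonic_continuous) auto
  then have cont: "continuous_on (sphere 0 1) (\<lambda>u. Re (V u))"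
    by (rule iffD2[OF continuous_on_cong[OF refl], rotated]) (use Y(2) in auto)
  have ne: "sphere (0::'a) 1 \<noteq> {}" using Pnz by auto
  obtain u0 where u0: "u0 \<in> sphere 0 1" "\<And>u. u \<in> sphere 0 1 \<Longrightarrow> Re (V u0) \<le> Re (V u)"
    using continuous_attains_inf[OF compact_sphere ne cont] by blast
  show ?thesis by (rule that[of "Re (V u0)"]) (use u0 pos in auto)
qed

end


section \<open>Gamma and Beta integrals\<close>

text \<open>The case \<open>e = 0\<close> is the bare power on the positive half-line, to which a
  complex exponential rate can then be attached.\<close>

definition gamma_kernel :: "real \<Rightarrow> real \<Rightarrow> real \<Rightarrow> real" where
  "gamma_kernel a e r = indicator {0<..} r * (r powr (a - 1) * exp (- (e * r)))"

lemma gamma_kernel_measurable [measurable]: "gamma_kernel a e \<in> borel_measurable borel"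
  unfolding gamma_kernel_def[abs_def] by measurable

lemma integrable_gamma_kernel:
  assumes "a > 0" "e > 0" shows "integrable lborel (gamma_kernel a e)"
proof -
  have "integrable lebesgue (\<lambda>t. indicator {0<..} t *\<^sub>R (complex_of_real t powr (of_real a - 1) / of_real (exp (e * t))))"
    using absolutely_integrable_Gamma_integral[of "of_real a" e] assms by (simp add: set_integrable_def)
  then have "integrable lebesgue (\<lambda>t. norm (indicator {0<..} t *\<^sub>R (complex_of_real t powr (of_real a - 1) / of_real (exp (e * t)))))"
    by (rule integrable_norm)
  also have "(\<lambda>t. norm (indicator {0<..} t *\<^sub>R (complex_of_real t powr (of_real a - 1) / of_real (exp (e * t))))) = gamma_kernel a e"
  proof
    fix t :: real
    show "norm (indicator {0<..} t *\<^sub>R (complex_of_real t powr (of_real a - 1) / of_real (exp (e * t)))) = gamma_kernel a e t"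
    proof (cases "t > 0")
      case True
      have "complex_of_real t powr (of_real a - 1) = of_real (t powr (a - 1))"
        using True powr_of_real[of t "a - 1"] by simp
      then show ?thesis using True
        by (simp add: gamma_kernel_def norm_divide exp_minus field_simps del: of_real_exp)
    qed (simp add: gamma_kernel_def)
  qed
  finally show ?thesis by (subst (asm) integrable_completion) auto
qed

lemma integral_gamma_kernel:
  assumes a: "a > 0" and e: "e > 0" shows "(LINT r|lborel. gamma_kernel a e r) = Gamma a * e powr (- a)"
proof -
  have "(\<integral>\<^sup>+t. ennreal (gamma_kernel a 1 t) \<partial>lborel) = (\<integral>\<^sup>+t. ennreal (indicator {0..} t * t powr (a - 1) / exp t) \<partial>lborel)"
    by (intro nn_integral_cong) (auto simp: gamma_kernel_def indicator_def exp_minus field_simps)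
  also have "\<dots> = ennreal (Gamma a)" by (rule Gamma_conv_nn_integral_real[OF a, symmetric])
  finally have "(LINT r|lborel. gamma_kernel a 1 r) = Gamma a"
    using a by (subst integral_eq_nn_integral) (auto simp: gamma_kernel_def Gamma_real_pos less_imp_le)
  moreover have "(LINT r|lborel. gamma_kernel a 1 r) = \<bar>e\<bar> *\<^sub>R (LINT r|lborel. gamma_kernel a 1 (0 + e * r))"
    using e by (intro lborel_integral_real_affine) auto
  moreover have "gamma_kernel a 1 (0 + e * r) = e powr (a - 1) * gamma_kernel a e r" for r
    using e by (auto simp: gamma_kernel_def indicator_def powr_mult zero_less_mult_iff)
  ultimately have "Gamma a = e * (e powr (a - 1) * (LINT r|lborel. gamma_kernel a e r))" using e by simp
  moreover have "e * e powr (a - 1) = e powr a" using e by (simp add: powr_diff)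
  ultimately show ?thesis using e by (simp add: powr_minus field_simps)
qed

text \<open>Both sides are holomorphic in the right half-plane and agree on the positive reals.
  Holomorphy of the integral is differentiation under the integral sign, justified by dominated
  convergence of the difference quotients.\<close>

lemma gamma_integral_complex:
  assumes a: "a > 0" and w: "Re w > 0"
  shows "(CLINT r|lborel. complex_of_real (gamma_kernel a 0 r) * exp (- (w * complex_of_real r))) =
    complex_of_real (Gamma a) * w powr (- complex_of_real a)"
proof -
  let ?g = "\<lambda>r. complex_of_real (gamma_kernel a 0 r)"
  define f where "f w = (CLINT r|lborel. ?g r * exp (- (w * complex_of_real r)))" for w
  let ?S = "{w. Re w > 0}"
  have int: "integrable lborel (\<lambda>r. ?g r * exp (- (w * complex_of_real r)))" if "Re w > 0" for w
  proof (rule Bochner_Integration.integrable_bound[OF integrable_gamma_kernel[OF a that]])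
    show "AE r in lborel. norm (?g r * exp (- (w * complex_of_real r))) \<le> norm (gamma_kernel a (Re w) r)"
      by (intro AE_I2) (auto simp: gamma_kernel_def norm_mult indicator_def abs_mult)
  qed measurable
  have der: "(f has_field_derivative (CLINT r|lborel. ?g r * (- complex_of_real r * exp (- (w * complex_of_real r))))) (at w)"
    if w: "Re w > 0" for w
  proof -
    \<comment> \<open>On the convex half-plane of real part above \<open>m\<close> the derivative of
      the exponential is at most r e^(- m r). The mean value inequality bounds the quotients by the
      same function, which gives the majorant \<open>gamma_kernel (a + 1) m\<close>.\<close>
    define m where "m = Re w / 2"
    let ?T = "{y. Re y > m}"
    have m: "m > 0" "w \<in> ?T" using w by (auto simp: m_def)
    have T: "open ?T" "convex ?T" by (auto simp: open_halfspace_Re_gt convex_halfspace_Re_gt)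
    have "((\<lambda>y. (f y - f w) / (y - w)) \<longlongrightarrow> (CLINT r|lborel. ?g r * (- complex_of_real r * exp (- (w * complex_of_real r))))) (at w within ?T)"
      unfolding tendsto_at_iff_sequentially o_def
    proof (intro allI impI)
      fix X assume X: "\<forall>i. X i \<in> ?T - {w}" "X \<longlonglongrightarrow> w"
      let ?q = "\<lambda>i r. ?g r * ((exp (- (X i * complex_of_real r)) - exp (- (w * complex_of_real r))) / (X i - w))"
      have q: "(f (X i) - f w) / (X i - w) = (CLINT r|lborel. ?q i r)" for i
      proof -
        have "Re (X i) > 0" using X(1)[rule_format, of i] m by auto
        then have "f (X i) - f w = (CLINT r|lborel. ?g r * exp (- (X i * complex_of_real r)) - ?g r * exp (- (w * complex_of_real r)))"
          unfolding f_def using int w by (subst Bochner_Integration.integral_diff) auto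
        then show ?thesis by (simp add: right_diff_distrib diff_divide_distrib flip: integral_divide_zero)
      qed
      have dr: "((\<lambda>y. exp (- (y * complex_of_real r))) has_field_derivative - complex_of_real r * exp (- (y * complex_of_real r))) (at y within A)" for r y A
        by (auto intro!: derivative_eq_intros)
      have "(\<lambda>i. CLINT r|lborel. ?q i r) \<longlonglongrightarrow> (CLINT r|lborel. ?g r * (- complex_of_real r * exp (- (w * complex_of_real r))))"
      proof (rule integral_dominated_convergence[where w="gamma_kernel (a + 1) m"])
        show "integrable lborel (gamma_kernel (a + 1) m)" using a m by (intro integrable_gamma_kernel) auto
        show "AE r in lborel. (\<lambda>i. ?q i r) \<longlonglongrightarrow> ?g r * (- complex_of_real r * exp (- (w * complex_of_real r)))"
        proof (intro AE_I2 tendsto_mult tendsto_const)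
          fix r
          have "((\<lambda>y. (exp (- (y * complex_of_real r)) - exp (- (w * complex_of_real r))) / (y - w)) \<longlongrightarrow> - complex_of_real r * exp (- (w * complex_of_real r))) (at w within ?T)"
            using dr[of r w ?T] by (simp add: has_field_derivative_iff)
          then show "(\<lambda>i. (exp (- (X i * complex_of_real r)) - exp (- (w * complex_of_real r))) / (X i - w)) \<longlonglongrightarrow> - complex_of_real r * exp (- (w * complex_of_real r))"
            using X unfolding tendsto_at_iff_sequentially o_def by blast
        qed
        show "AE r in lborel. norm (?q i r) \<le> gamma_kernel (a + 1) m r" for i
        proof (intro AE_I2)
          fix r :: real
          show "norm (?q i r) \<le> gamma_kernel (a + 1) m r"
          proof (cases "r > 0")
            case True
            have "norm (exp (- (X i * complex_of_real r)) - exp (- (w * complex_of_real r))) \<le> (r * exp (- (m * r))) * norm (X i - w)"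
            proof (rule field_differentiable_bound[OF T(2) dr])
              show "norm (- complex_of_real r * exp (- (y * complex_of_real r))) \<le> r * exp (- (m * r))" if "y \<in> ?T" for y
                using that True by (simp add: norm_mult)
            qed (use X(1) m in auto)
            moreover have "norm (X i - w) > 0" using X(1)[rule_format, of i] by simp
            ultimately have "norm ((exp (- (X i * complex_of_real r)) - exp (- (w * complex_of_real r))) / (X i - w)) \<le> r * exp (- (m * r))"
              by (simp add: norm_divide divide_le_eq)
            then have "norm (?q i r) \<le> r powr (a - 1) * (r * exp (- (m * r)))"
              unfolding norm_mult using True by (intro mult_mono) (auto simp: gamma_kernel_def)
            also have "\<dots> = gamma_kernel (a + 1) m r" using True by (simp add: gamma_kernel_def powr_diff)
            finally show ?thesis .
          qed (simp add: gamma_kernel_def)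
        qed
      qed measurable
      then show "(\<lambda>i. (f (X i) - f w) / (X i - w)) \<longlonglongrightarrow> (CLINT r|lborel. ?g r * (- complex_of_real r * exp (- (w * complex_of_real r))))"
        by (simp only: q)
    qed
    then show ?thesis unfolding has_field_derivative_iff using at_within_open[OF m(2) T(1)] by simp
  qed
  have hol: "(\<lambda>w. f w - complex_of_real (Gamma a) * w powr (- complex_of_real a)) holomorphic_on ?S"
  proof (intro holomorphic_intros)
    show "f holomorphic_on ?S" unfolding holomorphic_on_def field_differentiable_def
      using der by (auto intro: has_field_derivative_at_within)
  qed (auto simp: complex_nonpos_Reals_iff)
  have real: "f (complex_of_real x) - complex_of_real (Gamma a) * complex_of_real x powr (- complex_of_real a) = 0" if "x > 0" for x
  proof -
    have "f (complex_of_real x) = (CLINT r|lborel. complex_of_real (gamma_kernel a x r))"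
      unfolding f_def by (intro Bochner_Integration.integral_cong refl)
        (auto simp: gamma_kernel_def exp_of_real[symmetric] simp del: exp_of_real)
    also have "\<dots> = complex_of_real (Gamma a * x powr (- a))"
      by (simp add: integral_complex_of_real integral_gamma_kernel[OF a that])
    finally show ?thesis using that powr_of_real[of x "- a"] by simp
  qed
  have "f w - complex_of_real (Gamma a) * w powr (- complex_of_real a) = 0"
  proof (rule analytic_continuation[OF hol, of "complex_of_real ` {0<..}" 1])
    show "open ?S" "connected ?S" by (auto simp: open_halfspace_Re_gt convex_halfspace_Re_gt intro: convex_connected)
    show "complex_of_real ` {0<..} \<subseteq> ?S" by auto
    have "(\<lambda>n. complex_of_real (1 + 1 / real (Suc n))) \<longlonglongrightarrow> complex_of_real (1 + 0)"
      by (intro tendsto_intros LIMSEQ_Suc lim_1_over_n)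
    moreover have "complex_of_real (1 + 1 / real (Suc n)) \<in> complex_of_real ` {0<..} - {1}" for n
    proof (intro DiffI imageI)
      show "1 + 1 / real (Suc n) \<in> {0<..}" by (simp add: add_pos_pos)
      have "1 + 1 / real (Suc n) \<noteq> 1" by simp
      then show "complex_of_real (1 + 1 / real (Suc n)) \<notin> {1}" by (metis of_real_eq_1_iff singletonD)
    qed
    ultimately show "1 islimpt complex_of_real ` {0<..}" unfolding islimpt_sequential
      by (intro exI[of _ "\<lambda>n. complex_of_real (1 + 1 / real (Suc n))"]) simp
    show "\<And>z. z \<in> complex_of_real ` {0<..} \<Longrightarrow> f z - complex_of_real (Gamma a) * z powr (- complex_of_real a) = 0"
      using real by auto
  qed (use w in auto)
  then show ?thesis by (simp add: f_def)
qed

text \<open>Substitute sin^2 t in Euler's Beta integral. Its integrand may be singular at the ends,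
  where \<open>powr\<close> takes its default value 0, so the two forms are compared in the open
  interval only.\<close>

lemma trig_beta:
  fixes c :: real and n :: nat
  assumes c: "c \<ge> 0"
  shows "((\<lambda>t. sin t powr c * cos t ^ n) has_integral Beta ((c + 1) / 2) ((real n + 1) / 2) / 2) {0..pi/2}"
proof -
  let ?x = "(c + 1) / 2" and ?y = "(real n + 1) / 2"
  define f where "f t = t powr (?x - 1) * (1 - t) powr (?y - 1)" for t :: real
  have xy: "?x > 0" "?y > 0" using c by auto
  have i: "set_integrable lborel {(sin 0)\<^sup>2..(sin (pi/2))\<^sup>2} f"
    unfolding f_def using integrable_Beta[OF xy] by simp
  have d: "((\<lambda>t. (sin t)\<^sup>2) has_real_derivative 2 * sin t * cos t) (at t)" for t :: real
    by (auto intro!: derivative_eq_intros)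
  have nn: "0 \<le> 2 * sin t * cos t" if "t \<in> {0..pi/2}" for t :: real
    using that sin_ge_zero[of t] cos_ge_zero[of t] by simp
  note S = integral_substitution[OF i d _ nn]
  have S1: "set_integrable lborel {0..pi/2} (\<lambda>t. f ((sin t)\<^sup>2) * (2 * sin t * cos t))"
    by (rule S(1)) (auto intro!: continuous_intros)
  have S2: "(LBINT t. f t * indicator {(sin 0)\<^sup>2..(sin (pi/2))\<^sup>2} t) = (LBINT t. f ((sin t)\<^sup>2) * (2 * sin t * cos t) * indicator {0..pi/2} t)"
    by (rule S(2)) (auto intro!: continuous_intros)
  have "(LBINT t. f ((sin t)\<^sup>2) * (2 * sin t * cos t) * indicator {0..pi/2} t) = (LBINT t:{0..1}. f t)"
    using S2 by (simp add: set_lebesgue_integral_def mult.commute)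
  also have "\<dots> = Beta ?x ?y"
    using has_integral_Beta_real[OF xy] integrable_Beta[OF xy] unfolding f_def
    by (subst set_borel_integral_eq_integral) (auto intro: integral_unique)
  finally have B: "(LBINT t:{0..pi/2}. f ((sin t)\<^sup>2) * (2 * sin t * cos t)) = Beta ?x ?y"
    by (simp add: set_lebesgue_integral_def mult.commute)
  then have H: "((\<lambda>t. f ((sin t)\<^sup>2) * (2 * sin t * cos t)) has_integral Beta ?x ?y) {0..pi/2}"
    using set_borel_integral_eq_integral[OF S1] by (simp add: has_integral_iff)
  have "((\<lambda>t. 2 * (sin t powr c * cos t ^ n)) has_integral Beta ?x ?y) {0..pi/2}"
  proof (rule has_integral_spike_finite[OF _ _ H])
    show "finite {0, pi/2}" by simp
    fix t assume t: "t \<in> {0..pi/2} - {0, pi/2}"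
    then have s: "sin t > 0" "cos t > 0" by (auto intro: sin_gt_zero cos_gt_zero)
    have "1 - (sin t)\<^sup>2 = (cos t)\<^sup>2" by (simp add: cos_squared_eq)
    moreover have sq: "(x\<^sup>2) powr ((z + 1) / 2 - 1) = x powr (z - 1)" if "x > 0" for x z :: real
    proof -
      have "(x\<^sup>2) powr ((z + 1) / 2 - 1) = (x powr 2) powr ((z + 1) / 2 - 1)" using that by simp
      also have "\<dots> = x powr (2 * ((z + 1) / 2 - 1))" by (rule powr_powr)
      also have "2 * ((z + 1) / 2 - 1) = z - 1" by argo
      finally show ?thesis .
    qed
    ultimately have "f ((sin t)\<^sup>2) = sin t powr (c - 1) * cos t powr (real n - 1)"
      unfolding f_def using s by (simp only: sq)
    then show "2 * (sin t powr c * cos t ^ n) = f ((sin t)\<^sup>2) * (2 * sin t * cos t)"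
      using s by (simp add: powr_diff powr_realpow field_simps)
  qed
  from has_integral_mult_right[OF this, of "1/2"] show ?thesis by simp
qed


section \<open>Contour deformation\<close>

text \<open>What is left after the radius has been integrated out: up to a constant, the power is
  the Laplace transform of r^(a - 1) at the rate e + i sin t, with \<open>e\<close> standing for
  \<epsilon> / |x|, and the cosine is the weight of the arc.\<close>

definition sin_kernel :: "real \<Rightarrow> real \<Rightarrow> nat \<Rightarrow> complex \<Rightarrow> complex" where
  "sin_kernel e a n z = (complex_of_real e + \<i> * sin z) powr (- complex_of_real a) * cos z ^ n"

abbreviation "zA \<equiv> complex_of_real (- pi / 2)"
abbreviation "zB \<equiv> Complex (- pi / 2) (- 1)"
abbreviation "zC \<equiv> Complex (pi / 2) (- 1)"
abbreviation "zD \<equiv> complex_of_real (pi / 2)"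

text \<open>The path runs from \<open>-\<pi>/2\<close> to \<open>\<pi>/2\<close> along three sides of a rectangle in the lower half
  plane, where \<open>i sin z\<close> has nonnegative real part and modulus at least \<open>1\<close>.\<close>

definition detour :: "(complex \<Rightarrow> complex) \<Rightarrow> complex" where
  "detour f = contour_integral (linepath zA zB) f + contour_integral (linepath zB zC) f + contour_integral (linepath zC zD) f"

definition detour_points :: "complex set" where
  "detour_points = closed_segment zA zB \<union> closed_segment zB zC \<union> closed_segment zC zD"

text \<open>The real part equals - cos(Re z) sinh(Im z). Below the segment it is nonnegative, so the
  base of the power stays in the closed right half-plane, away from the cut of the principal branch;
  this is why the path goes down and not up.\<close>

lemma Re_i_sin_nonneg:
  assumes "\<bar>Re z\<bar> \<le> pi / 2" "Im z \<le> 0" shows "Re (\<i> * sin z) \<ge> 0"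
proof -
  have "cos (Re z) \<ge> 0" using assms by (intro cos_ge_zero) auto
  moreover have "exp (Im z) - exp (- Im z) \<le> 0" using assms by simp
  ultimately have "cos (Re z) * (exp (Im z) - exp (- Im z)) \<le> 0" by (rule mult_nonneg_nonpos)
  then show ?thesis by (simp add: Im_sin)
qed

lemma detour_pointsD:
  assumes "z \<in> detour_points"
  shows "\<bar>Re z\<bar> \<le> pi / 2" "- 1 \<le> Im z" "Im z \<le> 0" "\<bar>Re z\<bar> = pi / 2 \<or> Im z = - 1"
  using assms pi_gt_zero unfolding detour_points_def
  by (auto simp: closed_segment_same_Re closed_segment_same_Im closed_segment_eq_real_ivl abs_if split: if_splits)
    (use pi_gt_zero in linarith)+

lemma exp_1_ge: "exp (1::real) \<ge> 5 / 2"
  using exp_lower_Taylor_quadratic[of "1::real"] by simp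

text \<open>On the vertical sides |sin z|^2 = cosh^2(Im z). On the bottom side it is at least (e^2 -
  2) / 4, and e >= 5 / 2 already makes this exceed 1, so depth 1 is enough for the
  rectangle.\<close>

lemma detour_sin_ge:
  assumes "z \<in> detour_points" shows "norm (sin z) \<ge> 1"
proof -
  let ?E = "exp (2 * Im z)"
  have E: "?E > 0" by simp
  have "(norm (sin z))\<^sup>2 \<ge> 1"
  proof (cases "\<bar>Re z\<bar> = pi / 2")
    case True
    then have "2 * Re z = pi \<or> 2 * Re z = - pi" by (auto simp: abs_if split: if_splits)
    then have "cos (2 * Re z) = - 1" by (metis cos_minus cos_pi)
    moreover have "?E + inverse ?E \<ge> 2"
    proof -
      have "?E + inverse ?E - 2 = (?E - 1)\<^sup>2 / ?E" using E by (simp add: field_simps power2_eq_square)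
      then show ?thesis using E by (smt (verit) divide_nonneg_pos zero_le_power2)
    qed
    ultimately show ?thesis by (simp add: norm_sin_squared)
  next
    case False
    then have y: "Im z = - 1" using detour_pointsD(4)[OF assms] by simp
    have "(5 / 2) * (5 / 2) \<le> exp (1::real) * exp 1" using exp_1_ge by (intro mult_mono) auto
    then have "25 / 4 \<le> exp (2::real)" by (simp flip: exp_add)
    moreover have inv: "inverse (exp (2 * Im z)) = exp 2" by (simp add: y exp_minus[symmetric])
    moreover have "cos (2 * Re z) \<le> 1" by simp
    ultimately show ?thesis using E unfolding norm_sin_squared inv by (simp only: field_simps)
  qed
  then have "1\<^sup>2 \<le> (norm (sin z))\<^sup>2" by simp
  then show ?thesis by (rule power2_le_imp_le) simp
qed

text \<open>The crude estimate e <= 3 gives |cos z|^2 <= 1 + 9 / 4, which is below 4.\<close>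

lemma detour_cos_le:
  assumes "z \<in> detour_points" shows "norm (cos z) \<le> 2"
proof -
  let ?x = "exp (Im z)"
  have "?x \<le> 1" "?x > 0" using detour_pointsD[OF assms] by auto
  moreover have "inverse ?x \<le> 3"
  proof -
    have "inverse ?x = exp (- Im z)" by (simp add: exp_minus)
    also have "\<dots> \<le> exp 1" using detour_pointsD(2)[OF assms] by simp
    also have "\<dots> \<le> 3" by (rule exp_le)
    finally show ?thesis .
  qed
  moreover have "inverse ?x > 0" by simp
  ultimately have "\<bar>?x - inverse ?x\<bar> \<le> 3" by linarith
  then have "(?x - inverse ?x)\<^sup>2 \<le> 3\<^sup>2" by (metis abs_le_square_iff abs_numeral)
  moreover have "(cos (Re z))\<^sup>2 \<le> 1" by (simp add: abs_square_le_1)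
  ultimately have "(norm (cos z))\<^sup>2 \<le> 2\<^sup>2" unfolding norm_cos_squared by simp
  then show ?thesis by (rule power2_le_imp_le) simp
qed

lemma detour_base:
  assumes "z \<in> detour_points" "e \<ge> 0"
  shows "Re (complex_of_real e + \<i> * sin z) \<ge> 0" "norm (complex_of_real e + \<i> * sin z) \<ge> 1"
proof -
  have r: "Re (\<i> * sin z) \<ge> 0" using detour_pointsD[OF assms(1)] by (intro Re_i_sin_nonneg)
  then show "Re (complex_of_real e + \<i> * sin z) \<ge> 0" using assms(2) by simp
  have "(norm (\<i> * sin z))\<^sup>2 \<le> (norm (complex_of_real e + \<i> * sin z))\<^sup>2"
    unfolding cmod_power2 using power_mono[of "Re (\<i> * sin z)" "Re (complex_of_real e + \<i> * sin z)" 2] r assms(2) by simp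
  then have "norm (\<i> * sin z) \<le> norm (complex_of_real e + \<i> * sin z)" by (rule power2_le_imp_le) simp
  then show "norm (complex_of_real e + \<i> * sin z) \<ge> 1" using detour_sin_ge[OF assms(1)] by (simp add: norm_mult)
qed

text \<open>For a real exponent the modulus of the power depends only on the modulus of the base,
  which is at least 1 along the path. The bound is therefore uniform in both \<open>e\<close> and
  \<open>a\<close>, exactly what the summation over k requires.\<close>

lemma sin_kernel_bound:
  assumes "z \<in> detour_points" "e \<ge> 0" "a \<ge> 0" shows "norm (sin_kernel e a n z) \<le> 2 ^ n"
proof -
  let ?w = "complex_of_real e + \<i> * sin z"
  have "norm (?w powr (- complex_of_real a)) = norm ?w powr (- a)"
    using norm_powr_real_powr'[of "- complex_of_real a" ?w] by simp
  also have "\<dots> \<le> 1 powr (- a)" using detour_base(2)[OF assms(1,2)] assms(3) by (intro powr_mono2') auto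
  finally have "norm (?w powr (- complex_of_real a)) \<le> 1" by simp
  moreover have "norm (cos z) ^ n \<le> 2 ^ n" using detour_cos_le[OF assms(1)] by (intro power_mono) auto
  ultimately show ?thesis unfolding sin_kernel_def norm_mult norm_power
    using mult_mono[of "norm (?w powr (- complex_of_real a))" 1 "norm (cos z) ^ n" "2 ^ n"] by simp
qed

text \<open>Joint continuity in the damping, the exponent and the point serves two limits:
  \<open>e\<close> to 0, and \<open>a\<close> to the exceptional exponent 1.\<close>

lemma continuous_on_sin_kernel_joint:
  fixes g :: "'x::t2_space \<Rightarrow> real \<times> real"
  assumes "S \<subseteq> {x. fst (g x) \<ge> (0::real)}" "h ` S \<subseteq> detour_points" "continuous_on S g" "continuous_on S h"
  shows "continuous_on S (\<lambda>x. sin_kernel (fst (g x)) (snd (g x)) n (h x))"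
  unfolding sin_kernel_def
proof (intro continuous_intros assms)
  show "S \<subseteq> {z. 0 \<le> Re (complex_of_real (fst (g z)) + \<i> * sin (h z)) \<or> Im (complex_of_real (fst (g z)) + \<i> * sin (h z)) \<noteq> 0}"
    using assms detour_base(1) by blast
  fix z assume "z \<in> S" "complex_of_real (fst (g z)) + \<i> * sin (h z) = 0"
  moreover have "norm (complex_of_real (fst (g z)) + \<i> * sin (h z)) \<ge> 1"
    using assms \<open>z \<in> S\<close> by (intro detour_base(2)) auto
  ultimately show "0 < Re (- complex_of_real (snd (g z)))" by simp
qed

lemma segment_in_detour:
  "closed_segment zA zB \<subseteq> detour_points" "closed_segment zB zC \<subseteq> detour_points" "closed_segment zC zD \<subseteq> detour_points"
  by (auto simp: detour_points_def)

lemma continuous_on_sin_kernel: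
  "e \<ge> 0 \<Longrightarrow> A \<subseteq> detour_points \<Longrightarrow> continuous_on A (sin_kernel e a n)"
  using continuous_on_sin_kernel_joint[of A "\<lambda>_. (e, a)" "\<lambda>z. z" n] by (auto intro!: continuous_intros)

text \<open>The factor \<open>pi + 2\<close> is the length of the path.\<close>

lemma detour_bound:
  assumes "e \<ge> 0" "a \<ge> 0" shows "norm (detour (sin_kernel e a n)) \<le> 2 ^ n * (pi + 2)"
proof -
  have *: "norm (contour_integral (linepath p q) (sin_kernel e a n)) \<le> 2 ^ n * norm (q - p)"
    if "closed_segment p q \<subseteq> detour_points" for p q
    using that assms by (intro contour_integral_bound_linepath contour_integrable_continuous_linepath
        continuous_on_sin_kernel sin_kernel_bound) auto
  have n: "norm (zB - zA) = 1" "norm (zC - zB) = pi" "norm (zD - zC) = 1"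
    by (simp_all add: cmod_def)
  have "norm (detour (sin_kernel e a n)) \<le> norm (contour_integral (linepath zA zB) (sin_kernel e a n)) +
    norm (contour_integral (linepath zB zC) (sin_kernel e a n)) + norm (contour_integral (linepath zC zD) (sin_kernel e a n))"
    unfolding detour_def by (meson add_mono norm_triangle_ineq norm_triangle_mono order_refl order_trans)
  also have "\<dots> \<le> 2 ^ n * 1 + 2 ^ n * pi + 2 ^ n * 1"
    using *[OF segment_in_detour(1)] *[OF segment_in_detour(2)] *[OF segment_in_detour(3)] unfolding n by linarith
  finally show ?thesis by (simp add: algebra_simps)
qed

lemma continuous_on_detour:
  "continuous_on ({0..} \<times> UNIV) (\<lambda>p. detour (sin_kernel (fst p) (snd p) n))"
proof -
  have *: "continuous_on ({0..} \<times> UNIV) (\<lambda>p. contour_integral (linepath x y) (sin_kernel (fst p) (snd p) n))"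
    if s: "closed_segment x y \<subseteq> detour_points" for x y
  proof -
    have "continuous_on (({0..} \<times> UNIV) \<times> cbox 0 1) (\<lambda>(p, t). sin_kernel (fst p) (snd p) n (linepath x y t) * (y - x))"
      unfolding split_beta'
    proof (intro continuous_on_mult continuous_on_const continuous_on_sin_kernel_joint)
      show "(\<lambda>p. linepath x y (snd p)) ` (({0..} \<times> UNIV) \<times> cbox 0 1) \<subseteq> detour_points"
        using s linepath_in_path[of _ x y] by fastforce
      show "continuous_on (({0..} \<times> UNIV) \<times> cbox 0 1) (\<lambda>p. linepath x y (snd p))"
        unfolding linepath_def by (intro continuous_intros)
    qed (auto intro!: continuous_intros)
    from integral_continuous_on_param[OF this]
    show ?thesis by (simp add: contour_integral_integral)
  qed
  show ?thesis unfolding detour_def by (intro continuous_on_add * segment_in_detour)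
qed

lemma contour_integral_quadrilateral:
  assumes "f contour_integrable_on linepath a b" "f contour_integrable_on linepath b c"
    "f contour_integrable_on linepath c d" "f contour_integrable_on linepath d a"
  shows "contour_integral (linepath a b +++ linepath b c +++ linepath c d +++ linepath d a) f =
    contour_integral (linepath a b) f + (contour_integral (linepath b c) f + (contour_integral (linepath c d) f + contour_integral (linepath d a) f))"
  using assms by (simp add: contour_integrable_joinI valid_path_join)

lemma detour_cauchy:
  assumes e: "e > 0"
  shows "integral {- pi / 2..pi / 2} (\<lambda>t. sin_kernel e a n (complex_of_real t)) = detour (sin_kernel e a n)"
proof -
  let ?f = "sin_kernel e a n"
  let ?S = "cbox zB (Complex (pi / 2) 0)"
  have S: "z \<in> ?S \<longleftrightarrow> \<bar>Re z\<bar> \<le> pi / 2 \<and> -1 \<le> Im z \<and> Im z \<le> 0" for z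
    by (auto simp: in_cbox_complex_iff)
  have corners: "zA \<in> ?S" "zB \<in> ?S" "zC \<in> ?S" "zD \<in> ?S" unfolding S by simp_all
  have hol: "?f holomorphic_on ?S" unfolding sin_kernel_def
  proof (intro holomorphic_intros)
    fix z assume "z \<in> ?S"
    then have "Re (complex_of_real e + \<i> * sin z) > 0" using Re_i_sin_nonneg[of z] e unfolding S by simp
    then show "complex_of_real e + \<i> * sin z \<notin> \<real>\<^sub>\<le>\<^sub>0" by (auto simp: complex_nonpos_Reals_iff)
  qed
  have sub: "closed_segment p q \<subseteq> ?S" if "p \<in> ?S" "q \<in> ?S" for p q
    using that by (intro closed_segment_subset convex_box) auto
  have ci: "?f contour_integrable_on linepath p q" if "p \<in> ?S" "q \<in> ?S" for p q
    using sub[OF that] holomorphic_on_imp_continuous_on[OF hol]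
    by (intro contour_integrable_continuous_linepath) (auto intro: continuous_on_subset)
  have "(?f has_contour_integral 0) (linepath zA zB +++ linepath zB zC +++ linepath zC zD +++ linepath zD zA)"
    using sub corners by (intro Cauchy_theorem_convex_simple[OF hol] convex_box) (auto simp: path_image_join)
  then have "contour_integral (linepath zA zB) ?f + (contour_integral (linepath zB zC) ?f +
     (contour_integral (linepath zC zD) ?f + contour_integral (linepath zD zA) ?f)) = 0"
    using contour_integral_quadrilateral[OF ci[OF corners(1,2)] ci[OF corners(2,3)] ci[OF corners(3,4)] ci[OF corners(4,1)]]
    by (metis contour_integral_unique)
  moreover have "contour_integral (linepath zD zA) ?f = - contour_integral (linepath zA zD) ?f"
    by (rule contour_integral_reverse_linepath)
       (rule continuous_on_subset[OF holomorphic_on_imp_continuous_on[OF hol] sub], use corners in auto)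
  moreover have "contour_integral (linepath zA zD) ?f = integral {Re zA..Re zD} (\<lambda>x. ?f (of_real x))"
    by (rule contour_integral_linepath_Reals_eq) auto
  ultimately show ?thesis by (simp add: detour_def add_eq_0_iff2 algebra_simps)
qed

lemma sin_kernel_derivative_algebra:
  fixes A p w c m :: complex
  assumes "w \<noteq> 0"
  shows "- A * (p / w ^ 2) * \<i> * c * (1 + w ^ 2) + m * c * \<i> * w * (p / w) =
    - A * (p / w ^ 2) * \<i> * c - A * p * \<i> * c + m * c * \<i> * p"
  using assms by (simp add: field_simps power2_eq_square)

text \<open>Integrate the derivative of (i sin z)^(- a - 1) cos^(n + 1) z along the path, rewriting
  cos^2 z as 1 + (i sin z)^2. The boundary terms vanish because the cosine is zero at both
  ends.\<close>

lemma detour_recurrence: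
  "complex_of_real (a + 1) * detour (sin_kernel 0 (a + 2) n) = complex_of_real (real n - a) * detour (sin_kernel 0 a n)"
proof -
  define F where "F z = (\<i> * sin z) powr (- complex_of_real (a + 1)) * cos z ^ (n + 1)" for z
  define f where "f z = \<i> * (complex_of_real (real n - a) * sin_kernel 0 a n z - complex_of_real (a + 1) * sin_kernel 0 (a + 2) n z)" for z
  have der: "(F has_field_derivative f z) (at z within A)" if z: "z \<in> detour_points" for z A
  proof -
    let ?w = "\<i> * sin z"
    let ?p = "?w powr (- complex_of_real a)"
    \<comment> \<open>A zero of the sine would make the primitive singular. The path avoids it,
      which is why the recurrence is proved for \<open>detour\<close> and not for the real
      integral.\<close>
    have w: "?w \<noteq> 0" using detour_sin_ge[OF z] by auto
    have nz: "?w \<notin> \<real>\<^sub>\<le>\<^sub>0"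
      using detour_base(1)[OF z, of 0] w by (auto simp: complex_nonpos_Reals_iff complex_eq_iff)
    have p1: "?w powr (- complex_of_real (a + 1)) = ?p / ?w"
    proof -
      have "- complex_of_real (a + 1) = - complex_of_real a - 1" by simp
      then show ?thesis using w powr_diff[of ?w "- complex_of_real a" 1] by (simp only: powr_one_gt_zero_iff) simp
    qed
    have p2: "?w powr (- complex_of_real (a + 1) - 1) = ?p / ?w ^ 2"
      using w powr_diff[of ?w "- complex_of_real (a + 1)" 1] p1 by (simp add: power2_eq_square)
    have p3: "?w powr (- complex_of_real (a + 2)) = ?p / ?w ^ 2"
    proof -
      have "- complex_of_real (a + 2) = - complex_of_real (a + 1) - 1" by simp
      then show ?thesis using p2 by (simp only:)
    qed
    have dw: "((\<lambda>z. \<i> * sin z) has_field_derivative \<i> * cos z) (at z within A)"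
      by (auto intro!: derivative_eq_intros)
    have d1: "((\<lambda>z. (\<i> * sin z) powr (- complex_of_real (a + 1))) has_field_derivative
        (- complex_of_real (a + 1) * ?w powr (- complex_of_real (a + 1) - 1)) * (\<i> * cos z)) (at z within A)"
      by (rule DERIV_chain2[OF has_field_derivative_powr[OF nz] dw])
    have d2: "((\<lambda>z. cos z ^ (n + 1)) has_field_derivative of_nat (n + 1) * cos z ^ n * (- sin z)) (at z within A)"
    proof -
      have "((\<lambda>z. cos z ^ (n + 1)) has_field_derivative of_nat (n + 1) * (- sin z * cos z ^ (n + 1 - Suc 0))) (at z within A)"
        by (rule DERIV_power) (auto intro!: derivative_eq_intros)
      then show ?thesis by (simp add: mult_ac)
    qed
    have c2: "cos z ^ 2 = 1 + ?w ^ 2" by (simp add: cos_squared_eq power_mult_distrib)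
    have "(- complex_of_real (a + 1) * ?w powr (- complex_of_real (a + 1) - 1)) * (\<i> * cos z) * cos z ^ (n + 1) +
       (of_nat (n + 1) * cos z ^ n * (- sin z)) * ?w powr (- complex_of_real (a + 1)) =
       - complex_of_real (a + 1) * (?p / ?w ^ 2) * \<i> * cos z ^ n * cos z ^ 2 + of_nat (n + 1) * cos z ^ n * \<i> * ?w * (?p / ?w)"
      unfolding p1 p2 by (simp add: power2_eq_square)
    also have "\<dots> = - complex_of_real (a + 1) * (?p / ?w ^ 2) * \<i> * cos z ^ n - complex_of_real (a + 1) * ?p * \<i> * cos z ^ n + of_nat (n + 1) * cos z ^ n * \<i> * ?p"
      unfolding c2 by (rule sin_kernel_derivative_algebra[OF w])
    also have "\<dots> = f z" unfolding f_def sin_kernel_def of_real_0 add_0_left p3 by (simp add: algebra_simps add_divide_distrib diff_divide_distrib)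
    finally show ?thesis using DERIV_mult[OF d1 d2] unfolding F_def by (simp only: mult.commute)
  qed
  have seg: "contour_integral (linepath p q) f = F q - F p" if "closed_segment p q \<subseteq> detour_points" for p q
    using contour_integral_primitive[of detour_points F f "linepath p q"] der that
    by (simp add: contour_integral_unique)
  have "detour f = F zD - F zA"
    unfolding detour_def using seg segment_in_detour by simp
  also have "\<dots> = 0" by (simp add: F_def cos_of_real)
  finally have "detour f = 0" .
  moreover have "detour f = \<i> * (complex_of_real (real n - a) * detour (sin_kernel 0 a n) - complex_of_real (a + 1) * detour (sin_kernel 0 (a + 2) n))"
  proof -
    have seg2: "contour_integral (linepath p q) f = \<i> * (complex_of_real (real n - a) * contour_integral (linepath p q) (sin_kernel 0 a n) -
        complex_of_real (a + 1) * contour_integral (linepath p q) (sin_kernel 0 (a + 2) n))"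
      if "closed_segment p q \<subseteq> detour_points" for p q
    proof -
      have "sin_kernel 0 b n contour_integrable_on linepath p q" for b
        using that by (intro contour_integrable_continuous_linepath continuous_on_sin_kernel) auto
      then show ?thesis unfolding f_def
        by (simp add: contour_integral_lmul contour_integral_diff contour_integrable_lmul contour_integrable_diff)
    qed
    show ?thesis unfolding detour_def seg2[OF segment_in_detour(1)] seg2[OF segment_in_detour(2)] seg2[OF segment_in_detour(3)]
      by (simp only: distrib_left right_diff_distrib) (simp only: add_diff_add)
  qed
  ultimately show ?thesis by simp
qed


section \<open>Closed form of the contour integral\<close>

text \<open>Reciprocal Gamma functions are entire, so one expression covers all real exponents,
  including those at which the integral is zero.\<close>

definition detour_value :: "real \<Rightarrow> nat \<Rightarrow> real" where
  "detour_value a n = pi * Gamma ((real n + 1) / 2) * rGamma ((real n + 2 - a) / 2) * rGamma ((a + 1) / 2)"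

lemma rGamma_reflection_real: "rGamma z * rGamma (1 - z :: real) = sin (pi * z) / pi"
proof -
  have "complex_of_real (rGamma z * rGamma (1 - z)) = complex_of_real (sin (pi * z) / pi)"
  proof -
    have "rGamma (1 - complex_of_real z) = complex_of_real (rGamma (1 - z))"
      using rGamma_complex_of_real[of "1 - z"] by simp
    moreover have "sin (complex_of_real pi * complex_of_real z) = complex_of_real (sin (pi * z))"
      using sin_of_real[of "pi * z"] by simp
    ultimately show ?thesis using rGamma_reflection_complex[of "of_real z"] by (simp add: rGamma_complex_of_real)
  qed
  then show ?thesis by (simp only: of_real_eq_iff)
qed

lemma detour_value_recurrence: "(a + 1) * detour_value (a + 2) n = (real n - a) * detour_value a n"
proof -
  have "rGamma ((real n - a) / 2) = (real n - a) / 2 * rGamma ((real n + 2 - a) / 2)"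
    using rGamma_plus1[of "(real n - a) / 2"] by (simp add: field_simps)
  moreover have "rGamma ((a + 1) / 2) = (a + 1) / 2 * rGamma ((a + 3) / 2)"
    using rGamma_plus1[of "(a + 1) / 2"] by (simp add: field_simps)
  moreover have "(real n + 2 - (a + 2)) / 2 = (real n - a) / 2" "(a + 2 + 1) / 2 = (a + 3) / 2" by simp_all
  ultimately show ?thesis unfolding detour_value_def by (simp only:) (simp add: mult_ac)
qed

text \<open>For a positive power of the sine nothing diverges. The two halves of the segment
  contribute the same Beta integral with conjugate phases, which add up to 2 cos(pi c / 2); the
  reflection formula trades this cosine for reciprocal Gamma values.\<close>

lemma sin_kernel_real_integral:
  assumes c: "c > 0"
  shows "integral {- pi / 2..pi / 2} (\<lambda>t. sin_kernel 0 (- c) n (complex_of_real t)) = complex_of_real (detour_value (- c) n)"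
proof -
  let ?f = "\<lambda>t. sin_kernel 0 (- c) n (complex_of_real t)"
  let ?B = "Beta ((c + 1) / 2) ((real n + 1) / 2) / 2"
  have pos: "?f t = complex_of_real (sin t powr c * cos t ^ n) * cis (pi * c / 2)" if "t \<in> {0..pi/2}" for t
  proof -
    have s: "sin t \<ge> 0" using that by (intro sin_ge_zero) auto
    have "(\<i> * complex_of_real (sin t)) powr complex_of_real c = complex_of_real (sin t powr c) * cis (pi * c / 2)"
    proof (cases "sin t = 0")
      case False
      then have "sin t > 0" using s by simp
      then have "Ln (\<i> * complex_of_real (sin t)) = complex_of_real (ln (sin t)) + \<i> * complex_of_real pi / 2"
        by (subst mult.commute, subst Ln_times_of_real) (auto simp: Ln_of_real)
      then show ?thesis using False \<open>sin t > 0\<close>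
        by (simp add: powr_def cis_conv_exp exp_add distrib_left exp_of_real[symmetric] mult_ac del: exp_of_real)
    qed simp
    then show ?thesis by (simp add: sin_kernel_def sin_of_real cos_of_real)
  qed
  have neg: "?f (- t) = complex_of_real (sin t powr c * cos t ^ n) * cis (- (pi * c / 2))" if "t \<in> {0..pi/2}" for t
  proof -
    have s: "sin t \<ge> 0" using that by (intro sin_ge_zero) auto
    have "(- (\<i> * complex_of_real (sin t))) powr complex_of_real c = complex_of_real (sin t powr c) * cis (- (pi * c / 2))"
    proof (cases "sin t = 0")
      case False
      then have "sin t > 0" using s by simp
      then have "Ln (complex_of_real (sin t) * (- \<i>)) = complex_of_real (ln (sin t)) + - (\<i> * complex_of_real pi / 2)"
        by (subst Ln_times_of_real) (auto simp: Ln_of_real)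
      then have "Ln (- (\<i> * complex_of_real (sin t))) = complex_of_real (ln (sin t)) - \<i> * complex_of_real pi / 2"
        by (simp add: mult.commute)
      then have "(- (\<i> * complex_of_real (sin t))) powr complex_of_real c =
          exp (complex_of_real c * (complex_of_real (ln (sin t)) - \<i> * complex_of_real pi / 2))"
        using False by (simp add: powr_def)
      also have "\<dots> = exp (complex_of_real (c * ln (sin t))) * exp (\<i> * complex_of_real (- (pi * c / 2)))"
        by (subst exp_add[symmetric]) (simp add: algebra_simps)
      finally show ?thesis using \<open>sin t > 0\<close> unfolding exp_of_real cis_conv_exp by (simp add: powr_def)
    qed simp
    then show ?thesis by (simp add: sin_kernel_def sin_of_real cos_of_real)
  qed
  have B: "((\<lambda>t. complex_of_real (sin t powr c * cos t ^ n) * w) has_integral complex_of_real ?B * w) {0..pi/2}" for w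
    using trig_beta[of c n] c by (intro has_integral_mult_left has_integral_of_real) auto
  have i1: "(?f has_integral complex_of_real ?B * cis (pi * c / 2)) {0..pi/2}"
    by (rule has_integral_eq[OF _ B]) (use pos in simp)
  have i2: "((\<lambda>t. ?f (- t)) has_integral complex_of_real ?B * cis (- (pi * c / 2))) {0..pi/2}"
    by (rule has_integral_eq[OF _ B]) (use neg in simp)
  then have i3: "(?f has_integral complex_of_real ?B * cis (- (pi * c / 2))) {- pi/2..0}"
    by (subst (asm) has_integral_reflect_real[symmetric]) simp
  have i4: "(?f has_integral complex_of_real ?B * cis (- (pi * c / 2)) + complex_of_real ?B * cis (pi * c / 2)) {- pi/2..pi/2}"
    by (rule has_integral_combine[OF _ _ i3 i1]) auto
  have e1: "complex_of_real ?B * cis (- (pi * c / 2)) + complex_of_real ?B * cis (pi * c / 2) = complex_of_real (2 * ?B * cos (pi * c / 2))"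
    by (simp add: complex_eq_iff)
  have e2: "2 * ?B * cos (pi * c / 2) = detour_value (- c) n"
  proof -
    have "Gamma ((c + 1) / 2) > 0" using c by (intro Gamma_real_pos) simp
    moreover have "rGamma ((1 - c) / 2) * rGamma ((1 + c) / 2) = cos (pi * c / 2) / pi"
    proof -
      have e: "1 - (1 - c) / 2 = (1 + c) / 2" "pi * ((1 - c) / 2) = pi / 2 - pi * c / 2" by (simp_all add: field_simps)
      show ?thesis using rGamma_reflection_real[of "(1 - c) / 2"] unfolding e by (simp add: sin_diff)
    qed
    ultimately have "cos (pi * c / 2) = pi * (rGamma ((1 - c) / 2) * rGamma ((c + 1) / 2))"
        "rGamma ((c + 1) / 2) * Gamma ((c + 1) / 2) = 1"
      by (simp_all add: add.commute rGamma_inverse_Gamma[of "(1 + c) / 2"])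
    then have "cos (pi * c / 2) * Gamma ((c + 1) / 2) = pi * rGamma ((1 - c) / 2)"
      by (simp only: mult.assoc mult_1_right)
    moreover have "(c + 1) / 2 + (real n + 1) / 2 = (real n + 2 + c) / 2" by (simp add: field_simps)
    then have "2 * ?B = Gamma ((c + 1) / 2) * Gamma ((real n + 1) / 2) * rGamma ((real n + 2 + c) / 2)"
      unfolding Beta_altdef by (simp only:)
    ultimately show ?thesis unfolding detour_value_def by (simp add: mult_ac)
  qed
  show ?thesis using i4 unfolding e1 e2 by (rule integral_unique)
qed

lemma tendsto_detour:
  assumes "e0 \<ge> 0"
  shows "((\<lambda>e. detour (sin_kernel e a n)) \<longlongrightarrow> detour (sin_kernel e0 a n)) (at e0 within {0..})"
proof -
  have "continuous_on {0..} (\<lambda>e. detour (sin_kernel (fst (e, a)) (snd (e, a)) n))"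
    by (rule continuous_on_compose2[OF continuous_on_detour, of _ "\<lambda>e. (e, a)"]) (auto intro!: continuous_intros)
  then show ?thesis using assms by (auto simp: continuous_on_def)
qed

lemma tendsto_detour_exponent:
  "((\<lambda>a. detour (sin_kernel 0 a n)) \<longlongrightarrow> detour (sin_kernel 0 a0 n)) (at a0)"
proof -
  have "continuous_on UNIV (\<lambda>a. detour (sin_kernel (fst (0, a)) (snd (0, a)) n))"
    using continuous_on_compose2[OF continuous_on_detour[of n] continuous_on_Pair[OF continuous_on_const[of UNIV 0] continuous_on_id]] by auto
  then show ?thesis by (auto simp: continuous_on_def)
qed

lemma at_right_0_within: "at_right (0::real) \<le> at 0 within {0..}"
  by (rule at_le) auto

text \<open>For a negative exponent \<open>a\<close> the power is continuous at base 0, so the real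
  integral is continuous in \<open>e\<close> up to 0. Both sides of \<open>detour_cauchy\<close>
  then have limits, and these must agree.\<close>

lemma detour_eq_value_neg:
  assumes a: "a < 0" shows "detour (sin_kernel 0 a n) = complex_of_real (detour_value a n)"
proof -
  let ?I = "\<lambda>e. integral {- pi / 2..pi / 2} (\<lambda>t. sin_kernel e a n (complex_of_real t))"
  have "continuous_on ({0..} \<times> cbox (- pi / 2) (pi / 2)) (\<lambda>(e, t). sin_kernel e a n (complex_of_real t))"
    unfolding sin_kernel_def split_beta'
  proof (intro continuous_intros)
    show "{0..} \<times> cbox (- pi / 2) (pi / 2) \<subseteq> {z. 0 \<le> Re (complex_of_real (fst z) + \<i> * sin (complex_of_real (snd z))) \<or>
       Im (complex_of_real (fst z) + \<i> * sin (complex_of_real (snd z))) \<noteq> 0}"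
      by (auto simp: sin_of_real)
  qed (use a in auto)
  from integral_continuous_on_param[OF this]
  have "continuous_on {0..} ?I" by simp
  then have "(?I \<longlongrightarrow> ?I 0) (at 0 within {0..})" by (simp add: continuous_on_def)
  then have 1: "(?I \<longlongrightarrow> ?I 0) (at_right 0)" using at_right_0_within tendsto_mono by blast
  have 2: "((\<lambda>e. detour (sin_kernel e a n)) \<longlongrightarrow> detour (sin_kernel 0 a n)) (at_right 0)"
    using tendsto_detour[of 0 a n] at_right_0_within tendsto_mono by blast
  have "eventually (\<lambda>e. ?I e = detour (sin_kernel e a n)) (at_right 0)"
    using eventually_at_right_less[of "0::real"] by eventually_elim (simp only: detour_cauchy)
  then have "(?I \<longlongrightarrow> detour (sin_kernel 0 a n)) (at_right 0)"
    using 2 by (subst tendsto_cong)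
  with 1 have "?I 0 = detour (sin_kernel 0 a n)" by (intro tendsto_unique[of "at_right (0::real)"]) auto
  moreover have "?I 0 = complex_of_real (detour_value a n)" using sin_kernel_real_integral[of "- a" n] a by simp
  ultimately show ?thesis by simp
qed

lemma detour_eq_value_step:
  assumes "detour (sin_kernel 0 a n) = complex_of_real (detour_value a n)" "a \<noteq> - 1"
  shows "detour (sin_kernel 0 (a + 2) n) = complex_of_real (detour_value (a + 2) n)"
proof -
  have "complex_of_real (a + 1) * detour (sin_kernel 0 (a + 2) n) = complex_of_real ((real n - a) * detour_value a n)"
    unfolding detour_recurrence assms(1) by simp
  also have "\<dots> = complex_of_real (a + 1) * complex_of_real (detour_value (a + 2) n)"
    unfolding detour_value_recurrence[symmetric] by simp
  finally show ?thesis
    using assms(2) by (metis add_eq_0_iff2 mult_left_cancel of_real_eq_0_iff)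
qed

text \<open>The recurrence cannot pass from \<open>a = -1\<close> to \<open>a = 1\<close>; that value follows by continuity in \<open>a\<close>.\<close>

lemma detour_eq_value: "detour (sin_kernel 0 a n) = complex_of_real (detour_value a n)"
proof -
  have lt2: "detour (sin_kernel 0 a n) = complex_of_real (detour_value a n)" if "a < 2" for a
  proof (cases "a = 1")
    case False
    then show ?thesis using detour_eq_value_step[OF detour_eq_value_neg[of "a - 2"]] that by simp
  next
    case True
    have L1: "((\<lambda>a. complex_of_real (detour_value a n)) \<longlongrightarrow> complex_of_real (detour_value 1 n)) (at_left 1)"
    proof -
      have "isCont (\<lambda>a. complex_of_real (detour_value a n)) 1"
        unfolding detour_value_def by (intro continuous_intros) auto
      then show ?thesis unfolding isCont_def by (rule tendsto_mono[rotated]) (simp add: at_le)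
    qed
    have L2: "((\<lambda>a. detour (sin_kernel 0 a n)) \<longlongrightarrow> detour (sin_kernel 0 1 n)) (at_left 1)"
      using tendsto_detour_exponent by (rule tendsto_mono[rotated]) (simp add: at_le)
    have ev: "eventually (\<lambda>a. detour (sin_kernel 0 a n) = complex_of_real (detour_value a n)) (at_left 1)"
    proof -
      have "eventually (\<lambda>a::real. a < 1) (at_left 1)" by (simp add: eventually_at_filter)
      then show ?thesis
      proof eventually_elim
        case (elim a)
        then show ?case using detour_eq_value_step[OF detour_eq_value_neg[of "a - 2"]] by simp
      qed
    qed
    have "detour (sin_kernel 0 1 n) = complex_of_real (detour_value 1 n)"
      by (rule tendsto_unique[OF _ Lim_transform_eventually[OF L2 ev] L1]) simp
    then show ?thesis using True by simp
  qed
  have "detour (sin_kernel 0 a n) = complex_of_real (detour_value a n)" if "a < 2 * real (N + 1)" for a N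
    using that
  proof (induction N arbitrary: a)
    case 0
    then show ?case by (intro lt2) simp
  next
    case (Suc N)
    show ?case
    proof (cases "a < 2")
      case False
      then show ?thesis using detour_eq_value_step[OF Suc.IH[of "a - 2"]] Suc.prems by simp
    qed (rule lt2)
  qed
  moreover obtain N :: nat where "a < real N" using reals_Archimedean2 by blast
  then have "a < 2 * real (N + 1)" by simp
  ultimately show ?thesis by blast
qed

lemma sin_kernel_integral_bound:
  assumes "e > 0" "a \<ge> 0"
  shows "norm (integral {- pi / 2..pi / 2} (\<lambda>t. sin_kernel e a n (complex_of_real t))) \<le> 2 ^ n * (pi + 2)"
  unfolding detour_cauchy[OF assms(1)] using assms by (intro detour_bound) auto

lemma sin_kernel_integral_limit:
  "((\<lambda>e. integral {- pi / 2..pi / 2} (\<lambda>t. sin_kernel e a n (complex_of_real t))) \<longlongrightarrow> complex_of_real (detour_value a n)) (at_right 0)"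
proof -
  have "((\<lambda>e. detour (sin_kernel e a n)) \<longlongrightarrow> complex_of_real (detour_value a n)) (at_right 0)"
    using tendsto_mono[OF at_right_0_within tendsto_detour[of 0 a n]] by (simp add: detour_eq_value)
  moreover have "eventually (\<lambda>e. detour (sin_kernel e a n) = integral {- pi / 2..pi / 2} (\<lambda>t. sin_kernel e a n (complex_of_real t))) (at_right 0)"
    using eventually_at_right_less[of "0::real"] by eventually_elim (simp only: detour_cauchy)
  ultimately show ?thesis by (rule Lim_transform_eventually)
qed


section \<open>Fourier transforms of spherical harmonics\<close>

text \<open>The constant of Poisson's integral: with \<nu> = j + d / 2 - 1, the Bessel function of
  order \<nu> that governs the Fourier transform of a harmonic is an arc integral with weight cos^(2
  \<nu>), normalized by \<Gamma>(\<nu> + 1 / 2).\<close>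

definition sphere_fourier_const :: "nat \<Rightarrow> nat \<Rightarrow> real" where
  "sphere_fourier_const d j = 2 * pi powr (real d / 2) / (2 ^ j * sqrt pi * Gamma (real j + (real d - 1) / 2))"

text \<open>A finite measure instead of a set integral, so that
  \<open>sums_integral_exp_series\<close> and Fubini apply to the arc as they do to the
  sphere.\<close>

definition arc_measure :: "real measure" where
  "arc_measure = density lborel (\<lambda>t. ennreal (indicator {- pi / 2..pi / 2} t))"

lemma sets_arc_measure [simp, measurable_cong]: "sets arc_measure = sets borel"
  and space_arc_measure [simp]: "space arc_measure = UNIV"
  by (simp_all add: arc_measure_def)

global_interpretation arc_measure: finite_measure arc_measure
  by (rule finite_measureI) (simp add: arc_measure_def emeasure_density ennreal_indicator)

lemma integral_arc_measure:
  fixes f :: "real \<Rightarrow> 'b::euclidean_space"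
  assumes "continuous_on UNIV f"
  shows "integrable arc_measure f" "(LINT t|arc_measure. f t) = integral {- pi / 2..pi / 2} f"
proof -
  have [measurable]: "f \<in> borel_measurable borel" by (rule borel_measurable_continuous_onI[OF assms])
  have i: "set_integrable lborel {- pi / 2..pi / 2} f"
    by (rule borel_integrable_atLeastAtMost'[OF continuous_on_subset[OF assms]]) simp
  then show "integrable arc_measure f"
    unfolding arc_measure_def set_integrable_def by (subst integrable_density) auto
  have "(LINT t|arc_measure. f t) = (LINT t:{- pi / 2..pi / 2}|lborel. f t)"
    unfolding arc_measure_def set_lebesgue_integral_def by (subst integral_density) auto
  then show "(LINT t|arc_measure. f t) = integral {- pi / 2..pi / 2} f"
    using set_borel_integral_eq_integral(2)[OF i] by simp
qed

lemma sin_cos_integral: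
  "((\<lambda>t. sin t ^ m * cos t ^ n) has_integral
     (if even m then Beta ((real m + 1) / 2) ((real n + 1) / 2) else 0)) {- pi / 2..pi / 2}"
proof -
  let ?B = "Beta ((real m + 1) / 2) ((real n + 1) / 2) / 2"
  have i1: "((\<lambda>t. sin t ^ m * cos t ^ n) has_integral ?B) {0..pi/2}"
  proof (rule has_integral_spike_finite[OF _ _ trig_beta[of "real m" n]])
    show "finite {0::real}" by simp
    fix t assume "t \<in> {0..pi / 2} - {0}"
    then have "sin t > 0" by (intro sin_gt_zero) auto
    then show "sin t ^ m * cos t ^ n = sin t powr real m * cos t ^ n" by (simp add: powr_realpow)
  qed simp
  then have "((\<lambda>t. sin (- t) ^ m * cos (- t) ^ n) has_integral ?B) {- (pi/2)..- 0}"
    by (subst (asm) has_integral_reflect_real[symmetric]) simp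
  then have i2: "((\<lambda>t. (-1) ^ m * (sin t ^ m * cos t ^ n)) has_integral ?B) {- pi/2..0}"
    by (simp add: power_minus[of "sin _"] mult.assoc)
  have "((\<lambda>t. (-1) ^ m * ((-1) ^ m * (sin t ^ m * cos t ^ n))) has_integral (-1) ^ m * ?B) {- pi/2..0}"
    by (rule has_integral_mult_right[OF i2])
  then have i3: "((\<lambda>t. sin t ^ m * cos t ^ n) has_integral (-1) ^ m * ?B) {- pi/2..0}"
    by (simp add: mult.assoc[symmetric] power_mult_distrib[symmetric])
  have "((\<lambda>t. sin t ^ m * cos t ^ n) has_integral (-1) ^ m * ?B + ?B) {- pi/2..pi/2}"
    by (rule has_integral_combine[OF _ _ i3 i1]) auto
  then show ?thesis by (cases "even m") simp_all
qed

lemma Gamma_nat_half: "Gamma (real l + 1 / 2) = fact (2 * l) * sqrt pi / (4 ^ l * fact l)"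
proof (induction l)
  case 0
  then show ?case by (simp add: Gamma_one_half_real)
next
  case (Suc l)
  have "real l + 1 / 2 \<notin> \<int>\<^sub>\<le>\<^sub>0" using nonpos_Ints_nonpos[of "real l + 1 / 2"] by (auto simp: not_le)
  then have "Gamma (real l + 1 / 2 + 1) = (real l + 1 / 2) * Gamma (real l + 1 / 2)" by (rule Gamma_plus1)
  then have "Gamma (real (Suc l) + 1 / 2) = (real l + 1 / 2) * (fact (2 * l) * sqrt pi / (4 ^ l * fact l))"
    using Suc by (simp add: add_ac)
  also have "\<dots> = fact (2 * Suc l) * sqrt pi / (4 ^ Suc l * fact (Suc l))"
  proof -
    define X F Q f where "X = real l" and "F = (fact (2 * l) :: real)" and "Q = (4 ^ l :: real)" and "f = (fact l :: real)"
    have "fact (2 * Suc l) * sqrt pi / (4 ^ Suc l * fact (Suc l)) = ((X + 1) * (2 * (2 * X + 1) * F * sqrt pi)) / ((X + 1) * (4 * Q * f))"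
      unfolding X_def F_def Q_def f_def by (rule arg_cong2[where f="(/)"]) (simp_all add: algebra_simps)
    also have "\<dots> = (2 * (2 * X + 1) * F * sqrt pi) / (4 * Q * f)" unfolding X_def by simp
    also have "\<dots> = (X + 1 / 2) * (F * sqrt pi / (Q * f))"
    proof -
      have "Q \<noteq> 0" "f \<noteq> 0" by (simp_all add: Q_def f_def)
      then show ?thesis by (simp add: field_simps)
    qed
    finally show ?thesis unfolding X_def F_def Q_def f_def by simp
  qed
  finally show ?case .
qed

text \<open>The sphere moments of a harmonic and the moments of the sine on the arc, both normalized
  by factorials, are proportional with a factor independent of m. This matches two exponential
  series term by term; odd moments vanish on both sides.\<close>

lemma funk_hecke_coeff_arc:
  assumes d: "d \<ge> 2"
  shows "funk_hecke_coeff d (j + m) j / fact (j + m) =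
    sphere_fourier_const d j * (integral {- pi / 2..pi / 2} (\<lambda>t. sin t ^ m * cos t ^ (2 * j + d - 2)) / fact m)"
proof (cases "even m")
  case False
  then show ?thesis using integral_unique[OF sin_cos_integral[of m]] by (simp add: funk_hecke_coeff_def)
next
  case True
  then obtain l where m: "m = 2 * l" by blast
  let ?b = "real j + (real d - 1) / 2"
  have b: "(real (2 * j + d - 2) + 1) / 2 = ?b" using d by (simp add: of_nat_diff field_simps)
  have G: "Gamma ?b > 0" using d by (intro Gamma_real_pos) (simp add: add_nonneg_pos)
  have "integral {- pi / 2..pi / 2} (\<lambda>t. sin t ^ m * cos t ^ (2 * j + d - 2)) = Beta ((real m + 1) / 2) ?b"
    using integral_unique[OF sin_cos_integral[of m "2 * j + d - 2"]] True by (simp only: b if_True)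
  also have "\<dots> = Gamma (real l + 1 / 2) * Gamma ?b / Gamma (real l + real j + real d / 2)"
  proof -
    have "(real m + 1) / 2 = real l + 1 / 2" by (simp add: m)
    moreover have "real l + 1 / 2 + ?b = real l + real j + real d / 2" by (simp add: field_simps)
    ultimately show ?thesis unfolding Beta_def by (simp only:)
  qed
  also have "\<dots> = fact m * sqrt pi / (4 ^ l * fact l) * Gamma ?b / Gamma (real l + real j + real d / 2)"
    by (simp only: Gamma_nat_half m)
  finally have I: "integral {- pi / 2..pi / 2} (\<lambda>t. sin t ^ m * cos t ^ (2 * j + d - 2)) / fact m =
    sqrt pi / (4 ^ l * fact l) * Gamma ?b / Gamma (real l + real j + real d / 2)" by simp
  have "sphere_fourier_const d j * (sqrt pi / (4 ^ l * fact l) * Gamma ?b / Gamma (real l + real j + real d / 2)) =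
     2 * pi powr (real d / 2) / (2 ^ j * 4 ^ l * fact l * Gamma (real l + real j + real d / 2))"
    unfolding sphere_fourier_const_def using G by (simp add: mult_ac)
  also have "(2::real) ^ j * 4 ^ l = 2 ^ (j + 2 * l)" by (simp add: power_add power_mult)
  finally show ?thesis unfolding I unfolding m funk_hecke_coeff_eq by simp
qed

lemma cis_exp_series: "(\<lambda>n. (- (\<i> * complex_of_real t)) ^ n / fact n) sums cis (- t)"
proof -
  have "cis (- t) = exp (- (\<i> * complex_of_real t))" by (simp add: cis_conv_exp)
  then show ?thesis using exp_converges[of "- (\<i> * complex_of_real t)"] by (simp add: scaleR_conv_of_real field_simps)
qed

lemma sums_integral_exp_series:
  fixes h :: "'b \<Rightarrow> complex" and s :: "'b \<Rightarrow> real"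
  assumes M: "finite_measure M" and [measurable]: "h \<in> borel_measurable M" "s \<in> borel_measurable M"
    and h: "AE x in M. norm (h x) \<le> B" and s: "AE x in M. \<bar>s x\<bar> \<le> 1"
  shows "(\<lambda>n. (- (\<i> * complex_of_real t)) ^ n / fact n * (CLINT x|M. h x * complex_of_real (s x ^ n))) sums
    (CLINT x|M. h x * cis (- (t * s x)))"
proof -
  interpret finite_measure M by fact
  let ?f = "\<lambda>n x. (- (\<i> * complex_of_real t)) ^ n / fact n * (h x * complex_of_real (s x ^ n))"
  have b: "AE x in M. norm (?f n x) \<le> \<bar>t\<bar> ^ n / fact n * B" for n
    using h s
  proof eventually_elim
    case (elim x)
    have "norm (h x) * \<bar>s x\<bar> ^ n \<le> B * 1" using elim by (intro mult_mono power_le_one) (auto intro: order_trans[OF norm_ge_zero])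
    then have "\<bar>t\<bar> ^ n / fact n * (norm (h x) * \<bar>s x\<bar> ^ n) \<le> \<bar>t\<bar> ^ n / fact n * B" by (intro mult_left_mono) auto
    then show ?case by (simp add: norm_mult norm_power norm_divide)
  qed
  have int: "integrable M (?f n)" for n by (rule integrable_const_bound[OF b]) measurable
  have sm: "summable (\<lambda>n. \<bar>t\<bar> ^ n / fact n * B)"
    using summable_exp[of "\<bar>t\<bar>"] by (intro summable_mult2) (simp add: field_simps)
  have "(\<lambda>n. CLINT x|M. ?f n x) sums (CLINT x|M. (\<Sum>n. ?f n x))"
  proof (rule sums_integral[OF int])
    show "AE x in M. summable (\<lambda>n. norm (?f n x))"
    proof -
      have "AE x in M. \<forall>n. norm (?f n x) \<le> \<bar>t\<bar> ^ n / fact n * B" using b by (simp add: AE_all_countable)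
      then show ?thesis by eventually_elim (rule summable_comparison_test'[OF sm, of 0], simp)
    qed
    show "summable (\<lambda>n. LINT x|M. norm (?f n x))"
    proof (rule summable_comparison_test'[of "\<lambda>n. \<bar>t\<bar> ^ n / fact n * B * measure M (space M)" 0])
      show "summable (\<lambda>n. \<bar>t\<bar> ^ n / fact n * B * measure M (space M))" by (rule summable_mult2[OF sm])
      fix n
      have "(LINT x|M. norm (?f n x)) \<le> (LINT x|M. \<bar>t\<bar> ^ n / fact n * B)"
        using int b by (intro integral_mono_AE) auto
      then show "norm (LINT x|M. norm (?f n x)) \<le> \<bar>t\<bar> ^ n / fact n * B * measure M (space M)"
        by (simp add: integral_nonneg mult_ac)
    qed
  qed
  moreover have "(\<Sum>n. ?f n x) = h x * cis (- (t * s x))" for x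
  proof -
    have "(\<lambda>n. h x * ((- (\<i> * complex_of_real (t * s x))) ^ n / fact n)) sums (h x * cis (- (t * s x)))"
      by (intro sums_mult cis_exp_series)
    moreover have "h x * ((- (\<i> * complex_of_real (t * s x))) ^ n / fact n) = ?f n x" for n
    proof -
      have "- (\<i> * complex_of_real (t * s x)) = - (\<i> * complex_of_real t) * complex_of_real (s x)" by simp
      then show ?thesis by (simp only: power_mult_distrib of_real_power) (simp add: field_simps)
    qed
    ultimately have "(\<lambda>n. ?f n x) sums (h x * cis (- (t * s x)))" by (simp only:)
    then show ?thesis by (rule sums_unique[symmetric])
  qed
  ultimately show ?thesis by simp
qed

text \<open>Expand both exponentials. The terms of order below j vanish on the sphere, and the term
  of order j + m is matched with the m-th term on the arc by \<open>funk_hecke_coeff_arc\<close>.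
  The arc form is preferred to Bessel functions because the radius appears only in an
  exponential.\<close>

lemma sphere_fourier:
  fixes h :: "'a::euclidean_space \<Rightarrow> complex"
  assumes d: "DIM('a) \<ge> 2" and \<theta>: "norm \<theta> = 1" and h: "h \<in> spherical_harmonics j"
  shows "(CLINT u|sphere_measure. h u * cis (- (t * (\<theta> \<bullet> u)))) =
    h \<theta> * complex_of_real (sphere_fourier_const DIM('a) j) * (- (\<i> * complex_of_real t)) ^ j *
      (CLINT s|arc_measure. complex_of_real (cos s ^ (2 * j + DIM('a) - 2)) * cis (- (t * sin s)))"
proof -
  let ?n = "2 * j + DIM('a) - 2"
  let ?k = "complex_of_real (sphere_fourier_const DIM('a) j)"
  let ?z = "- (\<i> * complex_of_real t)"
  obtain B where B: "\<And>u. norm (h u) \<le> B" using spherical_harmonics_bounded[OF h] by blast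
  have [measurable]: "h \<in> borel_measurable borel" by (rule spherical_harmonics_measurable[OF h])
  have 1: "(\<lambda>n. ?z ^ n / fact n * (CLINT u|sphere_measure. h u * complex_of_real ((\<theta> \<bullet> u) ^ n))) sums
      (CLINT u|sphere_measure. h u * cis (- (t * (\<theta> \<bullet> u))))"
  proof (rule sums_integral_exp_series)
    show "finite_measure (sphere_measure :: 'a measure)" by (rule sphere_measure.finite_measure_axioms)
    show "AE u in sphere_measure. \<bar>\<theta> \<bullet> u\<bar> \<le> 1"
      using AE_sphere_measure by eventually_elim (rule sphere_inner_le_1[OF \<theta>])
  qed (use B in auto)
  then have 2: "(\<lambda>n. ?z ^ n / fact n * (complex_of_real (funk_hecke_coeff DIM('a) n j) * h \<theta>)) sums
      (CLINT u|sphere_measure. h u * cis (- (t * (\<theta> \<bullet> u))))"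
    by (simp only: spherical_harmonics_inner_power[OF d \<theta> h])
  have "(\<lambda>m. ?z ^ m / fact m * (CLINT s|arc_measure. complex_of_real (cos s ^ ?n) * complex_of_real (sin s ^ m))) sums
      (CLINT s|arc_measure. complex_of_real (cos s ^ ?n) * cis (- (t * sin s)))"
  proof (rule sums_integral_exp_series)
    show "finite_measure arc_measure" by (rule arc_measure.finite_measure_axioms)
    show "AE s in arc_measure. norm (complex_of_real (cos s ^ ?n)) \<le> 1"
      by (intro AE_I2) (simp add: norm_power power_le_one)
  qed auto
  then have "(\<lambda>m. h \<theta> * ?k * ?z ^ j * (?z ^ m / fact m * (CLINT s|arc_measure. complex_of_real (cos s ^ ?n) * complex_of_real (sin s ^ m)))) sums
      (h \<theta> * ?k * ?z ^ j * (CLINT s|arc_measure. complex_of_real (cos s ^ ?n) * cis (- (t * sin s))))"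
    by (rule sums_mult)
  moreover have "h \<theta> * ?k * ?z ^ j * (?z ^ m / fact m * (CLINT s|arc_measure. complex_of_real (cos s ^ ?n) * complex_of_real (sin s ^ m))) =
     ?z ^ (m + j) / fact (m + j) * (complex_of_real (funk_hecke_coeff DIM('a) (m + j) j) * h \<theta>)" for m
  proof -
    have "(CLINT s|arc_measure. complex_of_real (cos s ^ ?n) * complex_of_real (sin s ^ m)) =
      complex_of_real (integral {- pi / 2..pi / 2} (\<lambda>t. sin t ^ m * cos t ^ ?n))"
    proof -
      have "(CLINT s|arc_measure. complex_of_real (cos s ^ ?n) * complex_of_real (sin s ^ m)) =
         (CLINT s|arc_measure. complex_of_real (sin s ^ m * cos s ^ ?n))"
        by (simp add: mult.commute)
      also have "\<dots> = complex_of_real (LINT s|arc_measure. sin s ^ m * cos s ^ ?n)" by (rule integral_complex_of_real)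
      also have "(LINT s|arc_measure. sin s ^ m * cos s ^ ?n) = integral {- pi / 2..pi / 2} (\<lambda>t. sin t ^ m * cos t ^ ?n)"
        by (intro integral_arc_measure continuous_intros)
      finally show ?thesis .
    qed
    then have "?k * (1 / fact m * (CLINT s|arc_measure. complex_of_real (cos s ^ ?n) * complex_of_real (sin s ^ m))) =
      complex_of_real (funk_hecke_coeff DIM('a) (j + m) j / fact (j + m))"
      unfolding funk_hecke_coeff_arc[OF d] by simp
    then have e: "?k * (1 / fact m * (CLINT s|arc_measure. complex_of_real (cos s ^ ?n) * complex_of_real (sin s ^ m))) =
      complex_of_real (funk_hecke_coeff DIM('a) (m + j) j) / fact (m + j)"
      by (simp add: add.commute)
    have "h \<theta> * ?k * ?z ^ j * (?z ^ m / fact m * (CLINT s|arc_measure. complex_of_real (cos s ^ ?n) * complex_of_real (sin s ^ m))) =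
       h \<theta> * ?z ^ (m + j) * (?k * (1 / fact m * (CLINT s|arc_measure. complex_of_real (cos s ^ ?n) * complex_of_real (sin s ^ m))))"
      by (simp add: power_add mult_ac)
    then show ?thesis unfolding e by (simp add: mult_ac)
  qed
  ultimately have "(\<lambda>m. ?z ^ (m + j) / fact (m + j) * (complex_of_real (funk_hecke_coeff DIM('a) (m + j) j) * h \<theta>)) sums
      (h \<theta> * ?k * ?z ^ j * (CLINT s|arc_measure. complex_of_real (cos s ^ ?n) * cis (- (t * sin s))))"
    by simp
  then have "(\<lambda>n. ?z ^ n / fact n * (complex_of_real (funk_hecke_coeff DIM('a) n j) * h \<theta>)) sums
      (h \<theta> * ?k * ?z ^ j * (CLINT s|arc_measure. complex_of_real (cos s ^ ?n) * cis (- (t * sin s))))"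
    \<comment> \<open>Shifting the index by \<open>j\<close> loses nothing, since the coefficients
      of order below \<open>j\<close> are zero.\<close>
    by (subst (asm) sums_zero_iff_shift) (auto simp: funk_hecke_coeff_def)
  with 2 show ?thesis by (rule sums_unique2)
qed

lemma powr_scale_real:
  assumes "r > 0" shows "(complex_of_real r * w) powr z = complex_of_real r powr z * w powr z"
proof (cases "w = 0")
  case False
  then show ?thesis using assms by (simp add: powr_def Ln_times_of_real Ln_of_real exp_add distrib_left)
qed simp

text \<open>Integrate over directions first, which leaves an arc integral, then exchange arc and
  radius. The radial integral is a Gamma integral at the complex rate e + i |x| sin s, and scaling
  out |x| leaves \<open>sin_kernel\<close> at damping \<open>e / norm x\<close>.\<close>

lemma radial_fourier:
  fixes h :: "'a::euclidean_space \<Rightarrow> complex"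
  assumes d: "DIM('a) \<ge> 2" and h: "h \<in> spherical_harmonics j" and x: "x \<noteq> 0" and e: "e > 0" and b: "\<beta> \<ge> 0"
  shows "integrable lborel (\<lambda>z. cis (- (x \<bullet> z)) * complex_of_real (exp (- (e * norm z)) * norm z powr \<beta>) * h (z /\<^sub>R norm z))"
      (is "integrable _ ?F")
    and "(CLINT z|lborel. cis (- (x \<bullet> z)) * complex_of_real (exp (- (e * norm z)) * norm z powr \<beta>) * h (z /\<^sub>R norm z)) =
      h (x /\<^sub>R norm x) * complex_of_real (sphere_fourier_const DIM('a) j) * (- \<i>) ^ j *
      complex_of_real (Gamma (real DIM('a) + \<beta> + real j) * norm x powr (- (real DIM('a) + \<beta>))) *
      integral {- pi / 2..pi / 2} (\<lambda>t. sin_kernel (e / norm x) (real DIM('a) + \<beta> + real j) (2 * j + DIM('a) - 2) (complex_of_real t))"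
proof -
  let ?n = "2 * j + DIM('a) - 2"
  let ?a = "real DIM('a) + \<beta> + real j"
  let ?\<rho> = "norm x"
  let ?\<theta> = "x /\<^sub>R norm x"
  let ?k = "complex_of_real (sphere_fourier_const DIM('a) j)"
  define \<Phi> where "\<Phi> r u = cis (- (r * (x \<bullet> u))) * complex_of_real (exp (- (e * r)) * r powr \<beta>) * h u" for r u
  have \<rho>: "?\<rho> > 0" and \<theta>: "norm ?\<theta> = 1" using x by auto
  have "real DIM('a) > 0" by simp
  then have apos: "?a > 0" using b by linarith
  obtain B where B: "B \<ge> 0" "\<And>u. norm (h u) \<le> B" using spherical_harmonics_bounded[OF h] by blast
  have [measurable]: "h \<in> borel_measurable borel" by (rule spherical_harmonics_measurable[OF h])
  have [measurable]: "cis \<in> borel_measurable borel" by (intro borel_measurable_continuous_onI continuous_intros)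
  have eq: "?F z = \<Phi> (norm z) (z /\<^sub>R norm z)" for z
  proof (cases "z = 0")
    case False
    then have "norm z * (x \<bullet> (z /\<^sub>R norm z)) = x \<bullet> z" by simp
    then show ?thesis unfolding \<Phi>_def by (simp only:)
  qed (simp add: \<Phi>_def)
  have kernel: "(indicator {0<..} r * r ^ (DIM('a) - 1)) * (exp (- (e * r)) * r powr \<beta>) * r ^ i = gamma_kernel (real DIM('a) + \<beta> + real i) e r" for r :: real and i
  proof (cases "r > 0")
    case True
    have "r ^ (DIM('a) - 1) * r powr \<beta> * r ^ i = r powr (real (DIM('a) - 1) + \<beta> + real i)"
      using True by (simp only: powr_add powr_realpow)
    also have "real (DIM('a) - 1) + \<beta> + real i = real DIM('a) + \<beta> + real i - 1" using d by (simp add: of_nat_diff)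
    finally show ?thesis using True by (simp add: gamma_kernel_def mult_ac)
  qed (simp add: gamma_kernel_def)
  have m: "case_prod \<Phi> \<in> borel_measurable (borel \<Otimes>\<^sub>M borel)" unfolding \<Phi>_def by measurable
  have g: "integrable (radial_measure DIM('a)) (\<lambda>r. exp (- (e * r)) * r powr \<beta> * B)"
  proof (subst integral_radial_measure(1))
    have "integrable lborel (\<lambda>r. gamma_kernel (real DIM('a) + \<beta>) e r * B)"
      using b e by (intro integrable_mult_left integrable_gamma_kernel) (auto intro: add_pos_nonneg)
    then show "integrable lborel (\<lambda>r. (indicator {0<..} r * r ^ (DIM('a) - 1)) *\<^sub>R (exp (- (e * r)) * r powr \<beta> * B))"
      using kernel[of _ 0] by (simp add: mult.assoc[symmetric])
  qed measurable
  have bd: "norm (\<Phi> r u) \<le> exp (- (e * r)) * r powr \<beta> * B" if "r > 0" "norm u = 1" for r u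
    using B(2)[of u] that by (simp add: \<Phi>_def norm_mult mult_left_mono)
  note p = integral_polar[OF m g bd]
  show "integrable lborel ?F" unfolding eq by (rule p(1))
  have inner: "(CLINT u|sphere_measure. \<Phi> r u) = complex_of_real (exp (- (e * r)) * r powr \<beta>) *
     (h ?\<theta> * ?k * (- (\<i> * complex_of_real (r * ?\<rho>))) ^ j * (CLINT s|arc_measure. complex_of_real (cos s ^ ?n) * cis (- (r * ?\<rho> * sin s))))" for r
  proof -
    have "(CLINT u|sphere_measure. \<Phi> r u) = (CLINT u|sphere_measure. complex_of_real (exp (- (e * r)) * r powr \<beta>) * (h u * cis (- (r * ?\<rho> * (?\<theta> \<bullet> u)))))"
    proof (intro Bochner_Integration.integral_cong refl)
      fix u
      have "r * ?\<rho> * (?\<theta> \<bullet> u) = r * (x \<bullet> u)" using x by simp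
      then show "\<Phi> r u = complex_of_real (exp (- (e * r)) * r powr \<beta>) * (h u * cis (- (r * ?\<rho> * (?\<theta> \<bullet> u))))"
        unfolding \<Phi>_def by (simp only: mult_ac)
    qed
    then show ?thesis using sphere_fourier[OF d \<theta> h, of "r * ?\<rho>"] by (simp only: integral_mult_right_zero)
  qed
  let ?J = "\<lambda>r. (CLINT s|arc_measure. complex_of_real (cos s ^ ?n) * cis (- (r * ?\<rho> * sin s)))"
  \<comment> \<open>The j-th power of - i r |x| is split: r^j raises the Gamma exponent to
    \<open>?a\<close>, while |x|^j stays in \<open>?C\<close> and finally cancels the j in |x|^(-
    a).\<close>
  let ?C = "h ?\<theta> * ?k * (- \<i>) ^ j * complex_of_real (?\<rho> ^ j)"
  have [measurable]: "?J \<in> borel_measurable borel"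
    by (rule arc_measure.borel_measurable_lebesgue_integral) measurable
  have "(CLINT z|lborel. ?F z) = (CLINT r|radial_measure DIM('a). CLINT u|sphere_measure. \<Phi> r u)"
    unfolding eq by (rule p(2))
  also have "\<dots> = (CLINT r|radial_measure DIM('a). ?C * (complex_of_real (exp (- (e * r)) * r powr \<beta> * r ^ j) * ?J r))"
  proof (intro Bochner_Integration.integral_cong refl)
    fix r
    have "- (\<i> * complex_of_real (r * ?\<rho>)) = (- \<i>) * complex_of_real ?\<rho> * complex_of_real r" by simp
    then have "(- (\<i> * complex_of_real (r * ?\<rho>))) ^ j = (- \<i>) ^ j * complex_of_real (?\<rho> ^ j) * complex_of_real (r ^ j)"
      by (simp only: power_mult_distrib of_real_power)
    then show "(CLINT u|sphere_measure. \<Phi> r u) = ?C * (complex_of_real (exp (- (e * r)) * r powr \<beta> * r ^ j) * ?J r)"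
      unfolding inner by (simp only: of_real_mult mult_ac)
  qed
  also have "\<dots> = ?C * (CLINT r|radial_measure DIM('a). complex_of_real (exp (- (e * r)) * r powr \<beta> * r ^ j) * ?J r)" by simp
  also have "(CLINT r|radial_measure DIM('a). complex_of_real (exp (- (e * r)) * r powr \<beta> * r ^ j) * ?J r) =
    (CLINT r|lborel. complex_of_real (gamma_kernel ?a e r) * ?J r)"
  proof (subst integral_radial_measure(2))
    show "(CLINT r|lborel. (indicator {0<..} r * r ^ (DIM('a) - 1)) *\<^sub>R (complex_of_real (exp (- (e * r)) * r powr \<beta> * r ^ j) * ?J r)) =
      (CLINT r|lborel. complex_of_real (gamma_kernel ?a e r) * ?J r)"
      unfolding scaleR_conv_of_real kernel[symmetric] by (simp only: of_real_mult mult.assoc)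
  qed measurable
  also have "\<dots> = (CLINT r|lborel. CLINT s|arc_measure. complex_of_real (gamma_kernel ?a e r) * (complex_of_real (cos s ^ ?n) * cis (- (r * ?\<rho> * sin s))))"
    by simp
  also have "\<dots> = (CLINT s|arc_measure. CLINT r|lborel. complex_of_real (gamma_kernel ?a e r) * (complex_of_real (cos s ^ ?n) * cis (- (r * ?\<rho> * sin s))))"
  proof -
    interpret pair_sigma_finite lborel arc_measure ..
    have a: "integrable lborel (gamma_kernel ?a e)" using apos e by (intro integrable_gamma_kernel)
    have "integrable (lborel \<Otimes>\<^sub>M arc_measure) (\<lambda>(r, s). complex_of_real (gamma_kernel ?a e r) * (complex_of_real (cos s ^ ?n) * cis (- (r * ?\<rho> * sin s))))"
    proof (rule Fubini_integrable)
      have nn: "gamma_kernel ?a e r \<ge> 0" for r by (simp add: gamma_kernel_def)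
      show "integrable lborel (\<lambda>r. LINT s|arc_measure. norm (case (r, s) of (r, s) \<Rightarrow> complex_of_real (gamma_kernel ?a e r) * (complex_of_real (cos s ^ ?n) * cis (- (r * ?\<rho> * sin s)))))"
        using a nn by (simp add: norm_mult norm_power)
      show "AE r in lborel. integrable arc_measure (\<lambda>s. case (r, s) of (r, s) \<Rightarrow> complex_of_real (gamma_kernel ?a e r) * (complex_of_real (cos s ^ ?n) * cis (- (r * ?\<rho> * sin s))))"
        by (intro AE_I2) (auto intro!: integral_arc_measure(1) continuous_intros)
    qed measurable
    then show ?thesis by (rule Fubini_integral[symmetric])
  qed
  also have "\<dots> = (CLINT s|arc_measure. complex_of_real (Gamma ?a) * complex_of_real (?\<rho> powr (- ?a)) * sin_kernel (e / ?\<rho>) ?a ?n (complex_of_real s))"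
  proof (intro Bochner_Integration.integral_cong refl)
    fix s :: real
    let ?w = "complex_of_real e + \<i> * complex_of_real (?\<rho> * sin s)"
    have "(CLINT r|lborel. complex_of_real (gamma_kernel ?a e r) * (complex_of_real (cos s ^ ?n) * cis (- (r * ?\<rho> * sin s)))) =
      (CLINT r|lborel. complex_of_real (cos s ^ ?n) * (complex_of_real (gamma_kernel ?a 0 r) * exp (- (?w * complex_of_real r))))"
    proof (intro Bochner_Integration.integral_cong refl)
      fix r :: real
      have "exp (- (?w * complex_of_real r)) = complex_of_real (exp (- (e * r))) * cis (- (r * ?\<rho> * sin s))"
        by (simp add: cis_conv_exp exp_of_real[symmetric] exp_add[symmetric] algebra_simps del: exp_of_real)
      then show "complex_of_real (gamma_kernel ?a e r) * (complex_of_real (cos s ^ ?n) * cis (- (r * ?\<rho> * sin s))) =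
         complex_of_real (cos s ^ ?n) * (complex_of_real (gamma_kernel ?a 0 r) * exp (- (?w * complex_of_real r)))"
        by (simp add: gamma_kernel_def mult_ac)
    qed
    also have "\<dots> = complex_of_real (cos s ^ ?n) * (complex_of_real (Gamma ?a) * ?w powr (- complex_of_real ?a))"
      using e by (subst integral_mult_right_zero, subst gamma_integral_complex[OF apos]) auto
    also have "?w = complex_of_real ?\<rho> * (complex_of_real (e / ?\<rho>) + \<i> * sin (complex_of_real s))"
      using \<rho> by (simp add: sin_of_real field_simps)
    also have "\<dots> powr (- complex_of_real ?a) = complex_of_real (?\<rho> powr (- ?a)) * (complex_of_real (e / ?\<rho>) + \<i> * sin (complex_of_real s)) powr (- complex_of_real ?a)"
      unfolding powr_scale_real[OF \<rho>] using powr_of_real[of ?\<rho> "- ?a"] by simp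
    finally show "(CLINT r|lborel. complex_of_real (gamma_kernel ?a e r) * (complex_of_real (cos s ^ ?n) * cis (- (r * ?\<rho> * sin s)))) =
      complex_of_real (Gamma ?a) * complex_of_real (?\<rho> powr (- ?a)) * sin_kernel (e / ?\<rho>) ?a ?n (complex_of_real s)"
      by (simp add: sin_kernel_def cos_of_real mult_ac)
  qed
  also have "\<dots> = complex_of_real (Gamma ?a) * complex_of_real (?\<rho> powr (- ?a)) * (CLINT s|arc_measure. sin_kernel (e / ?\<rho>) ?a ?n (complex_of_real s))"
    by simp
  also have "(CLINT s|arc_measure. sin_kernel (e / ?\<rho>) ?a ?n (complex_of_real s)) = integral {- pi / 2..pi / 2} (\<lambda>t. sin_kernel (e / ?\<rho>) ?a ?n (complex_of_real t))"
  proof (rule integral_arc_measure(2))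
    show "continuous_on UNIV (\<lambda>t. sin_kernel (e / ?\<rho>) ?a ?n (complex_of_real t))"
      unfolding sin_kernel_def using e \<rho> by (intro continuous_intros) (auto simp: sin_of_real complex_eq_iff)
  qed
  also have "?C * (complex_of_real (Gamma ?a) * complex_of_real (?\<rho> powr (- ?a)) * integral {- pi / 2..pi / 2} (\<lambda>t. sin_kernel (e / ?\<rho>) ?a ?n (complex_of_real t))) =
     h ?\<theta> * ?k * (- \<i>) ^ j * complex_of_real (Gamma ?a * (?\<rho> ^ j * ?\<rho> powr (- ?a))) * integral {- pi / 2..pi / 2} (\<lambda>t. sin_kernel (e / ?\<rho>) ?a ?n (complex_of_real t))"
    by (simp only: of_real_mult mult_ac)
  also have "?\<rho> ^ j * ?\<rho> powr (- ?a) = ?\<rho> powr (- (real DIM('a) + \<beta>))"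
    using \<rho> by (simp add: powr_realpow[symmetric] powr_add[symmetric])
  finally show "(CLINT z|lborel. ?F z) = h ?\<theta> * ?k * (- \<i>) ^ j * complex_of_real (Gamma ?a * ?\<rho> powr (- (real DIM('a) + \<beta>))) *
      integral {- pi / 2..pi / 2} (\<lambda>t. sin_kernel (e / ?\<rho>) ?a ?n (complex_of_real t))" .
qed


section \<open>Fourier inversion\<close>

lemma cis_measurable [measurable]: "cis \<in> borel_measurable borel"
  by (intro borel_measurable_continuous_onI continuous_intros)

lemma integral_lborel_scaleR:
  fixes f :: "'a::euclidean_space \<Rightarrow> 'b::{banach, second_countable_topology}"
  assumes [measurable]: "f \<in> borel_measurable borel" and c: "c > 0"
  shows "(LINT x|lborel. f x) = c ^ DIM('a) *\<^sub>R (LINT x|lborel. f (c *\<^sub>R x))"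
proof -
  have "c \<noteq> 0" using c by simp
  have "(LINT x|lborel. f x) = (LINT x|density (distr lborel borel (\<lambda>x. 0 + c *\<^sub>R x)) (\<lambda>_. ennreal (\<bar>c\<bar> ^ DIM('a))). f x)"
    using lborel_affine[OF \<open>c \<noteq> 0\<close>, of "0::'a"] by simp
  also have "\<dots> = (LINT x|distr lborel borel (\<lambda>x. 0 + c *\<^sub>R x). (\<bar>c\<bar> ^ DIM('a)) *\<^sub>R f x)"
    by (rule integral_density) auto
  also have "\<dots> = (LINT x|lborel. c ^ DIM('a) *\<^sub>R f (c *\<^sub>R x))"
    using c by (subst integral_distr) auto
  finally show ?thesis by simp
qed

lemma integrable_gauss: "integrable lborel (\<lambda>z::'a::euclidean_space. exp (- (norm z)\<^sup>2 / 2))"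
  using hpoly_gauss_integral(1)[OF hpoly.const[of 1]] by simp

lemma gauss_fourier_real:
  "integrable lborel (\<lambda>t. cis (y * t) * complex_of_real (exp (- t\<^sup>2 / 2)))"
  "(CLINT t|lborel. cis (y * t) * complex_of_real (exp (- t\<^sup>2 / 2))) = complex_of_real (sqrt (2 * pi) * exp (- y\<^sup>2 / 2))"
proof -
  show "integrable lborel (\<lambda>t. cis (y * t) * complex_of_real (exp (- t\<^sup>2 / 2)))"
    by (rule Bochner_Integration.integrable_bound[OF integrable_gauss]) (auto simp: norm_mult)
  have "complex_of_real (exp (- y\<^sup>2 / 2)) = char std_normal_distribution y"
    by (simp add: char_std_normal_distribution)
  also have "\<dots> = (CLINT t|lborel. std_normal_density t *\<^sub>R iexp (y * t))"
    unfolding char_def by (rule integral_density) auto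
  also have "\<dots> = (CLINT t|lborel. complex_of_real (1 / sqrt (2 * pi)) * (cis (y * t) * complex_of_real (exp (- t\<^sup>2 / 2))))"
    by (intro Bochner_Integration.integral_cong refl) (simp add: std_normal_density_def scaleR_conv_of_real cis_conv_exp mult_ac)
  finally have "complex_of_real (exp (- y\<^sup>2 / 2)) = complex_of_real (1 / sqrt (2 * pi)) * (CLINT t|lborel. cis (y * t) * complex_of_real (exp (- t\<^sup>2 / 2)))"
    by (simp only: integral_mult_right_zero)
  then have "complex_of_real (sqrt (2 * pi)) * complex_of_real (exp (- y\<^sup>2 / 2)) =
     complex_of_real (sqrt (2 * pi) * (1 / sqrt (2 * pi))) * (CLINT t|lborel. cis (y * t) * complex_of_real (exp (- t\<^sup>2 / 2)))"
    by (simp only: of_real_mult mult.assoc)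
  then show "(CLINT t|lborel. cis (y * t) * complex_of_real (exp (- t\<^sup>2 / 2))) = complex_of_real (sqrt (2 * pi) * exp (- y\<^sup>2 / 2))"
    by simp
qed

lemma sqrt_power_eq_powr:
  assumes "x > 0" shows "sqrt x ^ n = x powr (real n / 2)"
proof -
  have "sqrt x ^ n = sqrt x powr real n" using assms by (simp add: powr_realpow)
  also have "\<dots> = (x powr (1 / 2)) powr real n" using assms by (simp add: powr_half_sqrt)
  also have "\<dots> = x powr (1 / 2 * real n)" by (rule powr_powr)
  also have "1 / 2 * real n = real n / 2" by simp
  finally show ?thesis .
qed

lemma cis_sum: "finite A \<Longrightarrow> cis (\<Sum>b\<in>A. f b) = (\<Prod>b\<in>A. cis (f b))"
  by (induction A rule: finite_induct) (auto simp: cis_mult[symmetric])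

lemma gauss_fourier:
  fixes y :: "'a::euclidean_space"
  shows "(CLINT z|lborel. cis (y \<bullet> z) * complex_of_real (exp (- (norm z)\<^sup>2 / 2))) =
    complex_of_real ((2 * pi) powr (real DIM('a) / 2) * exp (- (norm y)\<^sup>2 / 2))"
proof -
  interpret product_sigma_finite "\<lambda>b::'a. lborel :: real measure" ..
  let ?f = "\<lambda>b t. cis ((y \<bullet> b) * t) * complex_of_real (exp (- t\<^sup>2 / 2))"
  have sq: "(norm x)\<^sup>2 = (\<Sum>b\<in>Basis. (x \<bullet> b)\<^sup>2)" for x :: 'a
    by (subst power2_norm_eq_inner, subst euclidean_inner) (simp add: power2_eq_square)
  have eq: "cis (y \<bullet> z) * complex_of_real (exp (- (norm z)\<^sup>2 / 2)) = (\<Prod>b\<in>Basis. ?f b (z \<bullet> b))" for z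
  proof -
    have "exp (- (norm z)\<^sup>2 / 2) = (\<Prod>b\<in>Basis. exp (- (z \<bullet> b)\<^sup>2 / 2))"
      by (simp add: sq exp_sum[symmetric] sum_negf sum_divide_distrib)
    moreover have "cis (y \<bullet> z) = (\<Prod>b\<in>Basis. cis ((y \<bullet> b) * (z \<bullet> b)))"
      by (subst euclidean_inner) (simp add: cis_sum)
    ultimately show ?thesis by (simp only: prod.distrib of_real_prod)
  qed
  have "(CLINT z|lborel. cis (y \<bullet> z) * complex_of_real (exp (- (norm z)\<^sup>2 / 2))) = (CLINT z|lborel. (\<Prod>b\<in>Basis. ?f b (z \<bullet> b)))"
    by (simp only: eq)
  also have "\<dots> = (CLINT f|(\<Pi>\<^sub>M b\<in>Basis. lborel). (\<Prod>b\<in>Basis. ?f b ((\<Sum>b\<in>Basis. f b *\<^sub>R b) \<bullet> b)))"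
    by (subst lborel_eq, subst integral_distr) auto
  also have "\<dots> = (CLINT f|(\<Pi>\<^sub>M b\<in>Basis. lborel). (\<Prod>b\<in>Basis. ?f b (f b)))"
    by (intro Bochner_Integration.integral_cong refl prod.cong) (simp add: inner_sum_left_Basis)
  also have "\<dots> = (\<Prod>b\<in>Basis. (CLINT t|lborel. ?f b t))"
    by (rule product_integral_prod[OF finite_Basis gauss_fourier_real(1)])
  also have "\<dots> = (\<Prod>b\<in>(Basis :: 'a set). complex_of_real (sqrt (2 * pi) * exp (- (y \<bullet> b)\<^sup>2 / 2)))"
    by (simp only: gauss_fourier_real)
  also have "\<dots> = complex_of_real (sqrt (2 * pi) ^ DIM('a) * (\<Prod>b\<in>(Basis :: 'a set). exp (- (y \<bullet> b)\<^sup>2 / 2)))"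
    by (simp only: of_real_prod[symmetric] prod.distrib prod_constant)
  also have "(\<Prod>b\<in>(Basis :: 'a set). exp (- (y \<bullet> b)\<^sup>2 / 2)) = exp (- (norm y)\<^sup>2 / 2)"
    by (simp add: sq exp_sum[symmetric] sum_negf sum_divide_distrib)
  also have "sqrt (2 * pi) ^ DIM('a) = (2 * pi) powr (real DIM('a) / 2)"
    by (rule sqrt_power_eq_powr) simp
  finally show ?thesis .
qed

lemma gauss_integral: "(LINT z|lborel. exp (- (norm (z::'a::euclidean_space))\<^sup>2 / 2)) = (2 * pi) powr (real DIM('a) / 2)"
proof -
  have "complex_of_real (LINT z|lborel. exp (- (norm (z::'a))\<^sup>2 / 2)) = complex_of_real ((2 * pi) powr (real DIM('a) / 2))"
  proof -
    have "complex_of_real (LINT z|lborel. exp (- (norm (z::'a))\<^sup>2 / 2)) = (CLINT z|lborel. complex_of_real (exp (- (norm (z::'a))\<^sup>2 / 2)))"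
      by (rule integral_complex_of_real[symmetric])
    also have "\<dots> = complex_of_real ((2 * pi) powr (real DIM('a) / 2) * exp (- (norm (0::'a))\<^sup>2 / 2))"
      using gauss_fourier[of "0::'a"] by (simp only: inner_zero_left cis_zero mult_1_left)
    finally show ?thesis by simp
  qed
  then show ?thesis by (simp only: of_real_eq_iff)
qed

lemma gauss_fourier_scaled:
  fixes y :: "'a::euclidean_space"
  assumes s: "s > 0"
  shows "integrable lborel (\<lambda>z::'a. exp (- (s * (norm z)\<^sup>2) / 2))"
   and "(CLINT z|lborel. cis (y \<bullet> z) * complex_of_real (exp (- (s * (norm z)\<^sup>2) / 2))) =
    complex_of_real ((2 * pi / s) powr (real DIM('a) / 2) * exp (- (norm y)\<^sup>2 / (2 * s)))"
proof -
  let ?c = "1 / sqrt s"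
  have c: "?c > 0" "?c\<^sup>2 = 1 / s" using s by (simp_all add: power_divide)
  have e: "s * (norm (?c *\<^sub>R z))\<^sup>2 = (norm z)\<^sup>2" for z :: 'a using s c by (simp add: power_mult_distrib power_divide)
  show "integrable lborel (\<lambda>z::'a. exp (- (s * (norm z)\<^sup>2) / 2))"
  proof -
    let ?f = "\<lambda>z::'a. exp (- (s * (norm z)\<^sup>2) / 2)"
    have "(\<integral>\<^sup>+z. ennreal (?f z) \<partial>lborel) = ennreal (?c ^ DIM('a)) * (\<integral>\<^sup>+z. ennreal (?f (?c *\<^sub>R z)) \<partial>lborel)"
      using c by (intro nn_integral_lborel_scaleR) auto
    also have "(\<integral>\<^sup>+z. ennreal (?f (?c *\<^sub>R z)) \<partial>lborel) = (\<integral>\<^sup>+z. ennreal (exp (- (norm (z::'a))\<^sup>2 / 2)) \<partial>lborel)"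
      by (simp only: e)
    finally have "(\<integral>\<^sup>+z. ennreal (?f z) \<partial>lborel) = ennreal (?c ^ DIM('a)) * (\<integral>\<^sup>+z. ennreal (exp (- (norm (z::'a))\<^sup>2 / 2)) \<partial>lborel)" .
    moreover have "(\<integral>\<^sup>+z. ennreal (exp (- (norm (z::'a))\<^sup>2 / 2)) \<partial>lborel) < \<infinity>"
      using integrable_gauss[where 'a='a] by (simp add: integrable_iff_bounded)
    ultimately have "(\<integral>\<^sup>+z. ennreal (?f z) \<partial>lborel) < \<infinity>" by (simp add: ennreal_mult_less_top)
    then show ?thesis by (simp add: integrable_iff_bounded)
  qed
  have "(CLINT z|lborel. cis (y \<bullet> z) * complex_of_real (exp (- (s * (norm z)\<^sup>2) / 2))) =
    ?c ^ DIM('a) *\<^sub>R (CLINT z|lborel. cis (y \<bullet> (?c *\<^sub>R z)) * complex_of_real (exp (- (s * (norm (?c *\<^sub>R z))\<^sup>2) / 2)))"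
    by (rule integral_lborel_scaleR) (use c in measurable)
  also have "\<dots> = ?c ^ DIM('a) *\<^sub>R (CLINT z|lborel. cis ((?c *\<^sub>R y) \<bullet> z) * complex_of_real (exp (- (norm z)\<^sup>2 / 2)))"
    unfolding e by simp
  also have "\<dots> = complex_of_real (?c ^ DIM('a) * ((2 * pi) powr (real DIM('a) / 2) * exp (- (norm (?c *\<^sub>R y))\<^sup>2 / 2)))"
    by (simp only: gauss_fourier scaleR_conv_of_real of_real_mult)
  also have "?c ^ DIM('a) = (1 / s) powr (real DIM('a) / 2)"
    using s by (simp add: power_divide sqrt_power_eq_powr powr_divide)
  also have "(1 / s) powr (real DIM('a) / 2) * ((2 * pi) powr (real DIM('a) / 2) * exp (- (norm (?c *\<^sub>R y))\<^sup>2 / 2)) =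
     (2 * pi / s) powr (real DIM('a) / 2) * exp (- (norm y)\<^sup>2 / (2 * s))"
    using s c by (simp add: powr_divide power_mult_distrib power_divide)
  finally show "(CLINT z|lborel. cis (y \<bullet> z) * complex_of_real (exp (- (s * (norm z)\<^sup>2) / 2))) =
    complex_of_real ((2 * pi / s) powr (real DIM('a) / 2) * exp (- (norm y)\<^sup>2 / (2 * s)))" .
qed

section \<open>Inversion for a probability measure with integrable characteristic function\<close>

locale integrable_char = prob_space \<mu> for \<mu> :: "'a::euclidean_space measure" +
  assumes sets_mu [simp, measurable_cong]: "sets \<mu> = sets borel"
    and char_integrable: "integrable lborel (char_fun \<mu>)"
begin

lemma space_mu [simp]: "space \<mu> = UNIV"
  using sets_eq_imp_space_eq[OF sets_mu] by simp

lemma prob_UNIV [simp]: "prob UNIV = 1"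
  using prob_space by simp

lemma char_measurable [measurable]: "char_fun \<mu> \<in> borel_measurable borel"
  using borel_measurable_integrable[OF char_integrable] by simp

text \<open>The density of \<mu> convolved with a centred Gaussian of variance s; the two powers
  combine to its normalization (2 pi s)^(- d / 2) and are kept apart to match
  \<open>gauss_fourier_scaled\<close>.\<close>

definition smooth_density :: "real \<Rightarrow> 'a \<Rightarrow> real" where
  "smooth_density s x = (2 * pi) powr (- real DIM('a)) * ((2 * pi / s) powr (real DIM('a) / 2) *
     (LINT y|\<mu>. exp (- (norm (y - x))\<^sup>2 / (2 * s))))"

lemma smooth_density_fourier:
  assumes s: "s > 0"
  shows "complex_of_real ((2 * pi) powr (- real DIM('a))) *
    (CLINT z|lborel. cis (- (x \<bullet> z)) * char_fun \<mu> z * complex_of_real (exp (- (s * (norm z)\<^sup>2) / 2))) =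
    complex_of_real (smooth_density s x)"
proof -
  interpret pair_sigma_finite lborel \<mu> ..
  let ?G = "\<lambda>z::'a. complex_of_real (exp (- (s * (norm z)\<^sup>2) / 2))"
  let ?K = "(2 * pi / s) powr (real DIM('a) / 2)"
  have int: "integrable (lborel \<Otimes>\<^sub>M \<mu>) (\<lambda>(z, y). cis ((y - x) \<bullet> z) * ?G z)"
  proof (rule Fubini_integrable)
    show "integrable lborel (\<lambda>z. LINT y|\<mu>. norm (case (z, y) of (z, y) \<Rightarrow> cis ((y - x) \<bullet> z) * ?G z))"
      using gauss_fourier_scaled(1)[OF s] by (simp add: norm_mult prob_space)
    show "AE z in lborel. integrable \<mu> (\<lambda>y. case (z, y) of (z, y) \<Rightarrow> cis ((y - x) \<bullet> z) * ?G z)"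
      using s by (intro AE_I2 integrable_const_bound[of _ 1]) (auto simp: norm_mult)
  qed measurable
  have "(CLINT z|lborel. cis (- (x \<bullet> z)) * char_fun \<mu> z * ?G z) = (CLINT z|lborel. CLINT y|\<mu>. cis ((y - x) \<bullet> z) * ?G z)"
  proof (intro Bochner_Integration.integral_cong refl)
    fix z
    have "cis (- (x \<bullet> z)) * char_fun \<mu> z * ?G z = (CLINT y|\<mu>. cis (- (x \<bullet> z)) * cis (y \<bullet> z) * ?G z)"
      unfolding char_fun_def by simp
    then show "cis (- (x \<bullet> z)) * char_fun \<mu> z * ?G z = (CLINT y|\<mu>. cis ((y - x) \<bullet> z) * ?G z)"
      by (simp add: cis_mult inner_diff_left)
  qed
  also have "\<dots> = (CLINT y|\<mu>. CLINT z|lborel. cis ((y - x) \<bullet> z) * ?G z)"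
    by (rule Fubini_integral[OF int, symmetric])
  also have "\<dots> = (CLINT y|\<mu>. complex_of_real (?K * exp (- (norm (y - x))\<^sup>2 / (2 * s))))"
    by (simp only: gauss_fourier_scaled[OF s])
  also have "\<dots> = complex_of_real (LINT y|\<mu>. ?K * exp (- (norm (y - x))\<^sup>2 / (2 * s)))" by (rule integral_complex_of_real)
  finally show ?thesis unfolding smooth_density_def by simp
qed

definition scale_seq :: "nat \<Rightarrow> real" where "scale_seq n = 1 / real (Suc n)"

lemma scale_seq: "scale_seq n > 0" "scale_seq \<longlonglongrightarrow> 0"
  using LIMSEQ_Suc[OF lim_1_over_n[where 'a=real]] by (auto simp: scale_seq_def[abs_def])

lemma smooth_density_limit: "(\<lambda>n. complex_of_real (smooth_density (scale_seq n) x)) \<longlonglongrightarrow> inv_fourier_density \<mu> x"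
  unfolding inv_fourier_density_def smooth_density_fourier[OF scale_seq(1), symmetric]
proof (rule tendsto_mult[OF tendsto_const])
  show "(\<lambda>n. CLINT z|lborel. cis (- (x \<bullet> z)) * char_fun \<mu> z * complex_of_real (exp (- (scale_seq n * (norm z)\<^sup>2) / 2))) \<longlonglongrightarrow>
    (CLINT z|lborel. cis (- (x \<bullet> z)) * char_fun \<mu> z)"
  proof (rule integral_dominated_convergence[where w="\<lambda>z. norm (char_fun \<mu> z)"])
    show "AE z in lborel. (\<lambda>n. cis (- (x \<bullet> z)) * char_fun \<mu> z * complex_of_real (exp (- (scale_seq n * (norm z)\<^sup>2) / 2))) \<longlonglongrightarrow> cis (- (x \<bullet> z)) * char_fun \<mu> z"
    proof (intro AE_I2)
      fix z
      have "(\<lambda>n. cis (- (x \<bullet> z)) * char_fun \<mu> z * complex_of_real (exp (- (scale_seq n * (norm z)\<^sup>2) / 2))) \<longlonglongrightarrow>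
         cis (- (x \<bullet> z)) * char_fun \<mu> z * complex_of_real (exp (- (0 * (norm z)\<^sup>2) / 2))"
        by (intro tendsto_intros scale_seq) auto
      then show "(\<lambda>n. cis (- (x \<bullet> z)) * char_fun \<mu> z * complex_of_real (exp (- (scale_seq n * (norm z)\<^sup>2) / 2))) \<longlonglongrightarrow> cis (- (x \<bullet> z)) * char_fun \<mu> z"
        by simp
    qed
    show "AE z in lborel. norm (cis (- (x \<bullet> z)) * char_fun \<mu> z * complex_of_real (exp (- (scale_seq n * (norm z)\<^sup>2) / 2))) \<le> norm (char_fun \<mu> z)" for n
      using scale_seq(1)[of n] by (intro AE_I2) (auto simp: norm_mult mult_left_le)
  qed (use char_integrable in auto)
qed

lemma Re_density_limit: "(\<lambda>n. smooth_density (scale_seq n) x) \<longlonglongrightarrow> Re (inv_fourier_density \<mu> x)"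
  using tendsto_Re[OF smooth_density_limit[of x]] by simp

lemma smooth_density_nonneg: "smooth_density s x \<ge> 0"
  unfolding smooth_density_def by (auto intro!: mult_nonneg_nonneg integral_nonneg)

lemma Re_density_nonneg: "Re (inv_fourier_density \<mu> x) \<ge> 0"
  by (rule LIMSEQ_le_const[OF Re_density_limit]) (auto intro: smooth_density_nonneg)

lemma smooth_density_bound:
  assumes "s > 0" shows "smooth_density s x \<le> (2 * pi) powr (- real DIM('a)) * (LINT z|lborel. norm (char_fun \<mu> z))"
proof -
  have "smooth_density s x = norm (complex_of_real (smooth_density s x))" by (simp add: smooth_density_nonneg)
  also have "\<dots> = (2 * pi) powr (- real DIM('a)) * norm (CLINT z|lborel. cis (- (x \<bullet> z)) * char_fun \<mu> z * complex_of_real (exp (- (s * (norm z)\<^sup>2) / 2)))"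
    unfolding smooth_density_fourier[OF assms, symmetric] by (simp add: norm_mult)
  also have "norm (CLINT z|lborel. cis (- (x \<bullet> z)) * char_fun \<mu> z * complex_of_real (exp (- (s * (norm z)\<^sup>2) / 2))) \<le> (LINT z|lborel. norm (char_fun \<mu> z))"
  proof -
    have b: "norm (cis (- (x \<bullet> z)) * char_fun \<mu> z * complex_of_real (exp (- (s * (norm z)\<^sup>2) / 2))) \<le> norm (char_fun \<mu> z)" for z
      using assms by (auto simp: norm_mult mult_left_le)
    have "integrable lborel (\<lambda>z. cis (- (x \<bullet> z)) * char_fun \<mu> z * complex_of_real (exp (- (s * (norm z)\<^sup>2) / 2)))"
      by (rule Bochner_Integration.integrable_bound[OF char_integrable]) (use b in auto)
    then show ?thesis using char_integrable b by (intro order_trans[OF integral_norm_bound] integral_mono) auto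
  qed
  finally show ?thesis by simp
qed

text \<open>Both sides are limits of the integral of \<open>f\<close> against the smoothed density.
  One limit is taken under the integral, with the uniform bound \<open>smooth_density_bound\<close>;
  for the other, Fubini moves the Gaussian onto \<open>f\<close>, and continuity of \<open>f\<close>
  lets the smoothing disappear.\<close>

lemma density_test:
  fixes f :: "'a \<Rightarrow> real"
  assumes cont: "continuous_on UNIV f" and f01: "\<And>x. 0 \<le> f x" "\<And>x. f x \<le> 1" and int: "integrable lborel f"
  shows "integrable lborel (\<lambda>x. f x * Re (inv_fourier_density \<mu> x))"
    "(LINT x|lborel. f x * Re (inv_fourier_density \<mu> x)) = (LINT x|\<mu>. f x)"
proof -
  have [measurable]: "f \<in> borel_measurable borel" by (rule borel_measurable_continuous_onI[OF cont])
  let ?C = "(2 * pi) powr (- real DIM('a)) * (LINT z|lborel. norm (char_fun \<mu> z))"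
  have [measurable]: "smooth_density s \<in> borel_measurable borel" for s
    unfolding smooth_density_def[abs_def] by measurable
  have [measurable]: "inv_fourier_density \<mu> \<in> borel_measurable borel"
    unfolding inv_fourier_density_def[abs_def] by measurable
  have dc: "AE x in lborel. (\<lambda>n. f x * smooth_density (scale_seq n) x) \<longlonglongrightarrow> f x * Re (inv_fourier_density \<mu> x)"
    by (intro AE_I2 tendsto_mult tendsto_const Re_density_limit)
  have bd: "AE x in lborel. norm (f x * smooth_density (scale_seq n) x) \<le> f x * ?C" for n
    using f01(1) smooth_density_bound[OF scale_seq(1)] smooth_density_nonneg by (intro AE_I2) (auto simp: abs_mult intro!: mult_left_mono)
  have iC: "integrable lborel (\<lambda>x. f x * ?C)" using int by simp
  show "integrable lborel (\<lambda>x. f x * Re (inv_fourier_density \<mu> x))"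
    by (rule integrable_dominated_convergence[OF _ _ iC dc bd]) measurable
  have lim1: "(\<lambda>n. LINT x|lborel. f x * smooth_density (scale_seq n) x) \<longlonglongrightarrow> (LINT x|lborel. f x * Re (inv_fourier_density \<mu> x))"
    by (rule integral_dominated_convergence[OF _ _ iC dc bd]) measurable
  let ?G = "\<lambda>w::'a. exp (- (norm w)\<^sup>2 / 2)"
  let ?I = "\<lambda>n y. (LINT w|lborel. f (y + sqrt (scale_seq n) *\<^sub>R w) * ?G w)"
  have eq: "(LINT x|lborel. f x * smooth_density s x) = (2 * pi) powr (- real DIM('a) / 2) * (LINT y|\<mu>. LINT w|lborel. f (y + sqrt s *\<^sub>R w) * ?G w)"
    if s: "s > 0" for s
  proof -
    interpret pair_sigma_finite lborel \<mu> ..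
    let ?E = "\<lambda>x y. exp (- (norm (y - x))\<^sup>2 / (2 * s))"
    let ?c = "(2 * pi) powr (- real DIM('a)) * (2 * pi / s) powr (real DIM('a) / 2)"
    have ii: "integrable (lborel \<Otimes>\<^sub>M \<mu>) (\<lambda>(x, y). f x * ?E x y)"
    proof (rule Fubini_integrable)
      show "integrable lborel (\<lambda>x. LINT y|\<mu>. norm (case (x, y) of (x, y) \<Rightarrow> f x * ?E x y))"
      proof (rule Bochner_Integration.integrable_bound[OF int])
        have le: "(LINT y|\<mu>. ?E x y) \<le> 1" for x
        proof -
          have "(LINT y|\<mu>. ?E x y) \<le> (LINT y|\<mu>. 1)"
            using s by (intro integral_mono integrable_const_bound[of _ 1]) auto
          then show ?thesis by (simp add: prob_space)
        qed
        have "norm (LINT y|\<mu>. norm (f x * ?E x y)) \<le> norm (f x)" for x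
          using f01(1)[of x] le[of x] by (simp add: abs_mult mult_left_le integral_nonneg)
        then show "AE x in lborel. norm (LINT y|\<mu>. norm (case (x, y) of (x, y) \<Rightarrow> f x * ?E x y)) \<le> norm (f x)" by simp
      qed measurable
      show "AE x in lborel. integrable \<mu> (\<lambda>y. case (x, y) of (x, y) \<Rightarrow> f x * ?E x y)"
        using s by (intro AE_I2) (auto intro!: integrable_const_bound[of _ 1])
    qed measurable
    have "(LINT x|lborel. f x * smooth_density s x) = (LINT x|lborel. ?c * (LINT y|\<mu>. f x * ?E x y))"
      by (intro Bochner_Integration.integral_cong refl) (simp add: smooth_density_def mult_ac)
    also have "\<dots> = ?c * (LINT x|lborel. LINT y|\<mu>. f x * ?E x y)" by simp
    also have "(LINT x|lborel. LINT y|\<mu>. f x * ?E x y) = (LINT y|\<mu>. LINT x|lborel. f x * ?E x y)"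
      by (rule Fubini_integral[OF ii, symmetric])
    also have "\<dots> = (LINT y|\<mu>. sqrt s ^ DIM('a) * (LINT w|lborel. f (y + sqrt s *\<^sub>R w) * ?G w))"
    proof (intro Bochner_Integration.integral_cong refl)
      fix y
      have "(LINT x|lborel. f x * ?E x y) = (LINT x|lborel. f (x + y) * ?E (x + y) y)"
        by (rule integral_lborel_translate(1)[symmetric]) measurable
      also have "\<dots> = (LINT x|lborel. f (x + y) * exp (- (norm x)\<^sup>2 / (2 * s)))" by simp
      also have "\<dots> = sqrt s ^ DIM('a) *\<^sub>R (LINT w|lborel. f (sqrt s *\<^sub>R w + y) * exp (- (norm (sqrt s *\<^sub>R w))\<^sup>2 / (2 * s)))"
        using s by (intro integral_lborel_scaleR) auto
      finally show "(LINT x|lborel. f x * ?E x y) = sqrt s ^ DIM('a) * (LINT w|lborel. f (y + sqrt s *\<^sub>R w) * ?G w)"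
        using s by (simp add: power_mult_distrib add.commute)
    qed
    also have "?c * \<dots> = (?c * sqrt s ^ DIM('a)) * (LINT y|\<mu>. LINT w|lborel. f (y + sqrt s *\<^sub>R w) * ?G w)" by simp
    also have "?c * sqrt s ^ DIM('a) = (2 * pi) powr (- real DIM('a) / 2)"
    proof -
      have "sqrt s ^ DIM('a) = s powr (real DIM('a) / 2)"
        by (rule sqrt_power_eq_powr[OF s])
      moreover have "(2 * pi) powr (- real DIM('a)) * (2 * pi) powr (real DIM('a) / 2) = (2 * pi) powr (- real DIM('a) / 2)"
        by (simp add: powr_add[symmetric])
      ultimately show ?thesis using s by (simp add: powr_divide)
    qed
    finally show ?thesis .
  qed
  have Ibd: "norm (f (y + sqrt (scale_seq n) *\<^sub>R w) * ?G w) \<le> ?G w" for n y w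
    using f01 by (simp add: abs_mult mult_left_le_one_le)
  have lim2: "(\<lambda>n. LINT y|\<mu>. ?I n y) \<longlonglongrightarrow> (LINT y|\<mu>. f y * (2 * pi) powr (real DIM('a) / 2))"
  proof (rule integral_dominated_convergence[where w="\<lambda>_. (2 * pi) powr (real DIM('a) / 2)"])
    show "AE y in \<mu>. (\<lambda>n. ?I n y) \<longlonglongrightarrow> f y * (2 * pi) powr (real DIM('a) / 2)"
    proof (intro AE_I2)
      fix y
      have "(\<lambda>n. ?I n y) \<longlonglongrightarrow> (LINT w|lborel. f y * ?G w)"
      proof (rule integral_dominated_convergence[OF _ _ integrable_gauss])
        show "AE w in lborel. (\<lambda>n. f (y + sqrt (scale_seq n) *\<^sub>R w) * ?G w) \<longlonglongrightarrow> f y * ?G w"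
        proof (intro AE_I2 tendsto_mult tendsto_const)
          fix w
          have "(\<lambda>n. y + sqrt (scale_seq n) *\<^sub>R w) \<longlonglongrightarrow> y + sqrt 0 *\<^sub>R w" by (intro tendsto_intros scale_seq)
          then show "(\<lambda>n. f (y + sqrt (scale_seq n) *\<^sub>R w)) \<longlonglongrightarrow> f y"
            using cont continuous_on_tendsto_compose[of UNIV f] by auto
        qed
        show "AE w in lborel. norm (f (y + sqrt (scale_seq n) *\<^sub>R w) * ?G w) \<le> ?G w" for n using Ibd by (intro AE_I2)
      qed measurable
      then show "(\<lambda>n. ?I n y) \<longlonglongrightarrow> f y * (2 * pi) powr (real DIM('a) / 2)" by (simp only: integral_mult_right_zero gauss_integral)
    qed
    show "AE y in \<mu>. norm (?I n y) \<le> (2 * pi) powr (real DIM('a) / 2)" for n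
    proof (intro AE_I2)
      fix y
      have i: "integrable lborel (\<lambda>w. f (y + sqrt (scale_seq n) *\<^sub>R w) * ?G w)"
        by (rule Bochner_Integration.integrable_bound[OF integrable_gauss]) (use Ibd in auto)
      have "norm (?I n y) \<le> (LINT w|lborel. norm (f (y + sqrt (scale_seq n) *\<^sub>R w) * ?G w))" by (rule integral_norm_bound)
      also have "\<dots> \<le> (LINT w|lborel. ?G w)"
        by (rule integral_mono[OF integrable_norm[OF i] integrable_gauss Ibd])
      finally show "norm (?I n y) \<le> (2 * pi) powr (real DIM('a) / 2)" by (simp only: gauss_integral)
    qed
  qed (auto simp: integrable_const)
  have "(\<lambda>n. (2 * pi) powr (- real DIM('a) / 2) * (LINT y|\<mu>. ?I n y)) \<longlonglongrightarrow> (2 * pi) powr (- real DIM('a) / 2) * (LINT y|\<mu>. f y * (2 * pi) powr (real DIM('a) / 2))"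
    by (intro tendsto_intros lim2)
  moreover have "(2 * pi) powr (- real DIM('a) / 2) * (LINT y|\<mu>. f y * (2 * pi) powr (real DIM('a) / 2)) = (LINT y|\<mu>. f y)"
    by (simp add: mult.left_commute powr_add[symmetric])
  ultimately have "(\<lambda>n. LINT x|lborel. f x * smooth_density (scale_seq n) x) \<longlonglongrightarrow> (LINT y|\<mu>. f y)"
    by (simp only: eq[OF scale_seq(1)])
  with lim1 show "(LINT x|lborel. f x * Re (inv_fourier_density \<mu> x)) = (LINT x|\<mu>. f x)" by (rule LIMSEQ_unique)
qed

text \<open>Boxes generate the Borel sets and are stable under intersection. The indicator of a box
  is an increasing limit of continuous functions, the truncated multiples of the distance to its
  complement, to which \<open>density_test\<close> applies.\<close>

lemma mu_eq_density: "\<mu> = density lborel (\<lambda>x. ennreal (Re (inv_fourier_density \<mu> x)))"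
proof (rule measure_eqI_generator_eq)
  let ?g = "\<lambda>x. Re (inv_fourier_density \<mu> x)"
  have [measurable]: "inv_fourier_density \<mu> \<in> borel_measurable borel"
    unfolding inv_fourier_density_def[abs_def] by measurable
  let ?E = "range (\<lambda>(a, b). box a b :: 'a set)"
  show "Int_stable ?E" by (auto simp: Int_stable_def box_Int_box)
  show "?E \<subseteq> Pow UNIV" "sets \<mu> = sigma_sets UNIV ?E" "sets (density lborel (\<lambda>x. ennreal (?g x))) = sigma_sets UNIV ?E"
    by (simp_all add: borel_eq_box)
  let ?A = "\<lambda>n::nat. box (- (real n *\<^sub>R One)) (real n *\<^sub>R One) :: 'a set"
  show "range ?A \<subseteq> ?E" "(\<Union>i. ?A i) = UNIV" unfolding UN_box_eq_UNIV by auto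
  show "emeasure \<mu> (?A i) \<noteq> \<infinity>" for i by simp
  fix X assume "X \<in> ?E"
  then obtain a b where X: "X = box a b" by auto
  define f where "f k x = min 1 (real k * infdist x (- X))" for k :: nat and x
  \<comment> \<open>\<open>infdist\<close> to the empty set is 0 by convention, so the complement
    has to be seen to be nonempty before the distance is positive inside the box.\<close>
  have ne: "- X \<noteq> {}" unfolding X using bounded_box not_bounded_UNIV by (metis Compl_empty_eq double_compl)
  have cl: "closed (- X)" unfolding X by (simp add: closed_Compl open_box)
  have fc: "continuous_on UNIV (f k)" for k unfolding f_def by (intro continuous_intros)
  have f01: "0 \<le> f k x" "f k x \<le> 1" for k x by (auto simp: f_def infdist_nonneg)
  have f0: "f k x = 0" if "x \<notin> X" for k x using that by (simp add: f_def)
  have fi: "integrable lborel (f k)" for k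
  proof (rule Bochner_Integration.integrable_bound)
    show "integrable lborel (indicator X :: 'a \<Rightarrow> real)" unfolding X
      using emeasure_bounded_finite[OF bounded_box[of a b]] by (intro integrable_real_indicator) auto
    show "AE x in lborel. norm (f k x) \<le> norm (indicator X x :: real)"
      using f01 f0 by (intro AE_I2) (auto simp: indicator_def)
  qed (use fc in \<open>auto intro: borel_measurable_continuous_onI\<close>)
  have [measurable]: "f k \<in> borel_measurable borel" for k using fc by (auto intro: borel_measurable_continuous_onI)
  have mono: "incseq (\<lambda>k x. ennreal (f k x))"
  proof (intro incseq_SucI le_funI ennreal_leI)
    fix k x
    have "real k * infdist x (- X) \<le> real (Suc k) * infdist x (- X)"
      by (intro mult_right_mono) (auto simp: infdist_nonneg)
    then show "f k x \<le> f (Suc k) x" unfolding f_def by (rule min.mono[OF order_refl])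
  qed
  have sup: "(SUP k. ennreal (f k x)) = indicator X x" for x
  proof (cases "x \<in> X")
    case False
    then show ?thesis by (simp add: f0)
  next
    case True
    have "infdist x (- X) > 0" using in_closed_iff_infdist_zero[OF cl ne, of x] True infdist_nonneg[of x "- X"] by auto
    then obtain k :: nat where "1 < real k * infdist x (- X)" using reals_Archimedean3[of "infdist x (- X)"] by auto
    then have "f k x = 1" by (simp add: f_def)
    then have "1 \<le> (SUP k. ennreal (f k x))" using SUP_upper[of k UNIV "\<lambda>k. ennreal (f k x)"] by simp
    moreover have "(SUP k. ennreal (f k x)) \<le> 1" by (intro SUP_least) (use f01 in simp)
    ultimately have "(SUP k. ennreal (f k x)) = 1" by (intro antisym)
    then show ?thesis using True by simp
  qed
  have step: "(\<integral>\<^sup>+x. ennreal (f k x) \<partial>\<mu>) = (\<integral>\<^sup>+x. ennreal (f k x) \<partial>density lborel (\<lambda>x. ennreal (?g x)))" for k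
  proof -
    have "(\<integral>\<^sup>+x. ennreal (f k x) \<partial>\<mu>) = ennreal (LINT x|\<mu>. f k x)"
      using f01 by (intro nn_integral_eq_integral integrable_const_bound[of _ 1]) auto
    also have "\<dots> = ennreal (LINT x|lborel. f k x * ?g x)" using density_test(2)[OF fc f01 fi] by simp
    also have "\<dots> = (\<integral>\<^sup>+x. ennreal (f k x * ?g x) \<partial>lborel)"
      using density_test(1)[OF fc f01 fi] f01 Re_density_nonneg by (intro nn_integral_eq_integral[symmetric]) auto
    also have "\<dots> = (\<integral>\<^sup>+x. ennreal (?g x) * ennreal (f k x) \<partial>lborel)"
      using f01 Re_density_nonneg by (simp add: ennreal_mult mult.commute)
    also have "\<dots> = (\<integral>\<^sup>+x. ennreal (f k x) \<partial>density lborel (\<lambda>x. ennreal (?g x)))"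
      by (subst nn_integral_density) auto
    finally show ?thesis .
  qed
  have em: "emeasure M X = (SUP k. \<integral>\<^sup>+x. ennreal (f k x) \<partial>M)" if [measurable_cong]: "sets M = sets borel" for M :: "'a measure"
  proof -
    have "emeasure M X = (\<integral>\<^sup>+x. indicator X x \<partial>M)" unfolding X using that by simp
    also have "\<dots> = (\<integral>\<^sup>+x. (SUP k. ennreal (f k x)) \<partial>M)" by (simp only: sup)
    also have "\<dots> = (SUP k. \<integral>\<^sup>+x. ennreal (f k x) \<partial>M)"
      by (intro nn_integral_monotone_convergence_SUP mono) measurable
    finally show ?thesis .
  qed
  show "emeasure \<mu> X = emeasure (density lborel (\<lambda>x. ennreal (?g x))) X"
    using em[OF sets_mu] em[of "density lborel (\<lambda>x. ennreal (?g x))"] step by simp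
qed

end


section \<open>Estimates and constants\<close>

text \<open>The threshold R is where D r^\<alpha> equals r / 2. Beyond it the linear term dominates
  because \<alpha> < 1; below it the power is at most its value at R. This is where \<alpha> < 1
  enters the convergence of the series.\<close>

lemma power_le_linear:
  fixes D \<alpha> r :: real
  assumes D: "D > 0" and a: "0 < \<alpha>" "\<alpha> < 1" and r: "r > 0"
  shows "D * r powr \<alpha> \<le> r / 2 + D * ((2 * D) powr (1 / (1 - \<alpha>))) powr \<alpha>"
proof -
  define R where "R = (2 * D) powr (1 / (1 - \<alpha>))"
  have R: "R > 0" using D by (simp add: R_def)
  show ?thesis
  proof (cases "r \<ge> R")
    case True
    have "r powr \<alpha> = r * r powr (\<alpha> - 1)" using r by (simp add: powr_diff)
    also have "r powr (\<alpha> - 1) \<le> R powr (\<alpha> - 1)" using True R a by (intro powr_mono2') auto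
    also have "R powr (\<alpha> - 1) = (2 * D) powr (- 1)"
    proof -
      have "1 / (1 - \<alpha>) * (\<alpha> - 1) = - 1" using a by (simp add: field_simps)
      then show ?thesis unfolding R_def powr_powr by (simp only:)
    qed
    also have "\<dots> = 1 / (2 * D)" using D by (simp add: powr_minus_divide)
    finally have "r powr \<alpha> \<le> r * (1 / (2 * D))" using r by simp
    then have "D * r powr \<alpha> \<le> D * (r * (1 / (2 * D)))" using D by (intro mult_left_mono) auto
    also have "\<dots> = r / 2" using D by simp
    finally show ?thesis using D by (simp add: add_increasing2)
  next
    case False
    then have "r powr \<alpha> \<le> R powr \<alpha>" using r a by (intro powr_mono2) auto
    then have "D * r powr \<alpha> \<le> D * R powr \<alpha>" using D by simp
    then show ?thesis using r unfolding R_def by linarith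
  qed
qed

lemma sum_exp_le:
  fixes y :: real assumes "y \<ge> 0" shows "(\<Sum>k<n. y ^ k / fact k) \<le> exp y"
proof -
  have "(\<Sum>k<n. y ^ k / fact k) \<le> (\<Sum>k. y ^ k / fact k)"
    using assms summable_exp[of y] by (intro sum_le_suminf) (auto simp: field_simps)
  also have "\<dots> = exp y" by (simp add: exp_def scaleR_conv_of_real field_simps)
  finally show ?thesis .
qed

text \<open>The partial sums are dominated by \<open>\<integral> r\<^bsup>c-1\<^esup> e\<^bsup>-r\<^esup> exp (D r\<^sup>\<alpha>) dr\<close>.\<close>

lemma summable_Gamma_power:
  fixes D \<alpha> c :: real
  assumes D: "D > 0" and a: "0 < \<alpha>" "\<alpha> < 1" and c: "c > 0"
  shows "summable (\<lambda>k. D ^ k * Gamma (c + real k * \<alpha>) / fact k)"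
proof -
  define C where "C = D * ((2 * D) powr (1 / (1 - \<alpha>))) powr \<alpha>"
  have ap: "c + real k * \<alpha> > 0" for k using c a by (simp add: add_pos_nonneg)
  have G: "Gamma (c + real k * \<alpha>) = (LINT r|lborel. gamma_kernel (c + real k * \<alpha>) 1 r)" for k
    using integral_gamma_kernel[OF ap[of k], of 1] by simp
  have pw: "D ^ k * gamma_kernel (c + real k * \<alpha>) 1 r / fact k = gamma_kernel c 1 r * ((D * r powr \<alpha>) ^ k / fact k)" for k r
  proof (cases "r > 0")
    case True
    have "r powr (c + real k * \<alpha> - 1) = r powr (c - 1) * (r powr \<alpha>) ^ k"
    proof -
      have "r powr (c + real k * \<alpha> - 1) = r powr ((c - 1) + \<alpha> * real k)" by (simp add: algebra_simps)
      also have "\<dots> = r powr (c - 1) * (r powr \<alpha>) powr real k" by (simp only: powr_add powr_powr)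
      finally show ?thesis using True by (simp add: powr_realpow)
    qed
    then show ?thesis by (simp add: gamma_kernel_def power_mult_distrib)
  qed (simp add: gamma_kernel_def)
  show ?thesis
  proof (rule summableI_nonneg_bounded)
    show "0 \<le> D ^ k * Gamma (c + real k * \<alpha>) / fact k" for k
      using D Gamma_real_pos[OF ap[of k]] by simp
    fix n
    have int: "integrable lborel (\<lambda>r. D ^ k * gamma_kernel (c + real k * \<alpha>) 1 r / fact k)" for k
      using integrable_gamma_kernel[OF ap[of k], of 1] by simp
    have "(\<Sum>k<n. D ^ k * Gamma (c + real k * \<alpha>) / fact k) = (\<Sum>k<n. (LINT r|lborel. D ^ k * gamma_kernel (c + real k * \<alpha>) 1 r / fact k))"
      by (simp add: G)
    also have "\<dots> = (LINT r|lborel. (\<Sum>k<n. D ^ k * gamma_kernel (c + real k * \<alpha>) 1 r / fact k))"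
      by (rule Bochner_Integration.integral_sum[symmetric]) (rule int)
    also have "\<dots> \<le> (LINT r|lborel. exp C * gamma_kernel c (1/2) r)"
    proof (rule integral_mono)
      show "integrable lborel (\<lambda>r. (\<Sum>k<n. D ^ k * gamma_kernel (c + real k * \<alpha>) 1 r / fact k))"
        by (intro Bochner_Integration.integrable_sum int)
      show "integrable lborel (\<lambda>r. exp C * gamma_kernel c (1/2) r)"
        by (intro integrable_mult_right integrable_gamma_kernel c) simp
      fix r :: real
      show "(\<Sum>k<n. D ^ k * gamma_kernel (c + real k * \<alpha>) 1 r / fact k) \<le> exp C * gamma_kernel c (1/2) r"
      proof (cases "r > 0")
        case True
        have "(\<Sum>k<n. D ^ k * gamma_kernel (c + real k * \<alpha>) 1 r / fact k) = gamma_kernel c 1 r * (\<Sum>k<n. (D * r powr \<alpha>) ^ k / fact k)"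
          by (simp only: pw sum_distrib_left)
        also have "\<dots> \<le> gamma_kernel c 1 r * exp (D * r powr \<alpha>)"
          using D by (intro mult_left_mono sum_exp_le) (auto simp: gamma_kernel_def)
        \<comment> \<open>Half of the decay e^(- r) is spent on the growth of the exponential
          series; the rate 1 / 2 that remains still gives an integrable kernel.\<close>
        also have "\<dots> \<le> gamma_kernel c 1 r * exp (r / 2 + C)"
          using power_le_linear[OF D a True] unfolding C_def by (intro mult_left_mono) (auto simp: gamma_kernel_def)
        also have "\<dots> = exp C * gamma_kernel c (1/2) r"
        proof -
          have "exp (- r) * exp (r / 2 + C) = exp C * exp (- (r / 2))" by (simp flip: exp_add)
          then show ?thesis using True by (simp add: gamma_kernel_def)
        qed
        finally show ?thesis .
      qed (simp add: gamma_kernel_def)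
    qed
    finally show "(\<Sum>k<n. D ^ k * Gamma (c + real k * \<alpha>) / fact k) \<le> (LINT r|lborel. exp C * gamma_kernel c (1/2) r)" .
  qed
qed

lemma pochhammer_nat_fact: "pochhammer (real (Suc m)) j * fact m = fact (m + j)"
proof (induction j)
  case (Suc j)
  have "pochhammer (real (Suc m)) (Suc j) * fact m = (pochhammer (real (Suc m)) j * fact m) * (real (Suc m) + real j)"
    by (simp add: pochhammer_Suc mult_ac)
  also have "\<dots> = fact (m + j) * (real (Suc m) + real j)" by (simp only: Suc)
  also have "\<dots> = fact (m + Suc j)" by (simp add: algebra_simps)
  finally show ?case .
qed simp

text \<open>The rising factorial is monotone in its base, and at an integer it is j! times a
  binomial coefficient. It measures \<Gamma>(y + j) / \<Gamma>(y), and the j! is made to cancel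
  against the 1 / j! in \<open>sphere_fourier_const_le\<close>.\<close>

lemma pochhammer_le_power:
  fixes y :: real assumes "0 \<le> y" "y \<le> real m" shows "pochhammer y j \<le> 2 ^ (m + j) * fact j"
proof -
  have "pochhammer y j \<le> pochhammer (real (Suc m)) j"
    unfolding pochhammer_prod using assms by (intro prod_mono) auto
  also have "\<dots> = real (m + j choose j) * fact j"
  proof -
    have "fact j * fact m * (m + j choose j) = fact (m + j)" using binomial_fact_lemma[of j "m + j"] by simp
    then have "fact j * fact m * real (m + j choose j) = fact (m + j)" by (metis of_nat_fact of_nat_mult)
    then have "pochhammer (real (Suc m)) j * fact m = (real (m + j choose j) * fact j) * fact m"
      unfolding pochhammer_nat_fact by (simp add: mult_ac)
    then show ?thesis by simp
  qed
  also have "\<dots> \<le> 2 ^ (m + j) * fact j"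
  proof -
    have "m + j choose j \<le> 2 ^ (m + j)" by (rule binomial_le_pow2)
    then have "real (m + j choose j) \<le> real (2 ^ (m + j))" by (rule of_nat_mono)
    then show ?thesis by (intro mult_right_mono) auto
  qed
  finally show ?thesis .
qed

text \<open>Log-convexity between b and b + 1 gives the factor sqrt b, which is then replaced by the
  coarser b + 1.\<close>

lemma Gamma_half_shift_le:
  fixes b :: real assumes b: "b > 0" shows "Gamma (b + 1 / 2) \<le> (b + 1) * Gamma b"
proof -
  have G: "Gamma b > 0" using b by simp
  have "(ln \<circ> Gamma) ((1 - 1/2) *\<^sub>R b + (1/2) *\<^sub>R (b + 1)) \<le> (1 - 1/2) * (ln \<circ> Gamma) b + (1/2) * (ln \<circ> Gamma) (b + 1)"
    by (rule convex_onD[OF log_convex_Gamma_real]) (use b in auto)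
  moreover have "(1 - 1/2) *\<^sub>R b + (1/2) *\<^sub>R (b + 1) = b + 1 / 2" by (simp add: field_simps)
  moreover have "ln (Gamma (b + 1)) = ln b + ln (Gamma b)"
  proof -
    have "Gamma (b + 1) = b * Gamma b" using b nonpos_Ints_nonpos[of b] by (intro Gamma_plus1) force
    then show ?thesis using ln_mult_pos[OF b G] by simp
  qed
  moreover have "ln b / 2 \<le> ln (b + 1)"
  proof (cases "b \<ge> 1")
    case True
    then have "0 \<le> ln b" "ln b \<le> ln (b + 1)" by auto
    then show ?thesis by linarith
  next
    case False
    then have "ln b \<le> 0" "0 \<le> ln (b + 1)" using b by auto
    then show ?thesis by linarith
  qed
  ultimately have "ln (Gamma (b + 1 / 2)) \<le> ln (b + 1) + ln (Gamma b)" by (simp add: field_simps)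
  also have "\<dots> = ln ((b + 1) * Gamma b)" using ln_mult_pos[of "b + 1", OF _ G] b by simp
  finally show ?thesis using b G by (subst (asm) ln_le_cancel_iff) auto
qed

lemma Gamma_duplication_real:
  fixes a :: real assumes a: "a > 0"
  shows "Gamma a * rGamma ((a + 1) / 2) = 2 powr (a - 1) / sqrt pi * Gamma (a / 2)"
proof -
  have G: "Gamma (a / 2) * Gamma (a / 2 + 1 / 2) = 2 powr (1 - a) * sqrt pi * Gamma a"
  proof -
    have n: "complex_of_real (a / 2) \<notin> \<int>\<^sub>\<le>\<^sub>0" "complex_of_real (a / 2) + 1 / 2 \<notin> \<int>\<^sub>\<le>\<^sub>0"
      using a by (auto elim!: nonpos_Ints_cases simp: complex_eq_iff)
    have e: "complex_of_real (a / 2) + 1 / 2 = complex_of_real (a / 2 + 1 / 2)" "2 * complex_of_real (a / 2) = complex_of_real a" by simp_all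
    have "exp ((1 - complex_of_real a) * complex_of_real (ln 2)) = complex_of_real (2 powr (1 - a))"
      by (simp add: powr_def exp_of_real[symmetric] mult_ac del: exp_of_real)
    then have "complex_of_real (Gamma (a / 2) * Gamma (a / 2 + 1 / 2)) = complex_of_real (2 powr (1 - a) * sqrt pi * Gamma a)"
      using Gamma_legendre_duplication[OF n] unfolding e by (simp only: Gamma_complex_of_real of_real_mult)
    then show ?thesis by (simp only: of_real_eq_iff)
  qed
  have p: "Gamma ((a + 1) / 2) > 0" using a by (intro Gamma_real_pos) simp
  have h: "a / 2 + 1 / 2 = (a + 1) / 2" by (simp add: field_simps)
  have "Gamma a = 2 powr (a - 1) / sqrt pi * Gamma (a / 2) * Gamma ((a + 1) / 2)"
  proof -
    have "2 powr (a - 1) * 2 powr (1 - a) = (1::real)" by (simp flip: powr_add)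
    then have "2 powr (a - 1) / sqrt pi * (2 powr (1 - a) * sqrt pi * Gamma a) = Gamma a" by simp
    then show ?thesis using G unfolding h by (simp only: mult.assoc)
  qed
  then show ?thesis using p by (simp add: rGamma_inverse_Gamma)
qed

text \<open>Two things happen beyond collecting powers of 2 and pi: \<Gamma>(j + (d - 1) / 2)
  cancels between the sphere constant and \<open>detour_value\<close>, and the duplication formula
  reduces \<Gamma>(a) / \<Gamma>((a + 1) / 2) to \<Gamma>(a / 2). The reciprocal Gamma factor in (j
  - \<beta>) / 2 survives from \<open>detour_value\<close>.\<close>

lemma series_constant:
  assumes d: "d \<ge> 2" and b: "\<beta> \<ge> 0"
  shows "(2 * pi) powr (- real d) * (sphere_fourier_const d j * (Gamma (real d + \<beta> + real j) * detour_value (real d + \<beta> + real j) (2 * j + d - 2))) =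
    2 powr \<beta> * pi powr (- real d / 2) * (Gamma ((real j + \<beta> + real d) / 2) * rGamma ((real j - \<beta>) / 2))"
proof -
  let ?a = "real d + \<beta> + real j" and ?b = "real j + (real d - 1) / 2"
  have a: "?a > 0" using d b by simp
  have G: "Gamma ?b > 0" using d by (intro Gamma_real_pos) (simp add: add_nonneg_pos)
  have e: "(real (2 * j + d - 2) + 1) / 2 = ?b" "(real (2 * j + d - 2) + 2 - ?a) / 2 = (real j - \<beta>) / 2"
    using d by (simp_all add: of_nat_diff field_simps)
  have a2: "(real j + \<beta> + real d) / 2 = ?a / 2" by simp
  have "(2 * pi) powr (- real d) * (sphere_fourier_const d j * (Gamma ?a * detour_value ?a (2 * j + d - 2))) =
    (2 * pi) powr (- real d) * (2 * pi powr (real d / 2) / (2 ^ j * sqrt pi) * pi) * rGamma ((real j - \<beta>) / 2) * (Gamma ?a * rGamma ((?a + 1) / 2))"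
    unfolding detour_value_def e sphere_fourier_const_def using G by (simp add: mult_ac)
  also have "\<dots> = ((2 * pi) powr (- real d) * (2 * pi powr (real d / 2) / (2 ^ j * sqrt pi) * pi) * (2 powr (?a - 1) / sqrt pi)) * (Gamma (?a / 2) * rGamma ((real j - \<beta>) / 2))"
    unfolding Gamma_duplication_real[OF a] by (simp only: mult_ac)
  also have "(2 * pi) powr (- real d) * (2 * pi powr (real d / 2) / (2 ^ j * sqrt pi) * pi) * (2 powr (?a - 1) / sqrt pi) = 2 powr \<beta> * pi powr (- real d / 2)"
  proof -
    have "(2 * pi) powr (- real d) * (2 * pi powr (real d / 2) / (2 ^ j * sqrt pi) * pi) * (2 powr (?a - 1) / sqrt pi) =
      (2 powr (- real d) * 2 powr (- real j) * (2 * 2 powr (?a - 1))) * (pi powr (- real d) * pi powr (real d / 2)) * (pi / (sqrt pi * sqrt pi))"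
    proof -
      have "(2 * pi) powr (- real d) = 2 powr (- real d) * pi powr (- real d)" by (rule powr_mult)
      moreover have "2 powr (- real j) = (1::real) / 2 ^ j" by (simp add: powr_minus_divide powr_realpow)
      moreover have "A * B * (2 * C / (J * S) * P) * (E / S) = (A * (1 / J) * (2 * E)) * (B * C) * (P / (S * S))" for A B C J S P E :: real
        by (simp add: divide_inverse mult_ac)
      ultimately show ?thesis by (simp only:)
    qed
    also have "2 powr (- real d) * 2 powr (- real j) * (2 * 2 powr (?a - 1)) = 2 powr \<beta>"
    proof -
      have "(2::real) * 2 powr (?a - 1) = 2 powr 1 * 2 powr (?a - 1)" by simp
      then show ?thesis by (simp only: powr_add[symmetric]) simp
    qed
    also have "pi powr (- real d) * pi powr (real d / 2) = pi powr (- real d / 2)" by (simp flip: powr_add)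
    finally show ?thesis by simp
  qed
  finally show ?thesis unfolding a2 .
qed


section \<open>The regularized expansion\<close>

text \<open>The stretched exponential decays faster than any power. N is chosen with \<alpha> N >= d
  + 1, so that against the weight r^(d - 1) a decay of order r^(- 2) remains.\<close>

lemma integrable_radial_stretched_exp:
  assumes c: "c > 0" and a: "\<alpha> > 0" and d: "d > 0"
  shows "integrable (radial_measure d) (\<lambda>r. exp (- (c * r powr \<alpha>)))"
proof (subst integral_radial_measure(1))
  obtain N :: nat where N: "real (d + 1) / \<alpha> < real N" using reals_Archimedean2 by blast
  have N0: "N > 0"
  proof -
    have "0 < real (d + 1) / \<alpha>" using a by simp
    then have "0 < real N" using N by linarith
    then show ?thesis by simp
  qed
  have Na: "real (d + 1) \<le> \<alpha> * real N" using N a by (simp add: field_simps)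
  \<comment> \<open>(N / c)^N is the constant in e^(- y) <= (N / y)^N at y = c r^\<alpha>; raising
    it to at least 1 also covers r <= 1.\<close>
  define K where "K = max 1 ((real N / c) ^ N)"
  have K1: "K \<ge> 1" "K \<ge> (real N / c) ^ N" by (auto simp: K_def)
  have "integrable lborel (\<lambda>x::real. inverse (1 + x\<^sup>2))"
    using integrable_inverse_1_plus_square by (simp add: set_integrable_def)
  then have "integrable lborel (\<lambda>x::real. 2 * K * inverse (1 + x\<^sup>2))" by (rule integrable_mult_right)
  then show "integrable lborel (\<lambda>r. (indicator {0<..} r * r ^ (d - 1)) *\<^sub>R exp (- (c * r powr \<alpha>)))"
  proof (rule Bochner_Integration.integrable_bound)
    show "AE r in lborel. norm ((indicator {0<..} r * r ^ (d - 1)) *\<^sub>R exp (- (c * r powr \<alpha>))) \<le> norm (2 * K * inverse (1 + r\<^sup>2))"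
    proof (intro AE_I2)
      fix r :: real
      have pos: "1 + r\<^sup>2 > 0" by (simp add: add_pos_nonneg)
      show "norm ((indicator {0<..} r * r ^ (d - 1)) *\<^sub>R exp (- (c * r powr \<alpha>))) \<le> norm (2 * K * inverse (1 + r\<^sup>2))"
      proof (cases "r > 0")
        case True
        have "r ^ (d - 1) * exp (- (c * r powr \<alpha>)) \<le> 2 * K * inverse (1 + r\<^sup>2)"
        proof (cases "r \<le> 1")
          case r1: True
          have "r ^ (d - 1) * exp (- (c * r powr \<alpha>)) \<le> 1 * 1"
            using True r1 c by (intro mult_mono power_le_one) auto
          also have "\<dots> \<le> 2 * inverse (1 + r\<^sup>2)"
          proof -
            have "r\<^sup>2 \<le> 1" using True r1 by (simp add: power_le_one)
            then show ?thesis using pos by (simp add: field_simps)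
          qed
          also have "\<dots> \<le> 2 * K * inverse (1 + r\<^sup>2)" using K1 pos by (intro mult_right_mono) auto
          finally show ?thesis .
        next
          case False
          then have r1: "r > 1" by simp
          let ?y = "c * r powr \<alpha>"
          have y: "?y > 0" using c True by simp
          \<comment> \<open>The N-th power of t <= e^t at t = y / N gives polynomial decay of the
            prescribed order.\<close>
          have "(?y / real N) ^ N \<le> exp (?y / real N) ^ N"
            using y N0 exp_ge_add_one_self[of "?y / real N"] by (intro power_mono) (linarith, simp)
          also have "\<dots> = exp ?y" using N0 by (simp flip: exp_of_nat_mult)
          finally have "exp (- ?y) \<le> 1 / (?y / real N) ^ N"
            using y N0 by (simp add: exp_minus inverse_eq_divide frac_le)
          also have "\<dots> = (real N / c) ^ N * (1 / (r powr \<alpha>) ^ N)"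
            by (simp add: power_divide power_mult_distrib)
          also have "(r powr \<alpha>) ^ N = r powr (\<alpha> * real N)"
            using True by (simp add: powr_powr flip: powr_realpow)
          also have "(real N / c) ^ N * (1 / r powr (\<alpha> * real N)) \<le> K * (1 / r powr real (d + 1))"
          proof (intro mult_mono K1)
            have "r powr real (d + 1) \<le> r powr (\<alpha> * real N)" using r1 Na by (intro powr_mono) auto
            then show "1 / r powr (\<alpha> * real N) \<le> 1 / r powr real (d + 1)" using True by (intro frac_le) auto
          qed (use c K1 in auto)
          also have "r powr real (d + 1) = r ^ (d + 1)" using True by (simp only: powr_realpow)
          finally have "r ^ (d - 1) * exp (- ?y) \<le> r ^ (d - 1) * (K * (1 / r ^ (d + 1)))"
            using True by (intro mult_left_mono) auto
          also have "\<dots> \<le> K * (1 / r\<^sup>2)"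
          proof -
            have "d - 1 + 2 = d + 1" using d by simp
            then have "r ^ (d - 1) * r\<^sup>2 = r ^ (d + 1)" by (metis power_add)
            then have "r ^ (d - 1) / r ^ (d + 1) \<le> 1 / r\<^sup>2" using True by (simp add: field_simps)
            then show ?thesis using K1 mult_left_mono[of "r ^ (d - 1) / r ^ (d + 1)" "1 / r\<^sup>2" K] by (simp add: mult.commute)
          qed
          also have "\<dots> \<le> K * (2 * inverse (1 + r\<^sup>2))"
          proof (intro mult_left_mono)
            have "1 \<le> r\<^sup>2" using r1 by (simp add: one_le_power)
            then show "1 / r\<^sup>2 \<le> 2 * inverse (1 + r\<^sup>2)" using pos True by (simp add: field_simps)
          qed (use K1 in auto)
          finally show ?thesis by simp
        qed
        then show ?thesis using True pos K1 by simp
      qed simp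
    qed
  qed measurable
qed measurable

section \<open>The damped inversion integral of a stable law\<close>

locale polynomial_stable = polynomial_spectral \<alpha> q P + prob_space \<mu>
  for \<alpha> :: real and q :: nat and P :: "'a::euclidean_space \<Rightarrow> real" and \<mu> :: "'a measure" +
  assumes sets_mu: "sets \<mu> = sets borel"
    and charf: "char_fun \<mu> z = exp (- complex_of_real (norm z powr \<alpha>) * V (z /\<^sub>R norm z))"
begin

lemma char_fun_integrable: "integrable lborel (char_fun \<mu>)"
proof -
  obtain c where c: "c > 0" "\<And>u. norm u = 1 \<Longrightarrow> c \<le> Re (V u)" using V_lower by blast
  let ?F = "\<lambda>r u. exp (- complex_of_real (r powr \<alpha>) * V u)"
  have "integrable lborel (\<lambda>z. ?F (norm z) (z /\<^sub>R norm z))"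
  proof (rule integral_polar(1))
    show "integrable (radial_measure DIM('a)) (\<lambda>r. exp (- (c * r powr \<alpha>)))"
      by (rule integrable_radial_stretched_exp[OF c(1) alpha(1)]) simp
    show "norm (?F r u) \<le> exp (- (c * r powr \<alpha>))" if "r > 0" "norm u = 1" for r u
      using mult_left_mono[OF c(2)[OF that(2)], of "r powr \<alpha>"] by (simp add: mult.commute)
  qed measurable
  then show ?thesis by (simp add: charf[abs_def])
qed

sublocale integrable_char \<mu>
  by unfold_locales (auto simp: sets_mu char_fun_integrable)

definition Hkj :: "nat \<Rightarrow> nat \<Rightarrow> 'a \<Rightarrow> complex" where
  "Hkj k j = sph_proj j (\<lambda>v. V v ^ k)"

text \<open>\<open>V_power_expansion\<close> only supplies some harmonic components; uniqueness
  identifies them with the projections that occur in \<open>Sjk\<close>.\<close>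

lemma Hkj_expansion: "harmonic_expansion (\<lambda>u. V u ^ k) (k * q) (Hkj k)"
proof -
  obtain H where H: "harmonic_expansion (\<lambda>u. V u ^ k) (k * q) H" using V_power_expansion by blast
  interpret h: harmonic_expansion "\<lambda>u. V u ^ k" "k * q" H by fact
  have eq: "Hkj k j = H j" if "j \<le> k * q" for j unfolding Hkj_def by (rule h.sph_proj_eq[OF that])
  show ?thesis
  proof
    show "Hkj k j \<in> spherical_harmonics j" if "j \<le> k * q" for j using h.H that by (simp add: eq)
    show "V u ^ k = (\<Sum>j\<le>k * q. Hkj k j u)" if "norm u = 1" for u using h.F_eq[OF that] by (simp add: eq)
  qed (use dim in auto)
qed

definition radial_coeff :: "nat \<Rightarrow> nat \<Rightarrow> 'a \<Rightarrow> complex" where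
  "radial_coeff k j x = Hkj k j (x /\<^sub>R norm x) * complex_of_real (sphere_fourier_const DIM('a) j) * (- \<i>) ^ j *
    complex_of_real (Gamma (real DIM('a) + real k * \<alpha> + real j) * norm x powr (- (real DIM('a) + real k * \<alpha>)))"

definition regularized_term :: "nat \<Rightarrow> real \<Rightarrow> 'a \<Rightarrow> complex" where
  "regularized_term k e x = (- 1) ^ k / fact k * (\<Sum>j\<le>k * q. radial_coeff k j x *
     integral {- pi / 2..pi / 2} (\<lambda>t. sin_kernel (e / norm x) (real DIM('a) + real k * \<alpha> + real j) (2 * j + DIM('a) - 2) (complex_of_real t)))"

lemma regularized_term_fourier:
  assumes x: "x \<noteq> 0" and e: "e > 0"
  shows "(CLINT z|lborel. (- 1) ^ k / fact k * (cis (- (x \<bullet> z)) * complex_of_real (exp (- (e * norm z)) * norm z powr (real k * \<alpha>)) * V (z /\<^sub>R norm z) ^ k)) =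
    regularized_term k e x"
proof -
  interpret h: harmonic_expansion "\<lambda>u. V u ^ k" "k * q" "Hkj k" by (rule Hkj_expansion)
  let ?g = "\<lambda>z. cis (- (x \<bullet> z)) * complex_of_real (exp (- (e * norm z)) * norm z powr (real k * \<alpha>))"
  have b: "real k * \<alpha> \<ge> 0" using alpha by simp
  have [measurable]: "Hkj k j \<in> borel_measurable borel" if "j \<le> k * q" for j
    using spherical_harmonics_measurable[OF h.H[OF that]] .
  have int: "integrable lborel (\<lambda>z. ?g z * Hkj k j (z /\<^sub>R norm z))" if "j \<le> k * q" for j
    by (rule radial_fourier(1)[OF dim h.H[OF that] x e b])
  have "(CLINT z|lborel. ?g z * V (z /\<^sub>R norm z) ^ k) = (CLINT z|lborel. (\<Sum>j\<le>k * q. ?g z * Hkj k j (z /\<^sub>R norm z)))"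
  proof (rule integral_cong_AE)
    show "AE z in lborel. ?g z * V (z /\<^sub>R norm z) ^ k = (\<Sum>j\<le>k * q. ?g z * Hkj k j (z /\<^sub>R norm z))"
      using AE_lborel_singleton[of "0::'a"]
    proof eventually_elim
      case (elim z)
      then have "V (z /\<^sub>R norm z) ^ k = (\<Sum>j\<le>k * q. Hkj k j (z /\<^sub>R norm z))" by (intro h.F_eq) simp
      then show ?case by (simp add: sum_distrib_left)
    qed
    show "(\<lambda>z. \<Sum>j\<le>k * q. ?g z * Hkj k j (z /\<^sub>R norm z)) \<in> borel_measurable lborel"
      using int by (intro borel_measurable_sum) auto
  qed measurable
  also have "\<dots> = (\<Sum>j\<le>k * q. (CLINT z|lborel. ?g z * Hkj k j (z /\<^sub>R norm z)))"
    by (rule Bochner_Integration.integral_sum) (use int in auto)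
  also have "\<dots> = (\<Sum>j\<le>k * q. radial_coeff k j x * integral {- pi / 2..pi / 2} (\<lambda>t. sin_kernel (e / norm x) (real DIM('a) + real k * \<alpha> + real j) (2 * j + DIM('a) - 2) (complex_of_real t)))"
    by (intro sum.cong refl) (subst radial_fourier(2)[OF dim h.H x e b], auto simp: radial_coeff_def)
  finally show ?thesis unfolding regularized_term_def by (simp only: integral_mult_right_zero)
qed

text \<open>For fixed positive damping, sum and integral may be exchanged: the absolute integrals
  are at most a constant times (M e^(- \<alpha>))^k \<Gamma>(d + k \<alpha>) / k!, with e the
  damping, and \<open>summable_Gamma_power\<close> applies. This majorant blows up as the damping
  tends to 0, hence the separate uniform bound later on.\<close>

lemma regularized_sums:
  assumes x: "x \<noteq> 0" and e: "e > 0"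
  shows "(\<lambda>k. regularized_term k e x) sums (CLINT z|lborel. cis (- (x \<bullet> z)) * char_fun \<mu> z * complex_of_real (exp (- (e * norm z))))"
proof -
  obtain M where M: "M > 0" "\<And>u. norm u = 1 \<Longrightarrow> norm (V u) \<le> M" using V_bound by blast
  let ?f = "\<lambda>k z. (- 1) ^ k / fact k * (cis (- (x \<bullet> z)) * complex_of_real (exp (- (e * norm z)) * norm z powr (real k * \<alpha>)) * V (z /\<^sub>R norm z) ^ k)"
  let ?F = "\<lambda>k r u. M ^ k / fact k * (exp (- (e * r)) * r powr (real k * \<alpha>))"
  have kp: "real DIM('a) + real k * \<alpha> > 0" for k using alpha by (simp add: add_pos_nonneg)
  have kernel: "(indicator {0<..} r * r ^ (DIM('a) - 1)) * (exp (- (e * r)) * r powr (real k * \<alpha>)) = gamma_kernel (real DIM('a) + real k * \<alpha>) e r" for r :: real and k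
  proof (cases "r > 0")
    case True
    have "r ^ (DIM('a) - 1) * r powr (real k * \<alpha>) = r powr (real (DIM('a) - 1) + real k * \<alpha>)"
      using True by (simp only: powr_add powr_realpow)
    also have "real (DIM('a) - 1) + real k * \<alpha> = real DIM('a) + real k * \<alpha> - 1" using dim by (simp add: of_nat_diff)
    finally show ?thesis using True by (simp add: gamma_kernel_def mult_ac)
  qed (simp add: gamma_kernel_def)
  have rad1: "integrable (radial_measure DIM('a)) (\<lambda>r. exp (- (e * r)) * r powr (real k * \<alpha>))" for k
    by (subst integral_radial_measure(1), measurable) (simp only: real_scaleR_def kernel integrable_gamma_kernel[OF kp e])
  have rad2: "(LINT r|radial_measure DIM('a). exp (- (e * r)) * r powr (real k * \<alpha>)) = Gamma (real DIM('a) + real k * \<alpha>) * e powr (- (real DIM('a) + real k * \<alpha>))" for k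
    by (subst integral_radial_measure(2), measurable) (simp only: real_scaleR_def kernel integral_gamma_kernel[OF kp e])
  have Mpt: "norm (?f k z) \<le> ?F k (norm z) (z /\<^sub>R norm z)" if "z \<noteq> 0" for k z
  proof -
    have "norm (V (z /\<^sub>R norm z)) ^ k \<le> M ^ k" using M that by (intro power_mono) auto
    then have "1 / fact k * (exp (- (e * norm z)) * norm z powr (real k * \<alpha>) * norm (V (z /\<^sub>R norm z)) ^ k) \<le>
      1 / fact k * (exp (- (e * norm z)) * norm z powr (real k * \<alpha>) * M ^ k)"
      by (intro mult_left_mono) auto
    then show ?thesis by (simp add: norm_mult norm_divide norm_power mult_ac)
  qed
  have Fint: "integrable lborel (\<lambda>z::'a. ?F k (norm z) (z /\<^sub>R norm z))"
    "(LINT z|(lborel :: 'a measure). ?F k (norm z) (z /\<^sub>R norm z)) = M ^ k / fact k * (Gamma (real DIM('a) + real k * \<alpha>) * e powr (- (real DIM('a) + real k * \<alpha>))) * measure (sphere_measure :: 'a measure) UNIV" for k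
  proof -
    have m: "case_prod (?F k :: real \<Rightarrow> 'a \<Rightarrow> real) \<in> borel_measurable (borel \<Otimes>\<^sub>M borel)" by measurable
    have i: "integrable (radial_measure DIM('a)) (\<lambda>r. M ^ k / fact k * (exp (- (e * r)) * r powr (real k * \<alpha>)))"
      by (intro integrable_mult_right rad1)
    have b: "norm (?F k r u) \<le> M ^ k / fact k * (exp (- (e * r)) * r powr (real k * \<alpha>))" for r and u :: 'a
      using M by simp
    show "integrable lborel (\<lambda>z::'a. ?F k (norm z) (z /\<^sub>R norm z))" by (rule integral_polar(1)[OF m i b])
    have "(LINT z|(lborel :: 'a measure). ?F k (norm z) (z /\<^sub>R norm z)) = (LINT r|radial_measure DIM('a). LINT u|(sphere_measure :: 'a measure). ?F k r u)"
      by (rule integral_polar(2)[OF m i b])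
    also have "\<dots> = (LINT r|radial_measure DIM('a). (measure (sphere_measure :: 'a measure) UNIV * (M ^ k / fact k)) * (exp (- (e * r)) * r powr (real k * \<alpha>)))"
      by simp
    also have "\<dots> = (measure (sphere_measure :: 'a measure) UNIV * (M ^ k / fact k)) * (LINT r|radial_measure DIM('a). exp (- (e * r)) * r powr (real k * \<alpha>))"
      by (rule integral_mult_right_zero)
    finally show "(LINT z|(lborel :: 'a measure). ?F k (norm z) (z /\<^sub>R norm z)) = M ^ k / fact k * (Gamma (real DIM('a) + real k * \<alpha>) * e powr (- (real DIM('a) + real k * \<alpha>))) * measure (sphere_measure :: 'a measure) UNIV"
      unfolding rad2 by (simp only: mult_ac)
  qed
  \<comment> \<open>At the origin \<open>0 powr 0 = 0\<close> falsifies the term k = 0, and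
    \<open>z /\<^sub>R norm z\<close> is not a unit vector there; the pointwise claims are made off
    this null set.\<close>
  have z0: "AE z in lborel. z \<noteq> (0::'a)" by (rule AE_lborel_singleton)
  have int: "integrable lborel (?f k)" for k
  proof (rule Bochner_Integration.integrable_bound[OF Fint(1)])
    show "AE z in lborel. norm (?f k z) \<le> norm (?F k (norm z) (z /\<^sub>R norm z))"
      using z0
    proof eventually_elim
      case (elim z)
      show ?case by (rule order_trans[OF Mpt[OF elim]]) (simp only: real_norm_def abs_ge_self)
    qed
  qed measurable
  have pt: "(\<lambda>k. ?f k z) sums (cis (- (x \<bullet> z)) * char_fun \<mu> z * complex_of_real (exp (- (e * norm z))))"
    and pts: "summable (\<lambda>k. norm (?f k z))" if z: "z \<noteq> 0" for z
  proof -
    let ?w = "- (complex_of_real (norm z powr \<alpha>) * V (z /\<^sub>R norm z))"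
    let ?c = "cis (- (x \<bullet> z)) * complex_of_real (exp (- (e * norm z)))"
    have f: "?f k z = ?c * (?w ^ k / fact k)" for k
    proof -
      have "norm z powr (real k * \<alpha>) = (norm z powr \<alpha>) ^ k"
        using z by (simp add: powr_powr mult.commute flip: powr_realpow)
      moreover have "?w = (- 1) * complex_of_real (norm z powr \<alpha>) * V (z /\<^sub>R norm z)" by simp
      then have "?w ^ k = (- 1) ^ k * complex_of_real ((norm z powr \<alpha>) ^ k) * V (z /\<^sub>R norm z) ^ k"
        by (simp only: power_mult_distrib of_real_power)
      ultimately show ?thesis by (simp only: of_real_mult) (simp add: mult_ac)
    qed
    have "(\<lambda>k. ?c * (?w ^ k / fact k)) sums (?c * exp ?w)"
      using exp_converges[of ?w] by (intro sums_mult) (simp add: scaleR_conv_of_real field_simps)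
    then show "(\<lambda>k. ?f k z) sums (cis (- (x \<bullet> z)) * char_fun \<mu> z * complex_of_real (exp (- (e * norm z))))"
      unfolding f charf by (simp add: mult_ac)
    have "summable (\<lambda>k. norm ?c * norm (?w ^ k / fact k))"
      using summable_norm_exp[of ?w] by (intro summable_mult) (simp add: scaleR_conv_of_real field_simps)
    then show "summable (\<lambda>k. norm (?f k z))" unfolding f by (simp only: norm_mult)
  qed
  have "(\<lambda>k. CLINT z|lborel. ?f k z) sums (CLINT z|lborel. (\<Sum>k. ?f k z))"
  proof (rule sums_integral[OF int])
    show "AE z in lborel. summable (\<lambda>k. norm (?f k z))" using z0 by eventually_elim (rule pts)
    show "summable (\<lambda>k. LINT z|lborel. norm (?f k z))"
    proof (rule summable_comparison_test')
      let ?D = "M * e powr (- \<alpha>)"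
      have D: "?D > 0" using M e by simp
      show "summable (\<lambda>k. e powr (- real DIM('a)) * measure (sphere_measure :: 'a measure) UNIV * (?D ^ k * Gamma (real DIM('a) + real k * \<alpha>) / fact k))"
        by (intro summable_mult summable_Gamma_power D alpha) simp
      fix k
      have "(LINT z|lborel. norm (?f k z)) \<le> (LINT z|(lborel :: 'a measure). ?F k (norm z) (z /\<^sub>R norm z))"
      proof (rule integral_mono_AE[OF integrable_norm[OF int] Fint(1)])
        show "AE z in lborel. norm (?f k z) \<le> ?F k (norm z) (z /\<^sub>R norm z)" using z0 by eventually_elim (rule Mpt)
      qed
      also have "\<dots> = e powr (- real DIM('a)) * measure (sphere_measure :: 'a measure) UNIV * (?D ^ k * Gamma (real DIM('a) + real k * \<alpha>) / fact k)"
      proof -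
        have "e powr (- (real DIM('a) + real k * \<alpha>)) = e powr (- real DIM('a)) * (e powr (- \<alpha>)) ^ k"
        proof -
          have "e powr (- (real DIM('a) + real k * \<alpha>)) = e powr (- real DIM('a) + - \<alpha> * real k)" by (simp add: algebra_simps)
          also have "\<dots> = e powr (- real DIM('a)) * (e powr (- \<alpha>)) powr real k" by (simp only: powr_add powr_powr)
          finally show ?thesis using e by (simp add: powr_realpow)
        qed
        then show ?thesis unfolding Fint(2) by (simp add: power_mult_distrib mult_ac)
      qed
      finally show "norm (LINT z|lborel. norm (?f k z)) \<le> e powr (- real DIM('a)) * measure (sphere_measure :: 'a measure) UNIV * (?D ^ k * Gamma (real DIM('a) + real k * \<alpha>) / fact k)"
        by (simp add: integral_nonneg)
    qed
  qed
  moreover have "(CLINT z|lborel. (\<Sum>k. ?f k z)) = (CLINT z|lborel. cis (- (x \<bullet> z)) * char_fun \<mu> z * complex_of_real (exp (- (e * norm z))))"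
  proof (rule integral_cong_AE)
    show "AE z in lborel. (\<Sum>k. ?f k z) = cis (- (x \<bullet> z)) * char_fun \<mu> z * complex_of_real (exp (- (e * norm z)))"
      using z0 by eventually_elim (rule sums_unique[symmetric, OF pt])
    show "(\<lambda>z. \<Sum>k. ?f k z) \<in> borel_measurable lborel" by measurable
  qed measurable
  ultimately show ?thesis by (simp only: regularized_term_fourier[OF x e])
qed

end

section \<open>Bounds uniform in the damping\<close>

text \<open>\<open>H_bound\<close> controls a harmonic component only after multiplication by
  \<open>funk_hecke_coeff d j j\<close>. Up to sqrt pi and j!, the two constants differ by a shift
  of 1 / 2 in the Gamma function, which \<open>Gamma_half_shift_le\<close> handles.\<close>

lemma sphere_fourier_const_le:
  assumes d: "d \<ge> 2"
  shows "sphere_fourier_const d j \<le> funk_hecke_coeff d j j * ((real j + real d) / fact j)"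
proof -
  let ?b = "real j + (real d - 1) / 2"
  have b: "?b > 0" using d by (simp add: add_nonneg_pos)
  have G: "Gamma ?b > 0" "Gamma (?b + 1 / 2) > 0" using b by (auto intro!: Gamma_real_pos)
  have s: "sqrt pi \<ge> 1" using pi_ge_two by simp
  have C: "funk_hecke_coeff d j j = 2 * pi powr (real d / 2) * fact j / (2 ^ j * Gamma (?b + 1 / 2))"
  proof -
    have e: "?b + 1 / 2 = real j + real d / 2" by (simp add: field_simps)
    show ?thesis unfolding e using funk_hecke_coeff_eq[of d j 0] by simp
  qed
  have "Gamma (?b + 1 / 2) \<le> (real j + real d) * Gamma ?b"
  proof -
    have "Gamma (?b + 1 / 2) \<le> (?b + 1) * Gamma ?b" by (rule Gamma_half_shift_le[OF b])
    also have "\<dots> \<le> (real j + real d) * Gamma ?b"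
    proof (rule mult_right_mono)
      show "?b + 1 \<le> real j + real d" using d by (simp add: field_simps)
    qed (use G in simp)
    finally show ?thesis .
  qed
  also have "\<dots> \<le> (real j + real d) * (sqrt pi * Gamma ?b)"
    using s G by (intro mult_left_mono) auto
  finally have "1 / (sqrt pi * Gamma ?b) \<le> (real j + real d) / Gamma (?b + 1 / 2)"
    using G s by (simp add: field_simps)
  then have "2 * pi powr (real d / 2) / 2 ^ j * (1 / (sqrt pi * Gamma ?b)) \<le> 2 * pi powr (real d / 2) / 2 ^ j * ((real j + real d) / Gamma (?b + 1 / 2))"
    by (intro mult_left_mono) auto
  then show ?thesis unfolding sphere_fourier_const_def C by (simp add: mult_ac)
qed

lemma sphere_fourier_const_nonneg: "d \<ge> 2 \<Longrightarrow> sphere_fourier_const d j \<ge> 0"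
  using Gamma_real_pos[of "real j + (real d - 1) / 2"] by (simp add: sphere_fourier_const_def add_nonneg_pos less_imp_le)

lemma add_le_mult_power2: "d \<ge> 1 \<Longrightarrow> real j + real d \<le> real d * 2 ^ j"
proof -
  assume d: "d \<ge> 1"
  have "real j + real d \<le> real d * (real j + 1)"
  proof -
    have "1 * real j \<le> real d * real j" using d by (intro mult_right_mono) auto
    then show ?thesis by (simp add: distrib_left)
  qed
  also have "real j + 1 \<le> 2 ^ j"
  proof -
    have "Suc j \<le> 2 ^ j" by (rule Suc_leI[OF less_exp])
    then have "real (Suc j) \<le> real (2 ^ j)" by (rule of_nat_mono)
    then show ?thesis by simp
  qed
  then have "real d * (real j + 1) \<le> real d * 2 ^ j" by (intro mult_left_mono) auto
  finally show ?thesis .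
qed

context polynomial_stable
begin

text \<open>The factorial growth in j cancels: \<open>H_bound\<close> with
  \<open>sphere_fourier_const_le\<close> supplies (j + d) / j!, and the shift of Gamma by j costs j!
  times a power of 2. The arc integral is bounded along the displaced path, so \<epsilon> drops
  out.\<close>

lemma regularized_term_bound:
  obtains K D where "K \<ge> 0" "D > 0"
    "\<And>k e x. x \<noteq> 0 \<Longrightarrow> e > 0 \<Longrightarrow> norm (regularized_term k e x) \<le>
       K * (D ^ k * Gamma (real DIM('a) + real k * \<alpha>) / fact k) * norm x powr (- (real DIM('a) + real k * \<alpha>))"
proof -
  obtain M where M: "M > 0" "\<And>u. norm u = 1 \<Longrightarrow> norm (V u) \<le> M" using V_bound by blast
  let ?d = "DIM('a)"
  let ?w = "measure sphere_measure (UNIV :: 'a set)"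
  define K where "K = ?w * (pi + 2) * real ?d * 4 ^ ?d"
  \<comment> \<open>2^k comes from the Pochhammer bound. The factor 16^j collects 2^j from j + d,
    2^j from Pochhammer and 4^j from the cosine; with j <= k q and k q + 1 <= 2^(k q) summands this
    becomes 32^(k q). The 4^d in \<open>K\<close> comes from the same Pochhammer and cosine
    bounds.\<close>
  define D where "D = 2 * M * 32 ^ q"
  have "norm (regularized_term k e x) \<le> K * (D ^ k * Gamma (real ?d + real k * \<alpha>) / fact k) * norm x powr (- (real ?d + real k * \<alpha>))"
    if x: "x \<noteq> 0" and e: "e > 0" for k e x
  proof -
    interpret h: harmonic_expansion "\<lambda>u. V u ^ k" "k * q" "Hkj k" by (rule Hkj_expansion)
    let ?\<theta> = "x /\<^sub>R norm x"
    let ?G = "Gamma (real ?d + real k * \<alpha>)"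
    let ?r = "norm x powr (- (real ?d + real k * \<alpha>))"
    let ?I = "\<lambda>j. integral {- pi / 2..pi / 2} (\<lambda>t. sin_kernel (e / norm x) (real ?d + real k * \<alpha> + real j) (2 * j + ?d - 2) (complex_of_real t))"
    have \<theta>: "norm ?\<theta> = 1" using x by simp
    have y: "real ?d + real k * \<alpha> > 0" using alpha by (simp add: add_pos_nonneg)
    have G: "?G > 0" by (rule Gamma_real_pos[OF y])
    let ?A = "M ^ k * ?w * (pi + 2) * real ?d * 4 ^ ?d * 2 ^ k * ?G * ?r"
    have tm: "norm (radial_coeff k j x * ?I j) \<le> ?A * 16 ^ j" if j: "j \<le> k * q" for j
    proof -
      let ?C = "funk_hecke_coeff ?d j j" and ?\<kappa> = "sphere_fourier_const ?d j"
      have H: "?C * norm (Hkj k j ?\<theta>) \<le> M ^ k * ?w"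
        by (rule h.H_bound[OF j _ _ \<theta>]) (use M in \<open>auto simp: norm_power intro!: power_mono\<close>)
      have \<kappa>0: "?\<kappa> \<ge> 0" by (rule sphere_fourier_const_nonneg[OF dim])
      have a: "norm (Hkj k j ?\<theta>) * ?\<kappa> \<le> M ^ k * ?w * ((real j + real ?d) / fact j)"
      proof -
        have "norm (Hkj k j ?\<theta>) * ?\<kappa> \<le> norm (Hkj k j ?\<theta>) * (?C * ((real j + real ?d) / fact j))"
          by (intro mult_left_mono sphere_fourier_const_le dim) auto
        also have "\<dots> = (?C * norm (Hkj k j ?\<theta>)) * ((real j + real ?d) / fact j)" by (simp only: mult_ac)
        also have "\<dots> \<le> M ^ k * ?w * ((real j + real ?d) / fact j)" by (rule mult_right_mono[OF H]) simp
        finally show ?thesis .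
      qed
      have g: "Gamma (real ?d + real k * \<alpha> + real j) \<le> 2 ^ (?d + k + j) * fact j * ?G"
      proof -
        have "real ?d + real k * \<alpha> \<notin> \<int>\<^sub>\<le>\<^sub>0" using y nonpos_Ints_nonpos[of "real ?d + real k * \<alpha>"] by fastforce
        then have "Gamma (real ?d + real k * \<alpha> + real j) = pochhammer (real ?d + real k * \<alpha>) j * ?G"
          using pochhammer_Gamma[of "real ?d + real k * \<alpha>" j] G by (simp add: field_simps)
        also have "pochhammer (real ?d + real k * \<alpha>) j \<le> 2 ^ (?d + k + j) * fact j"
        proof (rule pochhammer_le_power)
          have "real k * \<alpha> \<le> real k * 1" using alpha by (intro mult_left_mono) auto
          then show "real ?d + real k * \<alpha> \<le> real (?d + k)" by simp
        qed (use y in simp)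
        finally show ?thesis using G by (simp add: mult_right_mono)
      qed
      have i: "norm (?I j) \<le> 2 ^ (2 * j + ?d) * (pi + 2)"
      proof -
        have "norm (?I j) \<le> 2 ^ (2 * j + ?d - 2) * (pi + 2)"
          using e x y by (intro sin_kernel_integral_bound) auto
        also have "\<dots> \<le> 2 ^ (2 * j + ?d) * (pi + 2)" by (intro mult_right_mono power_increasing) auto
        finally show ?thesis .
      qed
      have gp: "Gamma (real ?d + real k * \<alpha> + real j) > 0" using y by (intro Gamma_real_pos) simp
      have "norm (radial_coeff k j x * ?I j) = (norm (Hkj k j ?\<theta>) * ?\<kappa>) * (Gamma (real ?d + real k * \<alpha> + real j) * ?r) * norm (?I j)"
        using \<kappa>0 gp unfolding radial_coeff_def by (simp add: norm_mult norm_power)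
      also have "\<dots> \<le> (M ^ k * ?w * ((real j + real ?d) / fact j)) * ((2 ^ (?d + k + j) * fact j * ?G) * ?r) * (2 ^ (2 * j + ?d) * (pi + 2))"
      proof -
        have X: "0 \<le> M ^ k * ?w * ((real j + real ?d) / fact j)" using M by simp
        have Y: "0 \<le> Gamma (real ?d + real k * \<alpha> + real j) * ?r" "0 \<le> (2 ^ (?d + k + j) * fact j * ?G) * ?r"
          using gp G by simp_all
        have gr: "Gamma (real ?d + real k * \<alpha> + real j) * ?r \<le> (2 ^ (?d + k + j) * fact j * ?G) * ?r"
          by (rule mult_right_mono[OF g]) simp
        show ?thesis by (rule mult_mono[OF mult_mono[OF a gr X Y(1)] i mult_nonneg_nonneg[OF X Y(2)] norm_ge_zero])
      qed
      also have "\<dots> = (M ^ k * ?w * (pi + 2) * ?G * ?r) * (real j + real ?d) * (2 ^ (?d + k + j) * 2 ^ (2 * j + ?d))"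
        by simp
      also have "\<dots> \<le> (M ^ k * ?w * (pi + 2) * ?G * ?r) * (real ?d * 2 ^ j) * (2 ^ (?d + k + j) * 2 ^ (2 * j + ?d))"
        using G M dim by (intro mult_right_mono mult_left_mono add_le_mult_power2) auto
      also have "\<dots> = (M ^ k * ?w * (pi + 2) * ?G * ?r) * real ?d * (2 ^ j * (2 ^ (?d + k + j) * 2 ^ (2 * j + ?d)))"
        by (simp only: mult_ac)
      also have "(2::real) ^ j * (2 ^ (?d + k + j) * 2 ^ (2 * j + ?d)) = 4 ^ ?d * 2 ^ k * 16 ^ j"
      proof -
        have "(2::real) ^ j * (2 ^ (?d + k + j) * 2 ^ (2 * j + ?d)) = 2 ^ (2 * ?d + k + 4 * j)"
          by (simp flip: power_add)
        also have "\<dots> = (2 ^ 2) ^ ?d * 2 ^ k * (2 ^ 4) ^ j" by (simp only: power_add power_mult)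
        finally show ?thesis by simp
      qed
      finally show ?thesis by (simp only: mult_ac)
    qed
    have A0: "?A \<ge> 0" using M G by auto
    have "norm (regularized_term k e x) = 1 / fact k * norm (\<Sum>j\<le>k * q. radial_coeff k j x * ?I j)"
      unfolding regularized_term_def by (simp add: norm_mult norm_divide norm_power)
    also have "\<dots> \<le> 1 / fact k * (\<Sum>j\<le>k * q. ?A * 16 ^ (k * q))"
    proof (intro mult_left_mono sum_norm_le)
      fix j assume "j \<in> {..k * q}"
      then have "norm (radial_coeff k j x * ?I j) \<le> ?A * 16 ^ j" by (intro tm) simp
      also have "\<dots> \<le> ?A * 16 ^ (k * q)" using A0 \<open>j \<in> {..k * q}\<close> by (intro mult_left_mono power_increasing) auto
      finally show "norm (radial_coeff k j x * ?I j) \<le> ?A * 16 ^ (k * q)" .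
    qed simp
    also have "\<dots> = 1 / fact k * (?A * (real (k * q) + 1) * 16 ^ (k * q))" by simp
    also have "\<dots> \<le> 1 / fact k * (?A * 2 ^ (k * q) * 16 ^ (k * q))"
      using A0 add_le_mult_power2[of 1 "k * q"] by (intro mult_left_mono mult_right_mono) auto
    also have "\<dots> = K * (D ^ k * ?G / fact k) * ?r"
    proof -
      have "(2::real) ^ (k * q) * 16 ^ (k * q) = 32 ^ (k * q)" by (simp flip: power_mult_distrib)
      also have "\<dots> = (32 ^ q) ^ k" by (simp add: power_mult[symmetric] mult.commute)
      finally have p: "(2::real) ^ (k * q) * 16 ^ (k * q) = (32 ^ q) ^ k" .
      have "1 / fact k * (?A * 2 ^ (k * q) * 16 ^ (k * q)) = 1 / fact k * (?A * (2 ^ (k * q) * 16 ^ (k * q)))" by simp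
      then show ?thesis unfolding p K_def D_def power_mult_distrib by (simp add: mult_ac)
    qed
    finally show ?thesis .
  qed
  moreover have "K \<ge> 0" "D > 0" using M by (auto simp: K_def D_def)
  ultimately show ?thesis using that by blast
qed

section \<open>Removal of the damping\<close>

lemma regularized_term_limit:
  assumes x: "x \<noteq> 0"
  shows "(\<lambda>n. complex_of_real ((2 * pi) powr (- real DIM('a))) * regularized_term k (scale_seq n) x) \<longlonglongrightarrow> stable_term \<alpha> q lam k x"
proof -
  let ?d = "DIM('a)"
  let ?\<theta> = "x /\<^sub>R norm x"
  let ?P = "complex_of_real ((2 * pi) powr (- real ?d))"
  let ?v = "\<lambda>j. complex_of_real (detour_value (real ?d + real k * \<alpha> + real j) (2 * j + ?d - 2))"
  have sc: "filterlim (\<lambda>n. scale_seq n / norm x) (at_right 0) sequentially"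
  proof (rule tendsto_imp_filterlim_at_right)
    have "(\<lambda>n. scale_seq n / norm x) \<longlonglongrightarrow> 0 / norm x" using x by (intro tendsto_intros scale_seq) simp
    then show "(\<lambda>n. scale_seq n / norm x) \<longlonglongrightarrow> 0" by simp
    show "\<forall>\<^sub>F n in sequentially. scale_seq n / norm x > 0" using x scale_seq(1) by simp
  qed
  have "(\<lambda>n. ?P * regularized_term k (scale_seq n) x) \<longlonglongrightarrow> ?P * ((- 1) ^ k / fact k * (\<Sum>j\<le>k * q. radial_coeff k j x * ?v j))"
    unfolding regularized_term_def
    by (intro tendsto_intros filterlim_compose[OF sin_kernel_integral_limit sc])
  also have "?P * ((- 1) ^ k / fact k * (\<Sum>j\<le>k * q. radial_coeff k j x * ?v j)) = stable_term \<alpha> q lam k x"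
  proof -
    let ?r = "norm x powr (- (real ?d + real k * \<alpha>))"
    have b: "real k * \<alpha> \<ge> 0" using alpha by simp
    have "?P * (radial_coeff k j x * ?v j) =
       complex_of_real (2 powr (real k * \<alpha>) * pi powr (- real ?d / 2) * ?r) *
       (complex_of_real (Gamma ((real j + real k * \<alpha> + real ?d) / 2) * rGamma ((real j - real k * \<alpha>) / 2)) * Sjk \<alpha> lam j k ?\<theta>)" for j
    proof -
      have S: "Sjk \<alpha> lam j k ?\<theta> = (- \<i>) ^ j * Hkj k j ?\<theta>" by (simp add: Sjk_def Hkj_def V_def)
      have "?P * (radial_coeff k j x * ?v j) = complex_of_real ((2 * pi) powr (- real ?d) * (sphere_fourier_const ?d j * (Gamma (real ?d + real k * \<alpha> + real j) * detour_value (real ?d + real k * \<alpha> + real j) (2 * j + ?d - 2)))) *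
         (complex_of_real ?r * ((- \<i>) ^ j * Hkj k j ?\<theta>))"
        unfolding radial_coeff_def by (simp only: of_real_mult mult_ac)
      then show ?thesis unfolding series_constant[OF dim b] S by (simp only: of_real_mult mult_ac)
    qed
    then have "?P * (\<Sum>j\<le>k * q. radial_coeff k j x * ?v j) = complex_of_real (2 powr (real k * \<alpha>) * pi powr (- real ?d / 2) * ?r) *
       (\<Sum>j\<le>k * q. complex_of_real (Gamma ((real j + real k * \<alpha> + real ?d) / 2) * rGamma ((real j - real k * \<alpha>) / 2)) * Sjk \<alpha> lam j k ?\<theta>)"
      by (simp only: sum_distrib_left)
    then have "?P * ((- 1) ^ k / fact k * (\<Sum>j\<le>k * q. radial_coeff k j x * ?v j)) = (- 1) ^ k / fact k * complex_of_real (2 powr (real k * \<alpha>) * pi powr (- real ?d / 2) * ?r) *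
       (\<Sum>j\<le>k * q. complex_of_real (Gamma ((real j + real k * \<alpha> + real ?d) / 2) * rGamma ((real j - real k * \<alpha>) / 2)) * Sjk \<alpha> lam j k ?\<theta>)"
      by (metis (no_types, lifting) mult.assoc mult.left_commute)
    also have "(- 1) ^ k / fact k * complex_of_real (2 powr (real k * \<alpha>) * pi powr (- real ?d / 2) * ?r) =
       complex_of_real ((- (2 powr \<alpha>)) ^ k * pi powr (- real ?d / 2) / (fact k * norm x powr (real k * \<alpha> + real ?d)))"
    proof -
      have "(- (2 powr \<alpha>)) ^ k = (- 1) ^ k * 2 powr (real k * \<alpha>)"
        by (simp add: power_minus[of "2 powr \<alpha>"] powr_powr mult.commute flip: powr_realpow)
      moreover have "?r = 1 / norm x powr (real k * \<alpha> + real ?d)" by (simp only: powr_minus_divide add.commute)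
      ultimately show ?thesis by simp
    qed
    finally show ?thesis unfolding stable_term_def by (simp only: atMost_atLeast0)
  qed
  finally show ?thesis .
qed

text \<open>For k = 0 only j = 0 occurs, and the reciprocal Gamma function vanishes at 0. The
  limiting series, which Tannery's theorem sums from 0, therefore starts at 1.\<close>

lemma stable_term_0: "x \<noteq> 0 \<Longrightarrow> stable_term \<alpha> q lam 0 x = 0"
  by (simp add: stable_term_def)

lemma regularized_limit:
  "(\<lambda>n. CLINT z|lborel. cis (- (x \<bullet> z)) * char_fun \<mu> z * complex_of_real (exp (- (scale_seq n * norm z)))) \<longlonglongrightarrow>
    (CLINT z|lborel. cis (- (x \<bullet> z)) * char_fun \<mu> z)"
proof (rule integral_dominated_convergence[where w="\<lambda>z. norm (char_fun \<mu> z)"])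
  show "AE z in lborel. (\<lambda>n. cis (- (x \<bullet> z)) * char_fun \<mu> z * complex_of_real (exp (- (scale_seq n * norm z)))) \<longlonglongrightarrow> cis (- (x \<bullet> z)) * char_fun \<mu> z"
  proof (intro AE_I2)
    fix z
    have "(\<lambda>n. cis (- (x \<bullet> z)) * char_fun \<mu> z * complex_of_real (exp (- (scale_seq n * norm z)))) \<longlonglongrightarrow>
       cis (- (x \<bullet> z)) * char_fun \<mu> z * complex_of_real (exp (- (0 * norm z)))"
      by (intro tendsto_intros scale_seq)
    then show "(\<lambda>n. cis (- (x \<bullet> z)) * char_fun \<mu> z * complex_of_real (exp (- (scale_seq n * norm z)))) \<longlonglongrightarrow> cis (- (x \<bullet> z)) * char_fun \<mu> z"
      by simp
  qed
  show "AE z in lborel. norm (cis (- (x \<bullet> z)) * char_fun \<mu> z * complex_of_real (exp (- (scale_seq n * norm z)))) \<le> norm (char_fun \<mu> z)" for n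
    using scale_seq(1)[of n] by (intro AE_I2) (auto simp: norm_mult mult_left_le)
qed (use char_integrable in auto)

text \<open>The majorant of the damped terms does not depend on the damping, so it passes to the
  limit terms and permits the limit under the sum. Its dependence on x through a negative power of
  the norm is kept explicit, since it yields absolute and uniform convergence alike.\<close>

lemma stable_series:
  obtains B where "\<And>r. r > 0 \<Longrightarrow> summable (\<lambda>k. B k * r powr (- (real DIM('a) + real k * \<alpha>)))"
    "\<And>k x. x \<noteq> 0 \<Longrightarrow> norm (stable_term \<alpha> q lam k x) \<le> B k * norm x powr (- (real DIM('a) + real k * \<alpha>))"
    "\<And>k. B k \<ge> 0"
    "\<And>x. x \<noteq> 0 \<Longrightarrow> (\<lambda>k. stable_term \<alpha> q lam k x) sums inv_fourier_density \<mu> x"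
proof -
  let ?d = "real DIM('a)"
  let ?P = "complex_of_real ((2 * pi) powr (- ?d))"
  obtain K D where KD: "K \<ge> 0" "D > 0" and bd:
    "\<And>k e x. x \<noteq> 0 \<Longrightarrow> e > 0 \<Longrightarrow> norm (regularized_term k e x) \<le> K * (D ^ k * Gamma (?d + real k * \<alpha>) / fact k) * norm x powr (- (?d + real k * \<alpha>))"
    using regularized_term_bound by blast
  define B where "B k = (2 * pi) powr (- ?d) * (K * (D ^ k * Gamma (?d + real k * \<alpha>) / fact k))" for k
  have B0: "B k \<ge> 0" for k
  proof -
    have "Gamma (?d + real k * \<alpha>) > 0" using alpha by (intro Gamma_real_pos) (simp add: add_pos_nonneg)
    then show ?thesis using KD by (simp add: B_def)
  qed
  have sm: "summable (\<lambda>k. B k * r powr (- (?d + real k * \<alpha>)))" if r: "r > 0" for r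
  proof -
    let ?D = "D * r powr (- \<alpha>)"
    have "summable (\<lambda>k. ((2 * pi) powr (- ?d) * K * r powr (- ?d)) * (?D ^ k * Gamma (?d + real k * \<alpha>) / fact k))"
      using KD r by (intro summable_mult summable_Gamma_power alpha) auto
    moreover have "((2 * pi) powr (- ?d) * K * r powr (- ?d)) * (?D ^ k * Gamma (?d + real k * \<alpha>) / fact k) = B k * r powr (- (?d + real k * \<alpha>))" for k
    proof -
      have "r powr (- (?d + real k * \<alpha>)) = r powr (- ?d) * (r powr (- \<alpha>)) ^ k"
      proof -
        have "r powr (- (?d + real k * \<alpha>)) = r powr (- ?d + - \<alpha> * real k)" by (simp add: algebra_simps)
        also have "\<dots> = r powr (- ?d) * (r powr (- \<alpha>)) powr real k" by (simp only: powr_add powr_powr)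
        finally show ?thesis using r by (simp add: powr_realpow)
      qed
      then show ?thesis unfolding B_def by (simp add: power_mult_distrib)
    qed
    ultimately show ?thesis by (simp only:)
  qed
  have bd': "norm (?P * regularized_term k (scale_seq n) x) \<le> B k * norm x powr (- (?d + real k * \<alpha>))" if "x \<noteq> 0" for k n x
  proof -
    have "norm (?P * regularized_term k (scale_seq n) x) = (2 * pi) powr (- ?d) * norm (regularized_term k (scale_seq n) x)" by (simp add: norm_mult)
    also have "\<dots> \<le> (2 * pi) powr (- ?d) * (K * (D ^ k * Gamma (?d + real k * \<alpha>) / fact k) * norm x powr (- (?d + real k * \<alpha>)))"
      by (intro mult_left_mono bd that scale_seq) simp
    finally show ?thesis by (simp only: B_def mult.assoc)
  qed
  have tb: "norm (stable_term \<alpha> q lam k x) \<le> B k * norm x powr (- (?d + real k * \<alpha>))" if "x \<noteq> 0" for k x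
    by (rule LIMSEQ_le_const2[OF tendsto_norm[OF regularized_term_limit[OF that]]]) (use bd'[OF that] in auto)
  have "(\<lambda>k. stable_term \<alpha> q lam k x) sums inv_fourier_density \<mu> x" if x: "x \<noteq> 0" for x
  proof -
    have T: "summable (\<lambda>k. norm (stable_term \<alpha> q lam k x)) \<and>
      ((\<lambda>n. \<Sum>k. ?P * regularized_term k (scale_seq n) x) \<longlonglongrightarrow> (\<Sum>k. stable_term \<alpha> q lam k x))"
    proof -
      have "eventually (\<lambda>(k, n). norm (?P * regularized_term k (scale_seq n) x) \<le> B k * norm x powr (- (?d + real k * \<alpha>))) (sequentially \<times>\<^sub>F sequentially)"
        by (rule always_eventually) (use bd'[OF x] in auto)
      from tannerys_theorem[OF regularized_term_limit[OF x] this sm] show ?thesis using x by simp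
    qed
    have "(\<Sum>k. ?P * regularized_term k (scale_seq n) x) = ?P * (CLINT z|lborel. cis (- (x \<bullet> z)) * char_fun \<mu> z * complex_of_real (exp (- (scale_seq n * norm z))))" for n
      by (rule sums_unique[symmetric, OF sums_mult[OF regularized_sums[OF x scale_seq(1)]]])
    then have "(\<lambda>n. \<Sum>k. ?P * regularized_term k (scale_seq n) x) \<longlonglongrightarrow> inv_fourier_density \<mu> x"
      unfolding inv_fourier_density_def by (simp only:) (rule tendsto_mult[OF tendsto_const regularized_limit])
    then have "(\<Sum>k. stable_term \<alpha> q lam k x) = inv_fourier_density \<mu> x" by (rule LIMSEQ_unique[OF conjunct2[OF T]])
    moreover have "summable (\<lambda>k. stable_term \<alpha> q lam k x)" by (rule summable_norm_cancel[OF conjunct1[OF T]])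
    ultimately show ?thesis by (simp add: sums_iff)
  qed
  then show ?thesis using that[of B] sm tb B0 by blast
qed

lemma stable_density_expansion:
  "integrable lborel (char_fun \<mu>)
    \<and> \<mu> = density lborel (\<lambda>x. ennreal (Re (inv_fourier_density \<mu> x)))
    \<and> (\<forall>x. x \<noteq> 0 \<longrightarrow>
          summable (\<lambda>k. norm (stable_term \<alpha> q lam (Suc k) x))
        \<and> (\<lambda>k. stable_term \<alpha> q lam (Suc k) x) sums inv_fourier_density \<mu> x)
    \<and> (\<forall>r>0. uniform_limit {x. r \<le> norm x} (\<lambda>n x. \<Sum>k<n. stable_term \<alpha> q lam (Suc k) x)
          (inv_fourier_density \<mu>) sequentially)"
proof -
  let ?d = "real DIM('a)"
  obtain B where B: "\<And>r. r > 0 \<Longrightarrow> summable (\<lambda>k. B k * r powr (- (?d + real k * \<alpha>)))"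
    "\<And>k x. x \<noteq> 0 \<Longrightarrow> norm (stable_term \<alpha> q lam k x) \<le> B k * norm x powr (- (?d + real k * \<alpha>))"
    "\<And>k. B k \<ge> 0" "\<And>x. x \<noteq> 0 \<Longrightarrow> (\<lambda>k. stable_term \<alpha> q lam k x) sums inv_fourier_density \<mu> x"
    using stable_series by blast
  have B': "summable (\<lambda>k. B (Suc k) * r powr (- (?d + real (Suc k) * \<alpha>)))" if "r > 0" for r
    using B(1)[OF that] by (rule summable_Suc_iff[THEN iffD2])
  have sums: "(\<lambda>k. stable_term \<alpha> q lam (Suc k) x) sums inv_fourier_density \<mu> x" if "x \<noteq> 0" for x
    using B(4)[OF that] stable_term_0[OF that] by (subst sums_Suc_iff) simp
  have abs: "summable (\<lambda>k. norm (stable_term \<alpha> q lam (Suc k) x))" if "x \<noteq> 0" for x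
  proof (rule summable_comparison_test'[OF B'[of "norm x"], of 0])
    show "norm (norm (stable_term \<alpha> q lam (Suc k) x)) \<le> B (Suc k) * norm x powr (- (?d + real (Suc k) * \<alpha>))" for k
      using B(2)[OF that, of "Suc k"] by (simp only: real_norm_def abs_norm_cancel)
  qed (use that in simp)
  have "uniform_limit {x. r \<le> norm x} (\<lambda>n x. \<Sum>k<n. stable_term \<alpha> q lam (Suc k) x) (inv_fourier_density \<mu>) sequentially" if r: "r > 0" for r
  proof -
    have U: "uniform_limit {x. r \<le> norm x} (\<lambda>n x. \<Sum>k<n. stable_term \<alpha> q lam (Suc k) x) (\<lambda>x. \<Sum>k. stable_term \<alpha> q lam (Suc k) x) sequentially"
    proof (rule Weierstrass_m_test[OF _ B'[OF r]])
      fix k and x :: 'a assume x: "x \<in> {x. r \<le> norm x}"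
      then have x0: "x \<noteq> 0" using r by auto
      have "norm (stable_term \<alpha> q lam (Suc k) x) \<le> B (Suc k) * norm x powr (- (?d + real (Suc k) * \<alpha>))" by (rule B(2)[OF x0])
      also have "\<dots> \<le> B (Suc k) * r powr (- (?d + real (Suc k) * \<alpha>))"
      \<comment> \<open>The exponent is nonpositive, so on the exterior region the majorant is
        largest at radius \<open>r\<close>.\<close>
      proof (intro mult_left_mono powr_mono2' B(3) r)
        have "0 \<le> real (Suc k) * \<alpha>" using alpha by (intro mult_nonneg_nonneg) auto
        moreover have "0 \<le> ?d" by simp
        ultimately show "- (?d + real (Suc k) * \<alpha>) \<le> 0" by linarith
      qed (use x in simp)
      finally show "norm (stable_term \<alpha> q lam (Suc k) x) \<le> B (Suc k) * r powr (- (?d + real (Suc k) * \<alpha>))" .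
    qed
    have E: "(\<Sum>k. stable_term \<alpha> q lam (Suc k) x) = inv_fourier_density \<mu> x" if "x \<in> {x. r \<le> norm x}" for x
      using that r by (intro sums_unique[symmetric] sums) auto
    show ?thesis by (rule iffD1[OF uniform_limit_cong'[OF refl E] U])
  qed
  then show ?thesis by (intro conjI allI impI char_fun_integrable mu_eq_density abs sums)
qed

end

theorem theorem4p1:
  fixes \<mu> :: "'a::euclidean_space measure" and \<alpha> :: real and q :: nat and P :: "'a \<Rightarrow> real"
  assumes dim: "DIM('a) \<ge> 2"
    and alpha: "0 < \<alpha>" "\<alpha> < 1"
    and Ppoly: "sphere_poly q P"
    and Pnz: "\<exists>u\<in>sphere 0 1. P u \<noteq> 0"
    and Pnonneg: "\<forall>u\<in>sphere 0 1. 0 \<le> P u"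
    and prob: "prob_space \<mu>" and sets: "sets \<mu> = sets borel"
    and charf: "\<forall>z. char_fun \<mu> z = exp (- complex_of_real (norm z powr \<alpha>) *
                   stable_V \<alpha> (density sphere_measure (\<lambda>v. ennreal (P v))) (z /\<^sub>R norm z))"
  shows "integrable lborel (char_fun \<mu>)
    \<and> \<mu> = density lborel (\<lambda>x. ennreal (Re (inv_fourier_density \<mu> x)))
    \<and> (\<forall>x. x \<noteq> 0 \<longrightarrow>
          summable (\<lambda>k. norm (stable_term \<alpha> q (density sphere_measure (\<lambda>v. ennreal (P v))) (Suc k) x))
        \<and> (\<lambda>k. stable_term \<alpha> q (density sphere_measure (\<lambda>v. ennreal (P v))) (Suc k) x)
             sums inv_fourier_density \<mu> x)
    \<and> (\<forall>r>0. uniform_limit {x. r \<le> norm x}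
          (\<lambda>n x. \<Sum>k<n. stable_term \<alpha> q (density sphere_measure (\<lambda>v. ennreal (P v))) (Suc k) x)
          (inv_fourier_density \<mu>) sequentially)"
proof -
  interpret polynomial_spectral \<alpha> q P by unfold_locales fact+
  interpret prob_space \<mu> by fact
  interpret polynomial_stable \<alpha> q P \<mu>
    by unfold_locales (use sets charf in \<open>simp_all add: V_def lam_def\<close>)
  show ?thesis using stable_density_expansion unfolding lam_def .
qed

end
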